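(* Let $G$ be simply connected of type $\mathbf{E}_6$. (1) The Tits section $\mathcal N_\circ$ is optimal, and $\mathcal N_\circ(s_i)^2\ne1$ for all $i$. There is one other order profile of sections, given by taking $y$ to be a non-trivial cube root of unity, which satisfies that the lifts of all $s_i$ have order $12$. (2) Two sections are $T$-conjugate if and only if they have the same value of $y$.
   Context: $F$ is an algebraically closed field, $G$ an almost-simple connected reductive group over $F$, $T$ a maximal torus, $N=N_G(T)$, $W=N/T$, $\pi:N\to W$ the projection. Let $\alpha_1,\dots,\alpha_6$ be the simple roots in Bourbaki numbering, $s_i$ the corresponding reflections, $\alpha_i^\vee$ the simple coroots. Fix a realization of the root system: isomorphisms $u_\alpha:\mathbf G_a\to U_\alpha$ onto the root subgroups with $tu_\alpha(x)t^{-1}=u_\alpha(\alpha(t)x)$, such that $\sigma_\alpha=u_\alpha(1)u_{-\alpha}(-1)u_\alpha(1)\in N$ maps to $s_\alpha$ and $u_\alpha(x)u_{-\alpha}(-x^{-1})u_\alpha(x)=\alpha^\vee(x)\sigma_\alpha$ for $x\in F^\times$; put $\sigma_i=\sigma_{\alpha_i}$. A section is a map $\mathcal S:W\to N$ with $\pi\circ\mathcal S=\mathrm{id}$ satisfying the braid relations (equivalently $\mathcal S$ is multiplicative along reduced expressions). It is determined by $\mathcal S(s_i)=t_i\sigma_i$, $t_i\in T$; $\mathcal S(s_i)$ is the lift of $s_i$. The Tits section $\mathcal N_\circ$ is the one with all $t_i=1$. The order profile of $\mathcal S$ is the Dynkin diagram with the node of each $\alpha_i$ labeled by the order of $\mathcal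 S(s_i)$. For two sections write $\mathcal S'<\mathcal S$ if the order of $\mathcal S'(s_i)$ is greater than the order of $\mathcal S(s_i)$ for all $i$; this translates to a partial order on order profiles, and a section is called optimal if it has the unique maximal order profile with respect to this partial order. Two sections $\mathcal S,\mathcal S'$ are $T$-conjugate if there is $t\in T$ with $t\mathcal S(w)t^{-1}=\mathcal S'(w)$ for all $w\in W$. Coordinates: $(x_1,\dots,x_6)$ denotes $\alpha_1^\vee(x_1)\cdots\alpha_6^\vee(x_6)\in T$. The sections are exactly those for which there is $y\in F^\times$ with $y^3=1$ such that for each $i$ the element $t_i$ is obtained from $(y^2,1,y,1,y^2,y)$ by replacing its $i$-th coordinate by an arbitrary element of $F^\times$.
   Formalization: The claims that the squares of the Tits lifts are nontrivial and that the other lifts have order 12 are stated for characteristic not 2, and the existence of the other order profile for characteristic not 3, since they fail there; optimality and part (2) hold in every characteristic. *)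

theory Defs
  imports
    "HOL-Analysis.Determinants"
    "HOL-Algebra.Group_Action"
    "HOL-Algebra.Generated_Groups"
    "HOL-Algebra.Multiplicative_Group"
    "HOL-Computational_Algebra.Polynomial"
    "HOL-Library.Extended_Nat"
begin

section \<open>Linear algebraic groups\<close>

text \<open>
  A linear algebraic group over the algebraically closed field \<open>'a\<close> is a Zariski closed subgroup
  of the group \<open>GLn\<close> of invertible matrices indexed by the finite type \<open>'n\<close>.  Coordinate rings
  are rings of functions: \<open>function_algebra C\<close> is the algebra of functions generated by \<open>C\<close>.
\<close>

definition GLn :: "('a::field ^ 'n::finite ^ 'n) monoid" where
  "GLn = \<lparr>carrier = {A. invertible A}, mult = (**), one = mat 1\<rparr>"

abbreviation subgrp :: "('a::field ^ 'n::finite ^ 'n) set \<Rightarrow> ('a ^ 'n ^ 'n) monoid" where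
  "subgrp H \<equiv> GLn\<lparr>carrier := H\<rparr>"

inductive_set function_algebra :: "('x \<Rightarrow> 'a::comm_ring_1) set \<Rightarrow> ('x \<Rightarrow> 'a) set"
  for C :: "('x \<Rightarrow> 'a) set" where
  const: "(\<lambda>_. c) \<in> function_algebra C"
| gen: "f \<in> C \<Longrightarrow> f \<in> function_algebra C"
| add: "f \<in> function_algebra C \<Longrightarrow> g \<in> function_algebra C \<Longrightarrow> (\<lambda>x. f x + g x) \<in> function_algebra C"
| mult: "f \<in> function_algebra C \<Longrightarrow> g \<in> function_algebra C \<Longrightarrow> (\<lambda>x. f x * g x) \<in> function_algebra C"

definition regular_GLn :: "('a::field ^ 'n::finite ^ 'n \<Rightarrow> 'a) set" where
  "regular_GLn = function_algebra ({\<lambda>A. A $ i $ j | i j. True} \<union> {\<lambda>A. inverse (det A)})"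

definition regular_Ga :: "('a::field \<Rightarrow> 'a) set" where
  "regular_Ga = function_algebra {\<lambda>x. x}"

definition regular_Gm :: "('a::field \<Rightarrow> 'a) set" where
  "regular_Gm = function_algebra {\<lambda>x. x, \<lambda>x. inverse x}"

definition regular_Gm_power :: "nat \<Rightarrow> ((nat \<Rightarrow> 'a::field) \<Rightarrow> 'a) set" where
  "regular_Gm_power r =
     function_algebra ({\<lambda>x. x k | k. k < r} \<union> {\<lambda>x. inverse (x k) | k. k < r})"

definition regular_map ::
    "('x \<Rightarrow> 'a::field) set \<Rightarrow> 'x set \<Rightarrow> ('x \<Rightarrow> 'a ^ 'n::finite ^ 'n) \<Rightarrow> bool" where
  "regular_map \<O> X f \<longleftrightarrow> (\<forall>i j. \<exists>g\<in>\<O>. \<forall>x\<in>X. f x $ i $ j = g x)"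

definition zariski_closed :: "('a::field ^ 'n::finite ^ 'n) set \<Rightarrow> bool" where
  "zariski_closed X \<longleftrightarrow>
     (\<exists>P\<subseteq>regular_GLn. X = {A \<in> carrier GLn. \<forall>f\<in>P. f A = 0})"

definition zariski_connected :: "('a::field ^ 'n::finite ^ 'n) set \<Rightarrow> bool" where
  "zariski_connected X \<longleftrightarrow>
     (\<forall>A B. zariski_closed A \<and> zariski_closed B \<and> A \<inter> B = {} \<and> A \<union> B = X
        \<longrightarrow> A = {} \<or> B = {})"

definition algebraic_group :: "('a::field ^ 'n::finite ^ 'n) set \<Rightarrow> bool" where
  "algebraic_group H \<longleftrightarrow> subgroup H GLn \<and> zariski_closed H"

definition unipotent :: "'a::field ^ 'n::finite ^ 'n \<Rightarrow> bool" where
  "unipotent A \<longleftrightarrow> (\<exists>k. ((\<lambda>B. (A - mat 1) ** B) ^^ k) (mat 1) = 0)"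

definition connected_reductive :: "('a::field ^ 'n::finite ^ 'n) set \<Rightarrow> bool" where
  "connected_reductive G \<longleftrightarrow>
     algebraic_group G \<and> zariski_connected G \<and>
     (\<forall>U. algebraic_group U \<and> zariski_connected U \<and> U \<lhd> subgrp G \<and> (\<forall>A\<in>U. unipotent A)
        \<longrightarrow> U = {mat 1})"

definition almost_simple :: "('a::field ^ 'n::finite ^ 'n) set \<Rightarrow> bool" where
  "almost_simple G \<longleftrightarrow>
     \<not> comm_group (subgrp G) \<and>
     (\<forall>H. algebraic_group H \<and> H \<lhd> subgrp G \<longrightarrow> H = G \<or> finite H)"

definition Gm_power :: "nat \<Rightarrow> (nat \<Rightarrow> 'a::field) set" where
  "Gm_power r = {..<r} \<rightarrow>\<^sub>E (UNIV - {0})"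

text \<open>A torus is an algebraic group isomorphic, as an algebraic group, to a power of \<open>Gm\<close>.\<close>

definition torus :: "('a::field ^ 'n::finite ^ 'n) set \<Rightarrow> bool" where
  "torus T \<longleftrightarrow> algebraic_group T \<and>
     (\<exists>r \<phi>. bij_betw \<phi> (Gm_power r) T \<and>
        (\<forall>x\<in>Gm_power r. \<forall>y\<in>Gm_power r. \<phi> (\<lambda>k\<in>{..<r}. x k * y k) = \<phi> x ** \<phi> y) \<and>
        regular_map (regular_Gm_power r) (Gm_power r) \<phi> \<and>
        (\<forall>k<r. \<exists>g\<in>regular_GLn. \<forall>x\<in>Gm_power r. g (\<phi> x) = x k))"

definition maximal_torus :: "('a::field ^ 'n::finite ^ 'n) set \<Rightarrow> ('a ^ 'n ^ 'n) set \<Rightarrow> bool" where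
  "maximal_torus G T \<longleftrightarrow> torus T \<and> T \<subseteq> G \<and> (\<forall>T'. torus T' \<and> T' \<subseteq> G \<and> T \<subseteq> T' \<longrightarrow> T' = T)"

text \<open>Characters are extensional on \<open>T\<close>, so that equality of characters is equality of functions.\<close>

definition characters :: "('a::field ^ 'n::finite ^ 'n) set \<Rightarrow> ('a ^ 'n ^ 'n \<Rightarrow> 'a) set" where
  "characters T = {\<xi> \<in> T \<rightarrow>\<^sub>E (UNIV - {0}).
     (\<forall>s\<in>T. \<forall>t\<in>T. \<xi> (s ** t) = \<xi> s * \<xi> t) \<and> (\<exists>g\<in>regular_GLn. \<forall>t\<in>T. \<xi> t = g t)}"

definition neg_char ::
    "('a::field ^ 'n::finite ^ 'n) set \<Rightarrow> ('a ^ 'n ^ 'n \<Rightarrow> 'a) \<Rightarrow> ('a ^ 'n ^ 'n \<Rightarrow> 'a)" where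
  "neg_char T \<xi> = (\<lambda>t\<in>T. inverse (\<xi> t))"

definition cocharacters :: "('a::field ^ 'n::finite ^ 'n) set \<Rightarrow> ('a \<Rightarrow> 'a ^ 'n ^ 'n) set" where
  "cocharacters T = {\<nu>.
     (\<forall>x\<in>UNIV - {0}. \<nu> x \<in> T) \<and>
     (\<forall>x\<in>UNIV - {0}. \<forall>y\<in>UNIV - {0}. \<nu> (x * y) = \<nu> x ** \<nu> y) \<and>
     regular_map regular_Gm (UNIV - {0}) \<nu>}"

definition Ga_iso :: "('a::field ^ 'n::finite ^ 'n) set \<Rightarrow> ('a \<Rightarrow> 'a ^ 'n ^ 'n) \<Rightarrow> bool" where
  "Ga_iso U u \<longleftrightarrow> algebraic_group U \<and> bij_betw u UNIV U \<and> (\<forall>x y. u (x + y) = u x ** u y) \<and>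
     regular_map regular_Ga UNIV u \<and> (\<exists>g\<in>regular_GLn. \<forall>x. g (u x) = x)"

definition root_iso ::
    "('a::field ^ 'n::finite ^ 'n) set \<Rightarrow> ('a ^ 'n ^ 'n) set \<Rightarrow> ('a ^ 'n ^ 'n \<Rightarrow> 'a)
      \<Rightarrow> ('a ^ 'n ^ 'n) set \<Rightarrow> ('a \<Rightarrow> 'a ^ 'n ^ 'n) \<Rightarrow> bool" where
  "root_iso G T \<beta> U u \<longleftrightarrow> U \<subseteq> G \<and> Ga_iso U u \<and>
     (\<forall>t\<in>T. \<forall>x. t ** u x ** inv\<^bsub>GLn\<^esub> t = u (\<beta> t * x))"

text \<open>
  For a connected reductive group the roots are the nontrivial characters \<open>\<beta>\<close> for which there is
  an isomorphism \<open>u\<close> of \<open>Ga\<close> onto a \<^emph>\<open>unique\<close> closed subgroup of \<open>G\<close> with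
  \<open>t u(x) t\<^sup>-\<^sup>1 = u(\<beta>(t) x)\<close>; that subgroup is the root subgroup
  (Springer, Linear Algebraic Groups, 8.1.1).
\<close>

definition roots ::
    "('a::field ^ 'n::finite ^ 'n) set \<Rightarrow> ('a ^ 'n ^ 'n) set \<Rightarrow> ('a ^ 'n ^ 'n \<Rightarrow> 'a) set" where
  "roots G T = {\<beta> \<in> characters T. (\<exists>t\<in>T. \<beta> t \<noteq> 1) \<and> (\<exists>!U. \<exists>u. root_iso G T \<beta> U u)}"

definition root_subgroup ::
    "('a::field ^ 'n::finite ^ 'n) set \<Rightarrow> ('a ^ 'n ^ 'n) set \<Rightarrow> ('a ^ 'n ^ 'n \<Rightarrow> 'a)
      \<Rightarrow> ('a ^ 'n ^ 'n) set" where
  "root_subgroup G T \<beta> = (THE U. \<exists>u. root_iso G T \<beta> U u)"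


section \<open>Simply connected groups of type \<open>E\<^sub>6\<close> with a realization\<close>

record ('a, 'n) realization =
  grp :: "('a ^ 'n::finite ^ 'n) set"
  tor :: "('a ^ 'n::finite ^ 'n) set"
  simple_root :: "nat \<Rightarrow> 'a ^ 'n::finite ^ 'n \<Rightarrow> 'a"
  coroot :: "('a ^ 'n::finite ^ 'n \<Rightarrow> 'a) \<Rightarrow> 'a \<Rightarrow> 'a ^ 'n::finite ^ 'n"
  root_hom :: "('a ^ 'n::finite ^ 'n \<Rightarrow> 'a) \<Rightarrow> 'a \<Rightarrow> 'a ^ 'n::finite ^ 'n"

definition norm_tor :: "('a::field, 'n::finite) realization \<Rightarrow> ('a ^ 'n ^ 'n) set" where
  "norm_tor R = {n \<in> grp R. (\<lambda>t. n ** t ** inv\<^bsub>GLn\<^esub> n) ` tor R = tor R}"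

definition weyl_group :: "('a::field, 'n::finite) realization \<Rightarrow> ('a ^ 'n ^ 'n) set monoid" where
  "weyl_group R = subgrp (norm_tor R) Mod tor R"

definition proj :: "('a::field, 'n::finite) realization \<Rightarrow> 'a ^ 'n ^ 'n \<Rightarrow> ('a ^ 'n ^ 'n) set" where
  "proj R n = tor R #>\<^bsub>GLn\<^esub> n"

definition sigma_root ::
    "('a::field, 'n::finite) realization \<Rightarrow> ('a ^ 'n ^ 'n \<Rightarrow> 'a) \<Rightarrow> 'a ^ 'n ^ 'n" where
  "sigma_root R \<beta> =
     root_hom R \<beta> 1 ** root_hom R (neg_char (tor R) \<beta>) (-1) ** root_hom R \<beta> 1"

abbreviation sigma :: "('a::field, 'n::finite) realization \<Rightarrow> nat \<Rightarrow> 'a ^ 'n ^ 'n" where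
  "sigma R i \<equiv> sigma_root R (simple_root R i)"

text \<open>
  \<open>acts_as_reflection R \<beta> n\<close>: the class of \<open>n\<close> in \<open>W\<close> is the reflection \<open>s\<^sub>\<beta>\<close>, acting on the
  torus by \<open>t \<mapsto> t \<cdot> \<beta>\<^sup>\<or>(\<beta>(t))\<^sup>-\<^sup>1\<close>.
\<close>

definition acts_as_reflection ::
    "('a::field, 'n::finite) realization \<Rightarrow> ('a ^ 'n ^ 'n \<Rightarrow> 'a) \<Rightarrow> 'a ^ 'n ^ 'n \<Rightarrow> bool" where
  "acts_as_reflection R \<beta> n \<longleftrightarrow> n \<in> norm_tor R \<and>
     (\<forall>t\<in>tor R. n ** t ** inv\<^bsub>GLn\<^esub> n = t ** inv\<^bsub>GLn\<^esub> (coroot R \<beta> (\<beta> t)))"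

definition simple_reflection ::
    "('a::field, 'n::finite) realization \<Rightarrow> nat \<Rightarrow> ('a ^ 'n ^ 'n) set" where
  "simple_reflection R i = proj R (sigma R i)"

text \<open>Bourbaki numbering: the chain 1-3-4-5-6, with node 2 attached to node 4.\<close>

definition E6_edges :: "nat set set" where
  "E6_edges = {{1, 3}, {3, 4}, {4, 5}, {5, 6}, {2, 4}}"

definition E6_cartan :: "nat \<Rightarrow> nat \<Rightarrow> int" where
  "E6_cartan i j = (if i = j then 2 else if {i, j} \<in> E6_edges then -1 else 0)"

text \<open>The element written \<open>(x\<^sub>1, \<dots>, x\<^sub>6)\<close>, i.e. the product of the \<open>\<alpha>\<^sub>i\<^sup>\<or>(x\<^sub>i)\<close>.\<close>

definition tor_elt :: "('a::field, 'n::finite) realization \<Rightarrow> (nat \<Rightarrow> 'a) \<Rightarrow> 'a ^ 'n ^ 'n" where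
  "tor_elt R x = foldr (\<lambda>i A. coroot R (simple_root R i) (x i) ** A) [1, 2, 3, 4, 5, 6] (mat 1)"

definition is_base :: "('a::field, 'n::finite) realization \<Rightarrow> bool" where
  "is_base R \<longleftrightarrow>
     (\<forall>i\<in>{1..6}. simple_root R i \<in> roots (grp R) (tor R)) \<and>
     (\<forall>k::nat \<Rightarrow> int. (\<forall>t\<in>tor R. (\<Prod>i\<in>{1..6}. simple_root R i t powi k i) = 1)
        \<longrightarrow> (\<forall>i\<in>{1..6}. k i = 0)) \<and>
     (\<forall>\<beta>\<in>roots (grp R) (tor R). \<exists>k::nat \<Rightarrow> int.
        (\<forall>t\<in>tor R. \<beta> t = (\<Prod>i\<in>{1..6}. simple_root R i t powi k i)) \<and>
        ((\<forall>i\<in>{1..6}. k i \<ge> 0) \<or> (\<forall>i\<in>{1..6}. k i \<le> 0)))"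

definition type_E6 :: "('a::field, 'n::finite) realization \<Rightarrow> bool" where
  "type_E6 R \<longleftrightarrow> is_base R \<and>
     (\<forall>i\<in>{1..6}. \<forall>j\<in>{1..6}. \<forall>x\<in>UNIV - {0}.
        simple_root R j (coroot R (simple_root R i) x) = x powi E6_cartan i j)"

text \<open>Simply connected: every cocharacter of \<open>T\<close> is an integral combination of simple coroots.\<close>

definition simply_connected_group :: "('a::field, 'n::finite) realization \<Rightarrow> bool" where
  "simply_connected_group R \<longleftrightarrow>
     (\<forall>\<nu>\<in>cocharacters (tor R). \<exists>k::nat \<Rightarrow> int. \<forall>x\<in>UNIV - {0}.
        \<nu> x = tor_elt R (\<lambda>i. x powi k i))"

definition is_realization :: "('a::field, 'n::finite) realization \<Rightarrow> bool" where
  "is_realization R \<longleftrightarrow> (\<forall>\<beta>\<in>roots (grp R) (tor R).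
     root_iso (grp R) (tor R) \<beta> (root_subgroup (grp R) (tor R) \<beta>) (root_hom R \<beta>) \<and>
     coroot R \<beta> \<in> cocharacters (tor R) \<and>
     (\<forall>x\<in>UNIV - {0}. \<beta> (coroot R \<beta> x) = x ^ 2) \<and>
     acts_as_reflection R \<beta> (sigma_root R \<beta>) \<and>
     (\<forall>x\<in>UNIV - {0}.
        root_hom R \<beta> x ** root_hom R (neg_char (tor R) \<beta>) (- inverse x) ** root_hom R \<beta> x
          = coroot R \<beta> x ** sigma_root R \<beta>))"

text \<open>
  The last conjunct identifies \<open>N/T\<close> with the Weyl group of the root system, in the form that
  \<open>N/T\<close> is generated by the simple reflections.  It is a theorem for every connected reductive
  group, hence mathematically redundant; it is listed so that structure theory (Borel subgroups,
  self-centralizing maximal tori) need not be developed.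
\<close>

definition simply_connected_E6 :: "('a::alg_closed_field, 'n::finite) realization \<Rightarrow> bool" where
  "simply_connected_E6 R \<longleftrightarrow>
     connected_reductive (grp R) \<and> almost_simple (grp R) \<and> maximal_torus (grp R) (tor R) \<and>
     is_realization R \<and> type_E6 R \<and> simply_connected_group R \<and>
     generate (weyl_group R) (simple_reflection R ` {1..6}) = carrier (weyl_group R)"


section \<open>Sections of the Weyl group\<close>

definition word_prod :: "('a::field, 'n::finite) realization \<Rightarrow> nat list \<Rightarrow> ('a ^ 'n ^ 'n) set" where
  "word_prod R is =
     foldr (\<lambda>i w. simple_reflection R i \<otimes>\<^bsub>weyl_group R\<^esub> w) is \<one>\<^bsub>weyl_group R\<^esub>"

definition reduced :: "('a::field, 'n::finite) realization \<Rightarrow> nat list \<Rightarrow> bool" where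
  "reduced R is \<longleftrightarrow> set is \<subseteq> {1..6} \<and>
     (\<forall>js. set js \<subseteq> {1..6} \<and> word_prod R js = word_prod R is \<longrightarrow> length is \<le> length js)"

text \<open>
  The braid relations for a set-theoretic section are imposed in the form of multiplicativity
  along reduced expressions, so that a section is determined by its values on the \<open>s\<^sub>i\<close>.
\<close>

definition sections ::
    "('a::field, 'n::finite) realization \<Rightarrow> (('a ^ 'n ^ 'n) set \<Rightarrow> 'a ^ 'n ^ 'n) set" where
  "sections R = {\<S> \<in> carrier (weyl_group R) \<rightarrow>\<^sub>E norm_tor R.
     (\<forall>w\<in>carrier (weyl_group R). proj R (\<S> w) = w) \<and>
     (\<forall>is. reduced R is \<longrightarrow>
        \<S> (word_prod R is) = foldr (\<lambda>i n. \<S> (simple_reflection R i) ** n) is (mat 1))}"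

definition tits_section ::
    "('a::field, 'n::finite) realization \<Rightarrow> ('a ^ 'n ^ 'n) set \<Rightarrow> 'a ^ 'n ^ 'n" where
  "tits_section R =
     (THE \<S>. \<S> \<in> sections R \<and> (\<forall>i\<in>{1..6}. \<S> (simple_reflection R i) = sigma R i))"

text \<open>\<open>group.ord\<close> is 0 on elements of infinite order.\<close>

definition elt_order :: "'a::field ^ 'n::finite ^ 'n \<Rightarrow> enat" where
  "elt_order A = (if group.ord GLn A = 0 then \<infinity> else enat (group.ord GLn A))"

text \<open>An order profile is the labelling of the nodes \<open>1, \<dots>, 6\<close> of the Dynkin diagram.\<close>

definition order_profile ::
    "('a::field, 'n::finite) realization \<Rightarrow> (('a ^ 'n ^ 'n) set \<Rightarrow> 'a ^ 'n ^ 'n) \<Rightarrow> nat \<Rightarrow> enat" where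
  "order_profile R \<S> = (\<lambda>i\<in>{1..6}. elt_order (\<S> (simple_reflection R i)))"

definition profile_less :: "(nat \<Rightarrow> enat) \<Rightarrow> (nat \<Rightarrow> enat) \<Rightarrow> bool" where
  "profile_less P' P \<longleftrightarrow> (\<forall>i\<in>{1..6}. P' i > P i)"

definition order_profiles :: "('a::field, 'n::finite) realization \<Rightarrow> (nat \<Rightarrow> enat) set" where
  "order_profiles R = order_profile R ` sections R"

definition maximal_profile :: "('a::field, 'n::finite) realization \<Rightarrow> (nat \<Rightarrow> enat) \<Rightarrow> bool" where
  "maximal_profile R P \<longleftrightarrow> P \<in> order_profiles R \<and> \<not> (\<exists>P'\<in>order_profiles R. profile_less P P')"

definition optimal ::
    "('a::field, 'n::finite) realization \<Rightarrow> (('a ^ 'n ^ 'n) set \<Rightarrow> 'a ^ 'n ^ 'n) \<Rightarrow> bool" where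
  "optimal R \<S> \<longleftrightarrow> \<S> \<in> sections R \<and> maximal_profile R (order_profile R \<S>) \<and>
     (\<forall>P. maximal_profile R P \<longrightarrow> P = order_profile R \<S>)"

definition T_conjugate ::
    "('a::field, 'n::finite) realization \<Rightarrow> (('a ^ 'n ^ 'n) set \<Rightarrow> 'a ^ 'n ^ 'n)
      \<Rightarrow> (('a ^ 'n ^ 'n) set \<Rightarrow> 'a ^ 'n ^ 'n) \<Rightarrow> bool" where
  "T_conjugate R \<S> \<S>' \<longleftrightarrow>
     (\<exists>t\<in>tor R. \<forall>w\<in>carrier (weyl_group R). t ** \<S> w ** inv\<^bsub>GLn\<^esub> t = \<S>' w)"

definition E6_coords :: "'a::field \<Rightarrow> nat \<Rightarrow> 'a" where
  "E6_coords y i = [y^2, 1, y, 1, y^2, y] ! (i - 1)"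

definition has_y_value ::
    "('a::field, 'n::finite) realization \<Rightarrow> (('a ^ 'n ^ 'n) set \<Rightarrow> 'a ^ 'n ^ 'n) \<Rightarrow> 'a \<Rightarrow> bool" where
  "has_y_value R \<S> y \<longleftrightarrow> y ^ 3 = 1 \<and>
     (\<forall>i\<in>{1..6}. \<exists>z. z \<noteq> 0 \<and>
        \<S> (simple_reflection R i) = tor_elt R ((E6_coords y)(i := z)) ** sigma R i)"

end

theory Submission
  imports Defs
begin

text \<open>
  The braid relations for the Tits lifts come from the root subgroups.  If \<open>n \<in> N\<close> carries a root
  \<open>\<alpha>\<close> to \<open>\<beta>\<close>, then equivariance under the torus forces \<open>n u\<^sub>\<alpha>(x) n\<^sup>-\<^sup>1 = u\<^sub>\<beta>(c x)\<close>
  (\<open>conj_root_hom\<close>), and a computation in rank one (\<open>reflection_triple\<close>) turns this into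
  \<open>n \<sigma>\<^sub>\<alpha> n\<^sup>-\<^sup>1 \<in> \<beta>\<^sup>\<or>(F\<^sup>\<times>) \<sigma>\<^sub>\<beta>\<close> (\<open>conj_sigma\<close>).  Simple connectedness makes the simple coroots
  coordinates on the torus (\<open>tor_elt_coordinates\<close>).  Now, for adjacent nodes,
  \<open>\<sigma>\<^sub>i \<sigma>\<^sub>j \<sigma>\<^sub>i\<close> and \<open>\<sigma>\<^sub>j \<sigma>\<^sub>i \<sigma>\<^sub>j\<close> differ by an element that lies in the images of both \<open>\<alpha>\<^sub>i\<^sup>\<or>\<close>
  and \<open>\<alpha>\<^sub>j\<^sup>\<or>\<close>, and these meet trivially (\<open>sigma_braid\<close>).

  The action of \<open>N/T\<close> on the roots, each of which is positive or negative, gives the exchange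
  condition and with it Matsumoto's theorem (\<open>matsumoto\<close>).  Hence lifts of the simple reflections
  extend to a section exactly when they satisfy the braid relations; in particular the Tits
  section exists.

  A section is given by lifts \<open>t\<^sub>i \<sigma>\<^sub>i\<close>.  Comparing coordinates in the braid relations leaves a
  multiplicative system whose solutions are as follows (\<open>section_has_y_value\<close>): apart from its free
  \<open>i\<close>-th coordinate, \<open>t\<^sub>i\<close> agrees with the central element \<open>c = (y\<^sup>2, 1, y, 1, y\<^sup>2, y)\<close>, where
  \<open>y\<^sup>3 = 1\<close>.  The free coordinate cancels in \<open>(t\<^sub>i \<sigma>\<^sub>i)\<^sup>2 = c\<^sup>2 \<alpha>\<^sub>i\<^sup>\<or>(-1)\<close>, so the order of the
  lift is \<open>2\<close> or \<open>6\<close> times the order of \<open>-1\<close> in \<open>F\<^sup>\<times>\<close>, according to whether \<open>y = 1\<close> or not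
  (\<open>elt_order_lift\<close>).  Conjugation by \<open>t \<in> T\<close> multiplies the free coordinate by \<open>\<alpha>\<^sub>i(t)\<close> and
  fixes the others.  As the values \<open>\<alpha>\<^sub>i(t)\<close> can be prescribed (\<open>exists_tor_elt_roots\<close>), \<open>y\<close>
  classifies sections up to conjugation.
\<close>

section \<open>The general linear group and conjugation\<close>

lemma group_GLn: "group (GLn :: ('a::field ^ 'n::finite ^ 'n) monoid)"
proof (rule groupI)
  fix A :: "'a ^ 'n ^ 'n"
  assume "A \<in> carrier GLn"
  then obtain B where "A ** B = mat 1" "B ** A = mat 1"
    by (auto simp: GLn_def invertible_def)
  then show "\<exists>B\<in>carrier GLn. B \<otimes>\<^bsub>GLn\<^esub> A = \<one>\<^bsub>GLn\<^esub>"
    by (auto simp: GLn_def invertible_def)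
next
  show "\<one>\<^bsub>GLn\<^esub> \<in> carrier (GLn :: ('a ^ 'n ^ 'n) monoid)"
    by (simp add: GLn_def invertible_def)
qed (auto simp: GLn_def invertible_mult matrix_mul_assoc)

lemma GLn_simps [simp]:
  "carrier GLn = {A. invertible A}" "A \<otimes>\<^bsub>GLn\<^esub> B = A ** B" "\<one>\<^bsub>GLn\<^esub> = mat 1"
  by (simp_all add: GLn_def)

abbreviation minv :: "'a::field ^ 'n::finite ^ 'n \<Rightarrow> 'a ^ 'n ^ 'n" where
  "minv A \<equiv> inv\<^bsub>GLn\<^esub> A"

lemma invertible_mat_1 [simp]: "invertible (mat 1 :: 'a::field ^ 'n::finite ^ 'n)"
  using group.is_monoid [OF group_GLn] monoid.one_closed by fastforce

lemma minv_simps [simp]: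
  fixes A :: "'a::field ^ 'n::finite ^ 'n"
  assumes "invertible A"
  shows "invertible (minv A)" "minv A ** A = mat 1" "A ** minv A = mat 1"
    "minv A ** (A ** B) = B" "A ** (minv A ** B) = B" "minv (minv A) = A"
  using group.inv_closed [OF group_GLn, of A] group.l_inv [OF group_GLn, of A]
    group.r_inv [OF group_GLn, of A] group.inv_inv [OF group_GLn, of A] assms
  by (simp_all add: matrix_mul_assoc)

lemma minv_mult:
  fixes A :: "'a::field ^ 'n::finite ^ 'n"
  shows "\<lbrakk>invertible A; invertible B\<rbrakk> \<Longrightarrow> minv (A ** B) = minv B ** minv A"
  using group.inv_mult_group [OF group_GLn, of A B] by simp

lemma minv_one [simp]: "minv (mat 1 :: 'a::field ^ 'n::finite ^ 'n) = mat 1"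
  using monoid.inv_one [OF group.is_monoid [OF group_GLn]] by simp

lemma minv_unique:
  fixes A :: "'a::field ^ 'n::finite ^ 'n"
  shows "\<lbrakk>A ** B = mat 1; invertible A\<rbrakk> \<Longrightarrow> minv A = B"
  by (metis minv_simps(4) matrix_mul_rid)

lemma mult_cancel:
  fixes A B C :: "'a::field ^ 'n::finite ^ 'n"
  shows "invertible A \<Longrightarrow> A ** B = A ** C \<longleftrightarrow> B = C" "invertible A \<Longrightarrow> B ** A = C ** A \<longleftrightarrow> B = C"
proof -
  assume A: "invertible A"
  show "A ** B = A ** C \<longleftrightarrow> B = C"
    using minv_simps(4) [OF A, of B] minv_simps(4) [OF A, of C] by metis
  have "D ** A ** minv A = D" for D :: "'a ^ 'n ^ 'n" using A by (simp add: matrix_mul_assoc [symmetric])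
  then show "B ** A = C ** A \<longleftrightarrow> B = C" by metis
qed

lemmas mult_assoc = matrix_mul_assoc [symmetric]

definition conj_by :: "'a::field ^ 'n::finite ^ 'n \<Rightarrow> 'a ^ 'n ^ 'n \<Rightarrow> 'a ^ 'n ^ 'n" where
  "conj_by n A = n ** A ** minv n"

lemma conj_by_mult:
  "invertible n \<Longrightarrow> conj_by n (A ** B) = conj_by n A ** conj_by n B"
  by (simp add: conj_by_def mult_assoc)

lemma conj_by_comp:
  "\<lbrakk>invertible n; invertible m\<rbrakk> \<Longrightarrow> conj_by n (conj_by m A) = conj_by (n ** m) A"
  by (simp add: conj_by_def mult_assoc minv_mult)

lemma conj_by_one [simp]: "invertible n \<Longrightarrow> conj_by n (mat 1) = mat 1" "conj_by (mat 1) A = A"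
  by (simp_all add: conj_by_def)

lemma conj_by_cancel [simp]:
  assumes "invertible n"
  shows "conj_by (minv n) (conj_by n A) = A" "conj_by n (conj_by (minv n) A) = A"
  using assms by (simp_all add: conj_by_comp)

lemma conj_by_minv:
  "\<lbrakk>invertible n; invertible A\<rbrakk> \<Longrightarrow> conj_by n (minv A) = minv (conj_by n A)"
  by (simp add: conj_by_def minv_mult invertible_mult mult_assoc)

lemma invertible_conj_by [simp]: "\<lbrakk>invertible n; invertible A\<rbrakk> \<Longrightarrow> invertible (conj_by n A)"
  by (simp add: conj_by_def invertible_mult)

lemma conj_by_inj: "invertible n \<Longrightarrow> conj_by n A = conj_by n B \<longleftrightarrow> A = B"
  by (metis conj_by_cancel(1))

lemma conj_by_eq_iff: "invertible n \<Longrightarrow> conj_by n A = B \<longleftrightarrow> n ** A = B ** n"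
proof -
  assume n: "invertible n"
  have "conj_by n A = B \<longleftrightarrow> conj_by n A ** n = B ** n" using n by (simp add: mult_cancel)
  then show ?thesis using n by (simp add: conj_by_def mult_assoc)
qed

lemma subgroup_GLn_D:
  assumes "subgroup H GLn"
  shows "A \<in> H \<Longrightarrow> invertible A" "\<lbrakk>A \<in> H; B \<in> H\<rbrakk> \<Longrightarrow> A ** B \<in> H" "mat 1 \<in> H" "A \<in> H \<Longrightarrow> minv A \<in> H"
  using subgroup.subset [OF assms] subgroup.m_closed [OF assms] subgroup.one_closed [OF assms]
    subgroup.m_inv_closed [OF assms] by auto

lemma subgroup_GLn_I:
  assumes "\<And>A. A \<in> H \<Longrightarrow> invertible A" "\<And>A B. \<lbrakk>A \<in> H; B \<in> H\<rbrakk> \<Longrightarrow> A ** B \<in> H"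
    "mat 1 \<in> H" "\<And>A. A \<in> H \<Longrightarrow> minv A \<in> H"
  shows "subgroup H GLn"
  using assms by (intro subgroup.intro) auto

lemma subgroup_conj_by:
  assumes H: "subgroup H GLn" and n: "invertible n"
  shows "subgroup (conj_by n ` H) GLn"
  using subgroup_GLn_D [OF H] n
  by (intro subgroup_GLn_I)
    (auto simp: conj_by_mult [symmetric] conj_by_minv [symmetric] intro: image_eqI [of _ _ "mat 1"])


section \<open>Regular functions\<close>

text \<open>
  The set \<open>X\<close> is there for curves \<open>h\<close> that are regular only on the nonzero elements.
\<close>
lemma function_algebra_comp:
  assumes "f \<in> function_algebra C"
    and "\<And>g. g \<in> C \<Longrightarrow> \<exists>g'\<in>function_algebra D. \<forall>x\<in>X. g (h x) = g' x"
  shows "\<exists>f'\<in>function_algebra D. \<forall>x\<in>X. f (h x) = f' x"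
  using assms(1)
proof induction
  case (const c)
  show ?case by (rule bexI [OF _ function_algebra.const [of c]]) auto
next
  case (gen f)
  then show ?case by (rule assms(2))
next
  case (add f g)
  then obtain f' g' where "f' \<in> function_algebra D" "\<forall>x\<in>X. f (h x) = f' x"
    "g' \<in> function_algebra D" "\<forall>x\<in>X. g (h x) = g' x" by blast
  then show ?case by (intro bexI [of _ "\<lambda>x. f' x + g' x"]) (simp_all add: function_algebra.add)
next
  case (mult f g)
  then obtain f' g' where "f' \<in> function_algebra D" "\<forall>x\<in>X. f (h x) = f' x"
    "g' \<in> function_algebra D" "\<forall>x\<in>X. g (h x) = g' x" by blast
  then show ?case by (intro bexI [of _ "\<lambda>x. f' x * g' x"]) (simp_all add: function_algebra.mult)
qed

lemma function_algebra_sum: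
  "(\<And>i. i \<in> S \<Longrightarrow> f i \<in> function_algebra C) \<Longrightarrow> (\<lambda>x. \<Sum>i\<in>S. f i x) \<in> function_algebra C"
  by (induction S rule: infinite_finite_induct)
    (simp_all add: function_algebra.const function_algebra.add)

lemma function_algebra_prod:
  "(\<And>i. i \<in> S \<Longrightarrow> f i \<in> function_algebra C) \<Longrightarrow> (\<lambda>x. \<Prod>i\<in>S. f i x) \<in> function_algebra C"
  by (induction S rule: infinite_finite_induct)
    (simp_all add: function_algebra.const function_algebra.mult)

lemma conj_by_entry:
  "conj_by n A $ i $ j = (\<Sum>l\<in>UNIV. (\<Sum>k\<in>UNIV. n $ i $ k * A $ k $ l) * minv n $ l $ j)"
  by (simp add: conj_by_def matrix_matrix_mult_def)

lemma det_conj_by: "invertible n \<Longrightarrow> det (conj_by n A) = det A"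
proof -
  assume n: "invertible n"
  have "det n * det (minv n) = 1" using n by (simp add: det_mul [symmetric])
  then show ?thesis by (simp add: conj_by_def det_mul mult.commute mult.left_commute)
qed

lemma regular_GLn_conj_by:
  fixes n :: "'a::field ^ 'n::finite ^ 'n"
  assumes f: "f \<in> regular_GLn" and n: "invertible n"
  shows "(\<lambda>A. f (conj_by n A)) \<in> regular_GLn"
proof -
  let ?D = "{\<lambda>A :: 'a ^ 'n ^ 'n. A $ i $ j | i j. True} \<union> {\<lambda>A. inverse (det A)}"
  have "\<exists>g'\<in>function_algebra ?D. \<forall>A\<in>UNIV. g (conj_by n A) = g' A" if "g \<in> ?D" for g
  proof -
    have entry: "(\<lambda>A :: 'a ^ 'n ^ 'n. A $ i $ j) \<in> function_algebra ?D" for i j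
      by (rule function_algebra.gen) blast
    have "(\<lambda>A :: 'a ^ 'n ^ 'n. inverse (det A)) \<in> function_algebra ?D"
      by (rule function_algebra.gen) blast
    moreover have "(\<lambda>A :: 'a ^ 'n ^ 'n. conj_by n A $ i $ j) \<in> function_algebra ?D" for i j
      unfolding conj_by_entry
      by (intro function_algebra_sum function_algebra.mult function_algebra.const entry)
    ultimately have "(\<lambda>A. g (conj_by n A)) \<in> function_algebra ?D"
      using that by (auto simp: det_conj_by n)
    then show ?thesis by (intro bexI [of _ "\<lambda>A. g (conj_by n A)"]) auto
  qed
  then obtain f' where "f' \<in> function_algebra ?D" "\<forall>A\<in>UNIV. f (conj_by n A) = f' A"
    using function_algebra_comp [of f ?D ?D UNIV "conj_by n"] f by (auto simp: regular_GLn_def)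
  moreover have "(\<lambda>A. f (conj_by n A)) = f'" using calculation by auto
  ultimately show ?thesis by (simp add: regular_GLn_def)
qed

lemma algebraic_group_conj_by:
  assumes H: "algebraic_group H" and n: "invertible n"
  shows "algebraic_group (conj_by n ` H)"
proof -
  obtain P where P: "P \<subseteq> regular_GLn" "H = {A \<in> carrier GLn. \<forall>f\<in>P. f A = 0}"
    using H by (auto simp: algebraic_group_def zariski_closed_def)
  let ?P = "(\<lambda>f A. f (conj_by (minv n) A)) ` P"
  have "conj_by n ` H = {A \<in> carrier GLn. \<forall>f\<in>?P. f A = 0}"
  proof (intro equalityI subsetI)
    fix A assume A: "A \<in> {A \<in> carrier GLn. \<forall>f\<in>?P. f A = 0}"
    then have "conj_by (minv n) A \<in> H" using n by (auto simp: P)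
    then show "A \<in> conj_by n ` H" using n by (metis conj_by_cancel(2) image_eqI)
  qed (use n P in auto)
  moreover have "?P \<subseteq> regular_GLn" using P n by (auto intro: regular_GLn_conj_by)
  ultimately show ?thesis
    using H n subgroup_conj_by unfolding algebraic_group_def zariski_closed_def by blast
qed

text \<open>
  Over a finite field, \<open>1 + \<Prod>\<^sub>c (X - c)\<close> has no root.
\<close>
lemma infinite_UNIV_alg_closed: "infinite (UNIV :: 'a::alg_closed_field set)"
proof
  assume fin: "finite (UNIV :: 'a set)"
  let ?p = "\<Prod>c\<in>(UNIV :: 'a set). [:- c, 1:]"
  have deg: "degree (?p + 1) > 0"
  proof -
    have "degree ?p = card (UNIV :: 'a set)"
      by (subst degree_prod_eq_sum_degree) auto
    moreover have "card (UNIV :: 'a set) > 0" using fin by (simp add: card_gt_0_iff)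
    ultimately show ?thesis by (simp add: degree_add_eq_left)
  qed
  then obtain c where "poly (?p + 1) c = 0" using alg_closed_imp_poly_has_root by blast
  moreover have "poly ?p c = 0" using fin by (auto simp: poly_prod)
  ultimately show False by simp
qed

lemma Ga_iso_conj_by:
  assumes u: "Ga_iso U u" and n: "invertible n"
  shows "Ga_iso (conj_by n ` U) (\<lambda>x. conj_by n (u x))"
  unfolding Ga_iso_def
proof (intro conjI allI)
  show "algebraic_group (conj_by n ` U)"
    using u n by (auto simp: Ga_iso_def intro: algebraic_group_conj_by)
  have "bij_betw (conj_by n) U (conj_by n ` U)"
    using n by (intro inj_on_imp_bij_betw) (auto simp: inj_on_def conj_by_inj)
  then show "bij_betw (\<lambda>x. conj_by n (u x)) UNIV (conj_by n ` U)"
    using u bij_betw_trans [of u UNIV U "conj_by n"] by (auto simp: Ga_iso_def comp_def)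
  show "conj_by n (u (x + y)) = conj_by n (u x) ** conj_by n (u y)" for x y
    using u n by (simp add: Ga_iso_def conj_by_mult)
  have entry: "(\<lambda>x. u x $ k $ l) \<in> regular_Ga" for k l
  proof -
    obtain g where "g \<in> regular_Ga" "\<forall>x. u x $ k $ l = g x"
      using u unfolding Ga_iso_def regular_map_def by blast
    moreover have "(\<lambda>x. u x $ k $ l) = g" using calculation by auto
    ultimately show ?thesis by simp
  qed
  have "(\<lambda>x. conj_by n (u x) $ i $ j) \<in> regular_Ga" for i j
    using entry unfolding conj_by_entry regular_Ga_def
    by (intro function_algebra_sum function_algebra.mult function_algebra.const)
  then show "regular_map regular_Ga UNIV (\<lambda>x. conj_by n (u x))"
    unfolding regular_map_def by (metis (mono_tags, lifting))
  obtain g where "g \<in> regular_GLn" "\<forall>x. g (u x) = x" using u by (auto simp: Ga_iso_def)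
  then show "\<exists>g\<in>regular_GLn. \<forall>x. g (conj_by n (u x)) = x"
    using n by (intro bexI [OF _ regular_GLn_conj_by [of g "minv n"]]) auto
qed

section \<open>Reduced words in a group of reflections\<close>

text \<open>
  The roots are abstract, and only the simple reflections are given an action on them.  The last
  two assumptions tie this action to the group: a product of simple reflections that carries
  \<open>\<alpha>\<^sub>i\<close> to \<open>\<alpha>\<^sub>j\<close> conjugates \<open>s\<^sub>i\<close> to \<open>s\<^sub>j\<close>, and the action of a word depends only on its
  product.
\<close>
locale reflection_system = group W for W (structure) +
  fixes I :: "nat set" and s :: "nat \<Rightarrow> 'a" and adj :: "nat \<Rightarrow> nat \<Rightarrow> bool"
    and roots :: "'r set" and a :: "nat \<Rightarrow> 'r" and act :: "nat \<Rightarrow> 'r \<Rightarrow> 'r"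
    and minus :: "'r \<Rightarrow> 'r" and pos :: "'r \<Rightarrow> bool"
  assumes s_closed [simp]: "i \<in> I \<Longrightarrow> s i \<in> carrier W"
    and s_square: "i \<in> I \<Longrightarrow> s i \<otimes> s i = \<one>"
    and commuting: "\<lbrakk>i \<in> I; j \<in> I; i \<noteq> j; \<not> adj i j\<rbrakk> \<Longrightarrow> s i \<otimes> s j = s j \<otimes> s i"
    and not_commuting: "\<lbrakk>i \<in> I; j \<in> I; adj i j\<rbrakk> \<Longrightarrow> s i \<otimes> s j \<noteq> s j \<otimes> s i"
    and braid: "\<lbrakk>i \<in> I; j \<in> I; adj i j\<rbrakk> \<Longrightarrow> s i \<otimes> (s j \<otimes> s i) = s j \<otimes> (s i \<otimes> s j)"
    and simple_root: "i \<in> I \<Longrightarrow> a i \<in> roots"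
    and simple_pos: "i \<in> I \<Longrightarrow> pos (a i)"
    and simple_inj: "inj_on a I"
    and act_root: "\<lbrakk>i \<in> I; \<beta> \<in> roots\<rbrakk> \<Longrightarrow> act i \<beta> \<in> roots"
    and act_act: "\<lbrakk>i \<in> I; \<beta> \<in> roots\<rbrakk> \<Longrightarrow> act i (act i \<beta>) = \<beta>"
    and act_minus: "\<lbrakk>i \<in> I; \<beta> \<in> roots\<rbrakk> \<Longrightarrow> act i (minus \<beta>) = minus (act i \<beta>)"
    and act_simple: "i \<in> I \<Longrightarrow> act i (a i) = minus (a i)"
    and pos_minus: "\<beta> \<in> roots \<Longrightarrow> pos (minus \<beta>) \<longleftrightarrow> \<not> pos \<beta>"
    and act_pos: "\<lbrakk>i \<in> I; \<beta> \<in> roots; pos \<beta>; \<beta> \<noteq> a i\<rbrakk> \<Longrightarrow> pos (act i \<beta>)"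
    and reflection_conj: "\<lbrakk>set u \<subseteq> I; i \<in> I; j \<in> I; foldr act u (a i) = a j\<rbrakk> \<Longrightarrow>
      foldr (\<lambda>k w. s k \<otimes> w) u \<one> \<otimes> s i = s j \<otimes> foldr (\<lambda>k w. s k \<otimes> w) u \<one>"
    and act_cong: "\<lbrakk>set u \<subseteq> I; set v \<subseteq> I;
      foldr (\<lambda>k w. s k \<otimes> w) u \<one> = foldr (\<lambda>k w. s k \<otimes> w) v \<one>; \<beta> \<in> roots\<rbrakk> \<Longrightarrow>
      foldr act u \<beta> = foldr act v \<beta>"
begin

definition word :: "nat list \<Rightarrow> 'a" where
  "word u = foldr (\<lambda>k w. s k \<otimes> w) u \<one>"

definition is_reduced :: "nat list \<Rightarrow> bool" where
  "is_reduced u \<longleftrightarrow> set u \<subseteq> I \<and> (\<forall>v. set v \<subseteq> I \<and> word v = word u \<longrightarrow> length u \<le> length v)"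

lemma word_Nil [simp]: "word [] = \<one>"
  and word_Cons [simp]: "word (i # u) = s i \<otimes> word u"
  by (simp_all add: word_def)

lemma word_closed [simp]: "set u \<subseteq> I \<Longrightarrow> word u \<in> carrier W"
  by (induction u) auto

lemma word_append: "\<lbrakk>set u \<subseteq> I; set v \<subseteq> I\<rbrakk> \<Longrightarrow> word (u @ v) = word u \<otimes> word v"
  by (induction u) (auto simp: m_assoc)

lemma s_cancel: "\<lbrakk>i \<in> I; w \<in> carrier W\<rbrakk> \<Longrightarrow> s i \<otimes> (s i \<otimes> w) = w"
  by (simp add: m_assoc [symmetric] s_square)

lemma foldr_act_root: "\<lbrakk>set u \<subseteq> I; \<beta> \<in> roots\<rbrakk> \<Longrightarrow> foldr act u \<beta> \<in> roots"
  by (induction u) (auto intro: act_root)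

lemma foldr_act_minus:
  "\<lbrakk>set u \<subseteq> I; \<beta> \<in> roots\<rbrakk> \<Longrightarrow> foldr act u (minus \<beta>) = minus (foldr act u \<beta>)"
  by (induction u) (auto simp: act_minus foldr_act_root)

lemma foldr_act_rev: "\<lbrakk>set u \<subseteq> I; \<beta> \<in> roots\<rbrakk> \<Longrightarrow> foldr act u (foldr act (rev u) \<beta>) = \<beta>"
  by (induction u arbitrary: \<beta>) (auto simp: act_act foldr_act_root act_root)

lemma s_inv: "i \<in> I \<Longrightarrow> inv (s i) = s i"
  using s_square by (intro inv_equality) auto

lemma word_rev: "set u \<subseteq> I \<Longrightarrow> word (rev u) = inv (word u)"
  by (induction u) (simp_all add: word_append inv_mult_group s_inv)

text \<open>
  Just before the letter \<open>i\<close> at which a positive root first changes its sign, it equals \<open>\<alpha>\<^sub>i\<close>,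
  because \<open>s\<^sub>i\<close> permutes the other positive roots.
\<close>
lemma sign_change:
  "\<lbrakk>set u \<subseteq> I; \<beta> \<in> roots; pos \<beta>; \<not> pos (foldr act (rev u) \<beta>)\<rbrakk> \<Longrightarrow>
    \<exists>p i q. u = p @ i # q \<and> foldr act (rev p) \<beta> = a i"
proof (induction u arbitrary: \<beta>)
  case (Cons i u)
  show ?case
  proof (cases "\<beta> = a i")
    case True
    then show ?thesis by (intro exI [of _ "[]"]) auto
  next
    case False
    then have "pos (act i \<beta>)" "act i \<beta> \<in> roots"
      using Cons.prems by (auto intro: act_pos act_root)
    then obtain p k q where "u = p @ k # q" "foldr act (rev p) (act i \<beta>) = a k"
      using Cons.IH [of "act i \<beta>"] Cons.prems by auto
    then have "i # u = (i # p) @ k # q \<and> foldr act (rev (i # p)) \<beta> = a k" by simp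
    then show ?thesis by blast
  qed
qed auto

text \<open>
  With \<open>p\<close> the letters before the sign change at \<open>i\<close>, the roots \<open>p \<alpha>\<^sub>i\<close> and \<open>\<alpha>\<^sub>j\<close> coincide, so
  \<open>s\<^sub>j p = p s\<^sub>i\<close> and the letter \<open>i\<close> cancels.
\<close>
lemma exchange:
  assumes u: "set u \<subseteq> I" and j: "j \<in> I" and neg: "\<not> pos (foldr act (rev u) (a j))"
  shows "\<exists>v. set v \<subseteq> I \<and> Suc (length v) = length u \<and> s j \<otimes> word u = word v \<and>
    (\<exists>p i q. u = p @ i # q \<and> v = p @ q)"
proof -
  obtain p i q where pq: "u = p @ i # q" and ai: "foldr act (rev p) (a j) = a i"
    using sign_change [OF u simple_root [OF j] simple_pos [OF j] neg] by blast
  have sub: "set p \<subseteq> I" "i \<in> I" "set q \<subseteq> I" using u pq by auto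
  have "foldr act p (a i) = a j"
    using foldr_act_rev [of p "a j"] ai sub j simple_root by auto
  then have conj: "word p \<otimes> s i = s j \<otimes> word p"
    using reflection_conj [of p i j] sub j by (simp add: word_def)
  have "s j \<otimes> word u = s j \<otimes> word p \<otimes> (s i \<otimes> word q)"
    using sub j by (simp add: pq word_append m_assoc)
  also have "\<dots> = word p \<otimes> (s i \<otimes> (s i \<otimes> word q))"
    using sub by (simp add: conj [symmetric] m_assoc)
  also have "\<dots> = word (p @ q)"
    using sub by (simp add: s_cancel word_append)
  finally show ?thesis using sub pq by (intro exI [of _ "p @ q"]) auto
qed

lemma sign_flip:
  assumes "set u \<subseteq> I" "set v \<subseteq> I" "j \<in> I" "word u = s j \<otimes> word v"
  shows "pos (foldr act (rev u) (a j)) \<longleftrightarrow> \<not> pos (foldr act (rev v) (a j))"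
proof -
  have eq: "word (rev u) = word (rev (j # v))"
    using assms by (simp add: word_rev word_append inv_mult_group s_inv)
  have "foldr act (rev u) (a j) = foldr act (rev (j # v)) (a j)"
    using act_cong [of "rev u" "rev (j # v)" "a j"] eq assms simple_root by (simp add: word_def)
  also have "\<dots> = minus (foldr act (rev v) (a j))"
    using assms by (simp add: act_simple foldr_act_minus simple_root)
  finally show ?thesis
    using pos_minus [of "foldr act (rev v) (a j)"] foldr_act_root [of "rev v" "a j"] assms
      simple_root by auto
qed

lemma is_reduced_Nil: "is_reduced []"
  by (simp add: is_reduced_def)

text \<open>
  A shorter word \<open>v\<close> for \<open>s\<^sub>j u\<close> would make \<open>\<alpha>\<^sub>j\<close> negative, so that exchange would yield a word
  for \<open>u = s\<^sub>j v\<close> even shorter than \<open>v\<close>, hence shorter than \<open>u\<close>.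
\<close>
lemma is_reduced_ConsI:
  assumes u: "is_reduced u" and j: "j \<in> I" and pos: "pos (foldr act (rev u) (a j))"
  shows "is_reduced (j # u)"
proof -
  have sub: "set u \<subseteq> I" using u by (simp add: is_reduced_def)
  have "length (j # u) \<le> length v" if v: "set v \<subseteq> I" "word v = word (j # u)" for v
  proof (rule ccontr)
    assume short: "\<not> length (j # u) \<le> length v"
    have jv: "s j \<otimes> word v = word u" using v j sub by (simp add: s_cancel)
    have "\<not> pos (foldr act (rev v) (a j))"
      using sign_flip [of v u j] v sub j pos by auto
    then obtain v' where "set v' \<subseteq> I" "Suc (length v') = length v" "s j \<otimes> word v = word v'"
      using exchange [of v j] v j by blast
    then have "length u \<le> length v'" using u jv by (simp add: is_reduced_def)
    then show False using short \<open>Suc (length v') = length v\<close> by simp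
  qed
  then show ?thesis using sub j by (auto simp: is_reduced_def)
qed

lemma is_reduced_tl:
  assumes "is_reduced (i # u)" shows "is_reduced u"
proof -
  have sub: "set u \<subseteq> I" "i \<in> I" using assms by (auto simp: is_reduced_def)
  have "length u \<le> length v" if "set v \<subseteq> I" "word v = word u" for v
  proof -
    have "length (i # u) \<le> length (i # v)"
      using assms that sub unfolding is_reduced_def by (metis insert_subset list.simps(15) word_Cons)
    then show ?thesis by simp
  qed
  then show ?thesis using sub by (auto simp: is_reduced_def)
qed

lemma is_reduced_length:
  "\<lbrakk>is_reduced u; is_reduced v; word u = word v\<rbrakk> \<Longrightarrow> length u = length v"
  unfolding is_reduced_def by (metis le_antisym)

lemma is_reduced_of_length:
  assumes "is_reduced u" "set v \<subseteq> I" "word v = word u" "length v = length u"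
  shows "is_reduced v"
  using assms unfolding is_reduced_def by auto

lemma simple_reflections_distinct:
  assumes "i \<in> I" "j \<in> I" "s i = s j" shows "i = j"
proof (rule ccontr)
  assume "i \<noteq> j"
  then have "pos (act i (a j))"
    using assms simple_inj by (intro act_pos) (auto simp: simple_root simple_pos inj_on_def)
  moreover have "act i (a j) = act j (a j)"
    using act_cong [of "[i]" "[j]" "a j"] assms simple_root by auto
  ultimately show False using assms pos_minus simple_pos simple_root act_simple by metis
qed

text \<open>
  That \<open>j v\<close> is reduced means that the inverse of its product makes \<open>\<alpha>\<^sub>j\<close> negative; this does not
  depend on the word, so the exchange condition applies to every word for the same element.
\<close>
lemma exchange_first:
  assumes u: "is_reduced u" and v: "is_reduced (j # v)" and eq: "word u = word (j # v)"
  shows "\<exists>p i q. u = p @ i # q \<and> s j \<otimes> word u = word (p @ q)"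
proof -
  have sub: "set u \<subseteq> I" "set v \<subseteq> I" "j \<in> I" using u v by (auto simp: is_reduced_def)
  have "pos (foldr act (rev v) (a j))"
  proof (rule ccontr)
    assume "\<not> ?thesis"
    then obtain v' where "set v' \<subseteq> I" "Suc (length v') = length v" "s j \<otimes> word v = word v'"
      using exchange [of v j] sub by blast
    then show False using v unfolding is_reduced_def by force
  qed
  then have "\<not> pos (foldr act (rev u) (a j))"
    using sign_flip [of u v j] sub eq by auto
  then show ?thesis using exchange [of u j] sub by blast
qed

text \<open>
  Exchange cannot delete the first letter \<open>i\<close>, since that would give \<open>s\<^sub>i = s\<^sub>j\<close>.
\<close>
lemma reduced_word_second_letter:
  assumes u: "is_reduced (i # u)" and v: "is_reduced (j # v)"
    and eq: "word (i # u) = word (j # v)" and ij: "i \<noteq> j"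
  shows "\<exists>q. set q \<subseteq> I \<and> word (j # v) = s j \<otimes> (s i \<otimes> word q) \<and> length v = Suc (length q)"
proof -
  have sub: "set u \<subseteq> I" "set v \<subseteq> I" "i \<in> I" "j \<in> I" using u v by (auto simp: is_reduced_def)
  have len: "length u = length v" using is_reduced_length [OF u v eq] by simp
  obtain p k q where pq: "i # u = p @ k # q" and jw: "s j \<otimes> word (i # u) = word (p @ q)"
    using exchange_first [OF u v eq] by blast
  have w: "word (j # v) = s j \<otimes> word (p @ q)"
    using jw eq sub by (metis s_cancel word_closed word_Cons insert_subset list.simps(15))
  show ?thesis
  proof (cases p)
    case Nil
    then have "s i \<otimes> word u = s j \<otimes> word u" using w eq pq by simp
    then have "i = j" using sub simple_reflections_distinct by auto
    then show ?thesis using ij by simp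
  next
    case (Cons k' p')
    have "set (p' @ q) \<subseteq> I" using sub pq Cons by auto
    moreover have "length v = Suc (length (p' @ q))" using len pq Cons by simp
    moreover have "word (j # v) = s j \<otimes> (s i \<otimes> word (p' @ q))" using w pq Cons by auto
    ultimately show ?thesis by blast
  qed
qed

text \<open>
  Matsumoto's theorem, stated for operators so that it applies to any target with an
  associative product.  If reduced words \<open>i u\<close> and \<open>j v\<close> of the same element start with
  different letters, the exchange condition yields a third reduced word that starts with the
  longest word in \<open>i\<close> and \<open>j\<close>; its two spellings are compared with \<open>i u\<close> and \<open>j v\<close> by
  induction on the length.
\<close>
theorem matsumoto:
  fixes f :: "nat \<Rightarrow> 'm \<Rightarrow> 'm"
  assumes f_comm: "\<And>i j x. \<lbrakk>i \<in> I; j \<in> I; i \<noteq> j; \<not> adj i j\<rbrakk> \<Longrightarrow> f i (f j x) = f j (f i x)"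
    and f_braid: "\<And>i j x. \<lbrakk>i \<in> I; j \<in> I; adj i j\<rbrakk> \<Longrightarrow> f i (f j (f i x)) = f j (f i (f j x))"
    and "is_reduced u" "is_reduced v" "word u = word v"
  shows "foldr f u e = foldr f v e"
  using assms(3-)
proof (induction "length u" arbitrary: u v rule: less_induct)
  case less
  note len = is_reduced_length [OF less.prems]
  show ?case
  proof (cases u)
    case Nil
    then show ?thesis using len by simp
  next
    case (Cons i u')
    then obtain j v' where v: "v = j # v'" using len by (cases v) auto
    have red: "is_reduced u'" "is_reduced v'"
      using less.prems Cons v is_reduced_tl by blast+
    have sub: "set u' \<subseteq> I" "set v' \<subseteq> I" "i \<in> I" "j \<in> I"
      using less.prems Cons v by (auto simp: is_reduced_def)
    have lens: "length u = Suc (length u')" "length v' = length u'" using len Cons v by auto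
    have same_tail: "foldr f w e = foldr f w' e"
      if "is_reduced w" "set w' \<subseteq> I" "length w' = length u'" "k \<in> I" "length w = length u'"
        "s k \<otimes> word w = s k \<otimes> word w'" for w w' k
    proof -
      have "word w = word w'" using that by (auto simp: is_reduced_def)
      moreover have "is_reduced w'"
        using that calculation by (intro is_reduced_of_length [OF that(1)]) auto
      ultimately show ?thesis using less.hyps [of w w'] that lens by auto
    qed
    show ?thesis
    proof (cases "i = j")
      case True
      then have "word u' = word v'" using less.prems Cons v sub by auto
      then show ?thesis using less.hyps [of u' v'] red lens Cons v True by auto
    next
      case ij: False
      obtain q where q: "set q \<subseteq> I" "word v = s j \<otimes> (s i \<otimes> word q)" "length v' = Suc (length q)"
        using reduced_word_second_letter [of i u' j v'] less.prems Cons v ij by auto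
      show ?thesis
      proof (cases "adj i j")
        case False
        have jiq: "word u = s i \<otimes> (s j \<otimes> word q)"
          using q less.prems(3) sub commuting [OF sub(3,4) ij False]
          by (metis m_assoc s_closed word_closed)
        have "foldr f u' e = foldr f (j # q) e"
          using q jiq Cons sub lens red by (intro same_tail [of _ _ i]) auto
        moreover have "foldr f v' e = foldr f (i # q) e"
          using q v sub lens red by (intro same_tail [of _ _ j]) auto
        ultimately show ?thesis using Cons v f_comm [OF sub(3,4) ij False] by simp
      next
        case True
        have wv: "word (j # i # q) = word v" using q sub by simp
        have red_jiq: "is_reduced (j # i # q)"
          using wv q sub v by (intro is_reduced_of_length [OF less.prems(2)]) auto
        obtain p k r where pr: "j # i # q = p @ k # r"
          and iw: "s i \<otimes> word (j # i # q) = word (p @ r)"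
          using exchange_first [OF red_jiq, of i u'] less.prems wv unfolding Cons by metis
        have subpr: "set (p @ k # r) \<subseteq> I" using pr q sub by (metis insert_subset list.simps(15))
        have w: "word v = s i \<otimes> word (p @ r)"
          using iw wv subpr sub q
          by (metis s_cancel word_closed insert_subset list.simps(15))
        consider "p = []" | "p = [j]" | p' where "p = j # i # p'"
          using pr by (cases p; cases "tl p") auto
        then show ?thesis
        proof cases
          case 1
          then have "s i \<otimes> (s i \<otimes> word q) = s j \<otimes> (s i \<otimes> word q)" using w pr wv by auto
          then have "s i = s j" using sub q by simp
          then show ?thesis using ij simple_reflections_distinct sub by blast
        next
          case 2
          then have "s i \<otimes> (s j \<otimes> word q) = s j \<otimes> (s i \<otimes> word q)" using w pr wv by auto
          then have "(s i \<otimes> s j) \<otimes> word q = (s j \<otimes> s i) \<otimes> word q" using sub q by (simp add: m_assoc)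
          then have "s i \<otimes> s j = s j \<otimes> s i" using sub q by simp
          then show ?thesis using not_commuting True sub by blast
        next
          case 3
          define t where "t = p' @ r"
          have t: "set t \<subseteq> I" "Suc (length t) = length q" using 3 pr subpr by (auto simp: t_def)
          have w1: "word u = s i \<otimes> (s j \<otimes> (s i \<otimes> word t))"
            using w less.prems(3) 3 by (simp add: t_def)
          have "s i \<otimes> (s j \<otimes> (s i \<otimes> word t)) = s j \<otimes> (s i \<otimes> (s j \<otimes> word t))"
            using braid [OF sub(3,4) True] sub t by (simp add: m_assoc [symmetric])
          then have w2: "word v = s j \<otimes> (s i \<otimes> (s j \<otimes> word t))"
            using w1 less.prems(3) by simp
          have "foldr f u' e = foldr f (j # i # t) e"
            using w1 Cons sub lens red q t by (intro same_tail [of _ _ i]) auto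
          moreover have "foldr f v' e = foldr f (i # j # t) e"
            using w2 v sub lens red q t by (intro same_tail [of _ _ j]) auto
          ultimately show ?thesis using Cons v f_braid [OF sub(3,4) True] by simp
        qed
      qed
    qed
  qed
qed

lemma is_reduced_pair:
  assumes "i \<in> I" "j \<in> I" "i \<noteq> j" shows "is_reduced [j, i]"
proof -
  have "is_reduced [i]"
    using assms is_reduced_ConsI [OF is_reduced_Nil] by (auto simp: simple_pos)
  moreover have "pos (act i (a j))"
    using assms simple_inj by (intro act_pos) (auto simp: simple_root simple_pos inj_on_def)
  ultimately show ?thesis using assms is_reduced_ConsI [of "[i]" j] by auto
qed

lemma is_reduced_braid_word:
  assumes "i \<in> I" "j \<in> I" "i \<noteq> j" "act i (act j (a i)) = a j" shows "is_reduced [j, i, j]"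
proof -
  have "act j (act i (a j)) = a i"
    using assms by (metis act_act act_root simple_root)
  then show ?thesis
    using assms is_reduced_pair [of j i] is_reduced_ConsI [of "[i, j]" j] simple_pos [of i] by simp
qed

lemma exists_reduced_word:
  assumes "set u \<subseteq> I" shows "\<exists>v. is_reduced v \<and> word v = word u"
proof -
  obtain v where "set v \<subseteq> I \<and> word v = word u"
    "\<forall>x. set x \<subseteq> I \<and> word x = word u \<longrightarrow> length v \<le> length x"
    using ex_has_least_nat [of "\<lambda>v. set v \<subseteq> I \<and> word v = word u" u length] assms by blast
  then show ?thesis by (auto simp: is_reduced_def intro!: exI [of _ v])
qed

end

section \<open>Roots and root subgroups\<close>

locale realized_group =
  fixes R :: "('a::alg_closed_field, 'n::finite) realization"
  assumes grp: "algebraic_group (grp R)"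
    and tor: "torus (tor R)" "tor R \<subseteq> grp R"
    and realization: "is_realization R"
begin

abbreviation "T \<equiv> tor R"
abbreviation "N \<equiv> norm_tor R"
abbreviation "W \<equiv> weyl_group R"
abbreviation "\<Phi> \<equiv> roots (grp R) (tor R)"
abbreviation "neg \<equiv> neg_char (tor R)"

lemma subgroup_grp: "subgroup (grp R) GLn"
  using grp by (simp add: algebraic_group_def)

lemma subgroup_T: "subgroup T GLn"
  using tor by (simp add: torus_def algebraic_group_def)

lemmas T_simps [simp] = subgroup_GLn_D [OF subgroup_T]

lemma T_commute: "\<lbrakk>s \<in> T; t \<in> T\<rbrakk> \<Longrightarrow> s ** t = t ** s"
proof -
  obtain r \<phi> where \<phi>: "bij_betw \<phi> (Gm_power r :: (nat \<Rightarrow> 'a) set) T"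
    "\<And>x y. \<lbrakk>x \<in> Gm_power r; y \<in> Gm_power r\<rbrakk> \<Longrightarrow> \<phi> (\<lambda>k\<in>{..<r}. x k * y k) = \<phi> x ** \<phi> y"
    using tor(1) unfolding torus_def by blast
  assume "s \<in> T" "t \<in> T"
  then obtain x y where "x \<in> Gm_power r" "s = \<phi> x" "y \<in> Gm_power r" "t = \<phi> y"
    using \<phi>(1) unfolding bij_betw_def by blast
  then show ?thesis using \<phi>(2) [of x y] \<phi>(2) [of y x] by (simp add: mult.commute)
qed

lemma conj_by_T: "\<lbrakk>s \<in> T; t \<in> T\<rbrakk> \<Longrightarrow> conj_by s t = t"
  by (simp add: conj_by_eq_iff T_commute)

lemma N_iff: "n \<in> N \<longleftrightarrow> n \<in> grp R \<and> conj_by n ` T = T"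
  by (simp add: norm_tor_def conj_by_def)

lemma N_invertible [simp]: "n \<in> N \<Longrightarrow> invertible n"
  using subgroup_GLn_D(1) [OF subgroup_grp] by (auto simp: N_iff)

lemma T_subset_N: "t \<in> T \<Longrightarrow> t \<in> N"
  using tor(2) by (auto simp: N_iff conj_by_T image_def)

lemma N_conj [simp]: "\<lbrakk>n \<in> N; t \<in> T\<rbrakk> \<Longrightarrow> conj_by n t \<in> T"
  by (auto simp: N_iff)

lemma subgroup_N: "subgroup N GLn"
proof (rule subgroup_GLn_I)
  show "mat 1 \<in> N" by (rule T_subset_N) simp
  show "minv n \<in> N" if "n \<in> N" for n
  proof -
    have "conj_by (minv n) ` conj_by n ` T = T" using that by (simp add: image_image)
    then show ?thesis using that subgroup_GLn_D(4) [OF subgroup_grp] by (simp add: N_iff)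
  qed
  show "m ** n \<in> N" if "m \<in> N" "n \<in> N" for m n
  proof -
    have "conj_by (m ** n) ` T = conj_by m ` conj_by n ` T"
      using that by (simp add: image_image conj_by_comp)
    then show ?thesis using that subgroup_GLn_D(2) [OF subgroup_grp] by (simp add: N_iff)
  qed
qed simp

lemmas N_simps [simp] = subgroup_GLn_D(2,3,4) [OF subgroup_N]

text \<open>Restricting to \<open>T\<close> keeps characters extensional, so that they are permuted as functions.\<close>

definition act_char :: "'a ^ 'n ^ 'n \<Rightarrow> ('a ^ 'n ^ 'n \<Rightarrow> 'a) \<Rightarrow> 'a ^ 'n ^ 'n \<Rightarrow> 'a" where
  "act_char n \<beta> = (\<lambda>t\<in>T. \<beta> (conj_by (minv n) t))"

lemma act_char_conj: "\<lbrakk>n \<in> N; t \<in> T\<rbrakk> \<Longrightarrow> act_char n \<beta> (conj_by n t) = \<beta> t"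
  by (simp add: act_char_def)

lemma act_char_comp:
  "\<lbrakk>n \<in> N; m \<in> N\<rbrakk> \<Longrightarrow> act_char n (act_char m \<beta>) = act_char (n ** m) \<beta>"
  by (rule ext) (simp add: act_char_def conj_by_comp minv_mult)

lemma act_char_neg: "n \<in> N \<Longrightarrow> act_char n (neg \<beta>) = neg (act_char n \<beta>)"
  by (rule ext) (simp add: act_char_def neg_char_def)

lemma character:
  assumes "\<beta> \<in> characters T"
  shows "\<lbrakk>s \<in> T; t \<in> T\<rbrakk> \<Longrightarrow> \<beta> (s ** t) = \<beta> s * \<beta> t" "t \<in> T \<Longrightarrow> \<beta> t \<noteq> 0"
    "\<beta> (mat 1) = 1" "t \<in> T \<Longrightarrow> \<beta> (minv t) = inverse (\<beta> t)" "t \<notin> T \<Longrightarrow> \<beta> t = undefined"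
proof -
  show mult: "\<beta> (s ** t) = \<beta> s * \<beta> t" if "s \<in> T" "t \<in> T" for s t
    using assms that by (simp add: characters_def)
  show nz: "\<beta> t \<noteq> 0" if "t \<in> T" for t
    using assms that by (auto simp: characters_def PiE_def Pi_def)
  show one: "\<beta> (mat 1) = 1"
    using mult [of "mat 1" "mat 1"] nz [of "mat 1"] by simp
  show "\<beta> (minv t) = inverse (\<beta> t)" if "t \<in> T"
    using mult [of "minv t" t] nz that one by (simp add: field_simps)
  show "t \<notin> T \<Longrightarrow> \<beta> t = undefined"
    using assms by (auto simp: characters_def PiE_def extensional_def)
qed

lemma act_char_one: "\<beta> \<in> characters T \<Longrightarrow> act_char (mat 1) \<beta> = \<beta>"
  by (rule ext) (auto simp: act_char_def character(5))

lemma act_char_cancel: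
  "\<lbrakk>n \<in> N; \<beta> \<in> characters T\<rbrakk> \<Longrightarrow> act_char n (act_char (minv n) \<beta>) = \<beta>"
  "\<lbrakk>n \<in> N; \<beta> \<in> characters T\<rbrakk> \<Longrightarrow> act_char (minv n) (act_char n \<beta>) = \<beta>"
  by (simp_all add: act_char_comp act_char_one)

lemma act_char_characters:
  assumes n: "n \<in> N" and \<beta>: "\<beta> \<in> characters T"
  shows "act_char n \<beta> \<in> characters T"
proof -
  obtain g where g: "g \<in> regular_GLn" "\<forall>t\<in>T. \<beta> t = g t" using \<beta> by (auto simp: characters_def)
  have "\<exists>g\<in>regular_GLn. \<forall>t\<in>T. act_char n \<beta> t = g t"
    using g n by (intro bexI [OF _ regular_GLn_conj_by [OF g(1), of "minv n"]]) (auto simp: act_char_def)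
  then show ?thesis
    using n \<beta> by (auto simp: characters_def act_char_def conj_by_mult character [OF \<beta>])
qed

lemma root_iso_act_char:
  assumes n: "n \<in> N" and u: "root_iso (grp R) T \<beta> U u"
  shows "root_iso (grp R) T (act_char n \<beta>) (conj_by n ` U) (\<lambda>x. conj_by n (u x))"
  unfolding root_iso_def
proof (intro conjI ballI allI)
  show "conj_by n ` U \<subseteq> grp R"
    using n u subgroup_GLn_D [OF subgroup_grp]
    by (auto simp: root_iso_def N_iff conj_by_def)
  show "Ga_iso (conj_by n ` U) (\<lambda>x. conj_by n (u x))"
    using n u by (auto simp: root_iso_def intro: Ga_iso_conj_by)
  fix t x assume t: "t \<in> T"
  define t' where "t' = conj_by (minv n) t"
  have t': "t' \<in> T" "t = conj_by n t'" using n t by (auto simp: t'_def)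
  have "conj_by t (conj_by n (u x)) = conj_by n (conj_by t' (u x))"
    using n t' by (simp add: conj_by_comp) (simp add: conj_by_def mult_assoc)
  also have "conj_by t' (u x) = u (\<beta> t' * x)" using u t' by (simp add: root_iso_def conj_by_def)
  finally show "t ** conj_by n (u x) ** minv t = conj_by n (u (act_char n \<beta> t * x))"
    using n t t' by (simp add: act_char_conj) (simp add: conj_by_def)
qed

lemma root_iso_inverse_act_char:
  assumes n: "n \<in> N" and \<beta>: "\<beta> \<in> characters T" and u: "root_iso (grp R) T (act_char n \<beta>) U u"
  shows "root_iso (grp R) T \<beta> (conj_by (minv n) ` U) (\<lambda>x. conj_by (minv n) (u x))"
  using root_iso_act_char [OF _ u, of "minv n"] n \<beta> by (simp add: act_char_cancel)

lemma root_character: "\<beta> \<in> \<Phi> \<Longrightarrow> \<beta> \<in> characters T"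
  by (simp add: roots_def)

lemmas root_simps = character [OF root_character]

lemma root_subgroup_unique:
  "\<lbrakk>\<beta> \<in> \<Phi>; root_iso (grp R) T \<beta> U u\<rbrakk> \<Longrightarrow> root_subgroup (grp R) T \<beta> = U"
  unfolding root_subgroup_def by (rule the1_equality) (auto simp: roots_def)

lemma root_hom: "\<beta> \<in> \<Phi> \<Longrightarrow> root_iso (grp R) T \<beta> (root_subgroup (grp R) T \<beta>) (root_hom R \<beta>)"
  using realization by (simp add: is_realization_def)

lemma act_char_root:
  assumes n: "n \<in> N" and \<beta>: "\<beta> \<in> \<Phi>"
  shows "act_char n \<beta> \<in> \<Phi>"
proof -
  have "\<exists>t\<in>T. act_char n \<beta> t \<noteq> 1"
  proof -
    obtain t where "t \<in> T" "\<beta> t \<noteq> 1" using \<beta> by (auto simp: roots_def)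
    then show ?thesis using n by (intro bexI [of _ "conj_by n t"]) (auto simp: act_char_conj)
  qed
  moreover have "\<exists>!U. \<exists>u. root_iso (grp R) T (act_char n \<beta>) U u"
  proof (rule ex1I)
    show "\<exists>u. root_iso (grp R) T (act_char n \<beta>) (conj_by n ` root_subgroup (grp R) T \<beta>) u"
      using root_iso_act_char [OF n root_hom [OF \<beta>]] by blast
    fix V assume "\<exists>u. root_iso (grp R) T (act_char n \<beta>) V u"
    then obtain u where "root_iso (grp R) T (act_char n \<beta>) V u" by blast
    then have "root_subgroup (grp R) T \<beta> = conj_by (minv n) ` V"
      by (intro root_subgroup_unique [OF \<beta> root_iso_inverse_act_char [OF n]])
        (auto simp: root_character \<beta>)
    then show "V = conj_by n ` root_subgroup (grp R) T \<beta>"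
      using n by (simp add: image_image)
  qed
  ultimately show ?thesis
    using act_char_characters [OF n root_character [OF \<beta>]] by (simp add: roots_def)
qed

lemma cocharacter:
  assumes "\<nu> \<in> cocharacters T"
  shows "x \<noteq> 0 \<Longrightarrow> \<nu> x \<in> T" "\<lbrakk>x \<noteq> 0; y \<noteq> 0\<rbrakk> \<Longrightarrow> \<nu> (x * y) = \<nu> x ** \<nu> y" "\<nu> 1 = mat 1"
    "x \<noteq> 0 \<Longrightarrow> \<nu> (inverse x) = minv (\<nu> x)"
proof -
  show T: "\<nu> x \<in> T" if "x \<noteq> 0" for x using assms that by (simp add: cocharacters_def)
  show mult: "\<nu> (x * y) = \<nu> x ** \<nu> y" if "x \<noteq> 0" "y \<noteq> 0" for x y
    using assms that by (simp add: cocharacters_def)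
  have "\<nu> 1 ** \<nu> 1 = \<nu> 1 ** mat 1" using mult [of 1 1] by simp
  then show one: "\<nu> 1 = mat 1" using mult_cancel(1) [of "\<nu> 1" "\<nu> 1" "mat 1"] T [of 1] by simp
  show "\<nu> (inverse x) = minv (\<nu> x)" if "x \<noteq> 0"
    using mult [of x "inverse x"] that one T [of x] by (simp add: minv_unique)
qed

lemma coroot_cocharacter: "\<beta> \<in> \<Phi> \<Longrightarrow> coroot R \<beta> \<in> cocharacters T"
  using realization by (simp add: is_realization_def)

lemmas coroot_simps = cocharacter [OF coroot_cocharacter]

lemma root_coroot: "\<lbrakk>\<beta> \<in> \<Phi>; x \<noteq> 0\<rbrakk> \<Longrightarrow> \<beta> (coroot R \<beta> x) = x ^ 2"
  using realization by (simp add: is_realization_def)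

text \<open>
  A square root of \<open>c\<close> exists, and \<open>\<langle>\<beta>, \<beta>\<^sup>\<or>\<rangle> = 2\<close>.
\<close>
lemma root_surj:
  assumes "\<beta> \<in> \<Phi>" "c \<noteq> 0" shows "\<exists>t\<in>T. \<beta> t = c"
proof -
  obtain x where "x ^ 2 = c" using nth_root_exists [of 2 c] by auto
  moreover have "x \<noteq> 0" using calculation assms by auto
  ultimately show ?thesis
    using assms by (intro bexI [of _ "coroot R \<beta> x"]) (auto simp: root_coroot coroot_simps)
qed

lemma sigma_in_N: "\<beta> \<in> \<Phi> \<Longrightarrow> sigma_root R \<beta> \<in> N"
  using realization by (simp add: is_realization_def acts_as_reflection_def)

lemma sigma_conj:
  "\<lbrakk>\<beta> \<in> \<Phi>; t \<in> T\<rbrakk> \<Longrightarrow> conj_by (sigma_root R \<beta>) t = t ** minv (coroot R \<beta> (\<beta> t))"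
  using realization by (simp add: is_realization_def acts_as_reflection_def conj_by_def)

text \<open>
  The formula is stated for an arbitrary \<open>\<nu>\<close> because it also serves for elements of \<open>N\<close> of which it
  is not yet known that \<open>\<nu>\<close> is a coroot.
\<close>
lemma reflection_involutive:
  assumes m: "m \<in> N" and \<gamma>: "\<gamma> \<in> characters T" and \<nu>: "\<nu> \<in> cocharacters T"
    and two: "\<And>x. x \<noteq> 0 \<Longrightarrow> \<gamma> (\<nu> x) = x ^ 2"
    and refl: "\<And>t. t \<in> T \<Longrightarrow> conj_by m t = t ** minv (\<nu> (\<gamma> t))" and t: "t \<in> T"
  shows "conj_by (minv m) t = t ** minv (\<nu> (\<gamma> t))"
proof -
  note \<gamma> = character [OF \<gamma>] and \<nu> = cocharacter [OF \<nu>]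
  let ?s = "conj_by m t"
  have s: "?s \<in> T" using m t by simp
  have nz: "\<gamma> t \<noteq> 0" using t by (simp add: \<gamma>)
  have "\<gamma> ?s = inverse (\<gamma> t)"
    using t nz by (simp add: refl \<gamma> \<nu> two power2_eq_square)
  then have "conj_by m ?s = t"
    using t nz by (subst refl) (simp_all add: s, simp add: refl \<nu> mult_assoc)
  then have "conj_by (minv m) t = ?s" using m by (metis conj_by_cancel(1) N_invertible)
  then show ?thesis using refl [OF t] by simp
qed

lemma sigma_conj_minv:
  assumes "\<beta> \<in> \<Phi>" "t \<in> T"
  shows "conj_by (minv (sigma_root R \<beta>)) t = conj_by (sigma_root R \<beta>) t"
  using assms
  by (simp add: reflection_involutive [OF sigma_in_N root_character coroot_cocharacter]
      root_coroot sigma_conj)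

lemma neg_root_act: "\<beta> \<in> \<Phi> \<Longrightarrow> act_char (sigma_root R \<beta>) \<beta> = neg \<beta>"
  by (rule ext)
    (auto simp: act_char_def neg_char_def sigma_conj_minv sigma_conj root_simps coroot_simps
      root_coroot power2_eq_square)

lemma neg_root: "\<beta> \<in> \<Phi> \<Longrightarrow> neg \<beta> \<in> \<Phi>"
  using act_char_root [OF sigma_in_N] neg_root_act by metis

lemma root_hom_simps:
  assumes "\<beta> \<in> \<Phi>"
  shows "root_hom R \<beta> (x + y) = root_hom R \<beta> x ** root_hom R \<beta> y"
    "root_hom R \<beta> x = root_hom R \<beta> y \<longleftrightarrow> x = y" "root_hom R \<beta> 0 = mat 1"
    "invertible (root_hom R \<beta> x)" "root_hom R \<beta> (- x) = minv (root_hom R \<beta> x)"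
    "t \<in> T \<Longrightarrow> conj_by t (root_hom R \<beta> x) = root_hom R \<beta> (\<beta> t * x)"
proof -
  let ?u = "root_hom R \<beta>"
  have iso: "Ga_iso (root_subgroup (grp R) T \<beta>) ?u"
    and conj: "\<And>t x. t \<in> T \<Longrightarrow> conj_by t (?u x) = ?u (\<beta> t * x)"
    using root_hom [OF assms] by (auto simp: root_iso_def conj_by_def)
  show add: "?u (x + y) = ?u x ** ?u y" for x y using iso by (simp add: Ga_iso_def)
  show "?u x = ?u y \<longleftrightarrow> x = y"
    using iso by (auto simp: Ga_iso_def bij_betw_def inj_on_def)
  have sub: "subgroup (root_subgroup (grp R) T \<beta>) GLn"
    using iso by (simp add: Ga_iso_def algebraic_group_def)
  show invertible: "invertible (?u x)" for x
    using iso subgroup_GLn_D(1) [OF sub, of "?u x"] by (auto simp: Ga_iso_def bij_betw_def)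
  have "?u 0 ** ?u 0 = ?u 0 ** mat 1" using add [of 0 0] by simp
  then show zero: "?u 0 = mat 1" using mult_cancel(1) invertible by blast
  show "?u (- x) = minv (?u x)"
    using add [of x "- x"] zero invertible by (simp add: minv_unique)
  show "t \<in> T \<Longrightarrow> conj_by t (?u x) = ?u (\<beta> t * x)" by (rule conj)
qed

lemma reflection_factorization:
  assumes "\<beta> \<in> \<Phi>" "x \<noteq> 0"
  shows "root_hom R \<beta> x ** root_hom R (neg \<beta>) (- inverse x) ** root_hom R \<beta> x
    = coroot R \<beta> x ** sigma_root R \<beta>"
  using realization assms by (simp add: is_realization_def)

text \<open>
  Two isomorphisms of the additive group with the same root subgroup differ by a scalar: being
  equivariant for the torus, whose image under a root is all of \<open>F\<^sup>\<times>\<close>, the comparison map is linear.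
\<close>
lemma conj_root_hom:
  assumes n: "n \<in> N" and \<alpha>: "\<alpha> \<in> \<Phi>"
  shows "\<exists>c. c \<noteq> 0 \<and> (\<forall>x. conj_by n (root_hom R \<alpha> x) = root_hom R (act_char n \<alpha>) (c * x))"
proof -
  let ?\<beta> = "act_char n \<alpha>"
  have \<beta>: "?\<beta> \<in> \<Phi>" by (rule act_char_root [OF n \<alpha>])
  have "root_subgroup (grp R) T ?\<beta> = conj_by n ` root_subgroup (grp R) T \<alpha>"
    by (rule root_subgroup_unique [OF \<beta> root_iso_act_char [OF n root_hom [OF \<alpha>]]])
  moreover have "range (root_hom R \<beta>) = root_subgroup (grp R) T \<beta>" if "\<beta> \<in> \<Phi>" for \<beta>
    using root_hom [OF that] by (auto simp: root_iso_def Ga_iso_def bij_betw_def)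
  ultimately have "\<exists>y. conj_by n (root_hom R \<alpha> x) = root_hom R ?\<beta> y" for x
    using \<alpha> \<beta> by (metis image_iff rangeI)
  then obtain f where f: "\<And>x. conj_by n (root_hom R \<alpha> x) = root_hom R ?\<beta> (f x)" by metis
  have scale: "f (k * x) = k * f x" if k: "k \<noteq> 0" for k x
  proof -
    obtain t where t: "t \<in> T" "\<alpha> t = k" using root_surj [OF \<alpha> k] by blast
    have "root_hom R ?\<beta> (f (k * x)) = conj_by n (conj_by t (root_hom R \<alpha> x))"
      using t by (simp add: f [symmetric] root_hom_simps \<alpha>)
    also have "\<dots> = conj_by (conj_by n t) (conj_by n (root_hom R \<alpha> x))"
      using n t by (simp add: conj_by_comp) (simp add: conj_by_def mult_assoc)
    also have "\<dots> = root_hom R ?\<beta> (k * f x)"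
      using n t by (simp add: f root_hom_simps \<beta> act_char_conj)
    finally show ?thesis by (simp add: root_hom_simps \<beta>)
  qed
  have f0: "f 0 = 0"
    using f [of 0] n by (simp add: root_hom_simps \<alpha>) (metis \<beta> root_hom_simps(2,3))
  have "f x = f 1 * x" for x
    using scale [of x 1] f0 by (cases "x = 0") (simp_all add: mult.commute)
  moreover have "f 1 \<noteq> 0"
    using f [of 1] f [of 0] f0 n by (metis conj_by_inj N_invertible root_hom_simps(2) [OF \<alpha>] zero_neq_one)
  ultimately show ?thesis using f by metis
qed

text \<open>
  In a rank one group only the triples \<open>u(a) u\<^sub>-(-a\<^sup>-\<^sup>1) u(a)\<close> normalize the torus.  If
  \<open>u(a) u\<^sub>-(-b) u(a)\<close> also induces the reflection and \<open>c = a\<^sup>-\<^sup>1 - b\<close>, then \<open>u(-a) u\<^sub>-(c) u(a)\<close>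
  centralizes \<open>T\<close>, and rescaling by the torus shows that conjugation by \<open>u(a)\<close> maps
  \<open>u\<^sub>-(c z)\<close> to \<open>u\<^sub>-(c z / (1 + z))\<close>.  As \<open>z / (1 + z)\<close> is not additive in \<open>z\<close>, \<open>c = 0\<close>.
\<close>
lemma reflection_triple:
  assumes \<beta>: "\<beta> \<in> \<Phi>" and a: "a \<noteq> 0"
    and n: "n = root_hom R \<beta> a ** root_hom R (neg \<beta>) (- b) ** root_hom R \<beta> a"
    and refl: "\<And>t. t \<in> T \<Longrightarrow> conj_by n t = conj_by (sigma_root R \<beta>) t"
  shows "b = inverse a"
proof (rule ccontr)
  assume "b \<noteq> inverse a"
  define c where "c = inverse a - b"
  have c: "c \<noteq> 0" using \<open>b \<noteq> inverse a\<close> by (simp add: c_def)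
  let ?u = "root_hom R \<beta>" and ?v = "root_hom R (neg \<beta>)"
  note u = root_hom_simps [OF \<beta>] and v = root_hom_simps [OF neg_root [OF \<beta>]]
  define m where "m = ?u (- a) ** ?v c ** ?u a"
  define n1 where "n1 = coroot R \<beta> a ** sigma_root R \<beta>"
  have inv: "invertible m" "invertible n1"
    using a \<beta> sigma_in_N by (simp_all add: m_def n1_def u v invertible_mult coroot_simps)
  have "n = n1 ** m"
  proof -
    have "n1 ** m = ?u a ** ?v (- inverse a + c) ** ?u a"
      unfolding n1_def m_def reflection_factorization [OF \<beta> a, symmetric]
      by (simp only: v(1)) (simp add: u(4,5) mult_assoc)
    then show ?thesis by (simp add: n c_def)
  qed
  have m_T: "conj_by m t = t" if t: "t \<in> T" for t
  proof -
    have "conj_by n1 (conj_by m t) = conj_by (sigma_root R \<beta>) t"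
      using refl [OF t] inv by (simp add: conj_by_comp \<open>n = n1 ** m\<close>)
    also have "\<dots> = conj_by n1 t"
      using a \<beta> t sigma_in_N by (simp add: n1_def conj_by_comp [symmetric] conj_by_T coroot_simps)
    finally show ?thesis using inv by (simp add: conj_by_inj)
  qed
  have v_conj: "conj_by t (?v x) = ?v (x / \<beta> t)" if "t \<in> T" for t x
    using that v(6) by (simp add: neg_char_def field_simps)
  have step: "conj_by (?u ((k - 1) * a)) (?v c) = ?v (c / k)" if k: "k \<noteq> 0" for k
  proof -
    obtain t where t: "t \<in> T" "\<beta> t = k" using root_surj [OF \<beta> k] by blast
    have "conj_by t m = m"
      using m_T [OF t(1)] t inv by (simp add: conj_by_eq_iff)
    moreover have "conj_by t m = ?u (- (k * a)) ** ?v (c / k) ** ?u (k * a)"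
      using t by (simp add: m_def conj_by_mult v_conj u(6))
    ultimately have m: "m = ?u (- (k * a)) ** ?v (c / k) ** ?u (k * a)" by simp
    have "conj_by (?u (k * a)) m = ?v (c / k)"
      unfolding m conj_by_def by (simp add: u(4,5) mult_assoc)
    moreover have "conj_by (?u (k * a)) m = conj_by (?u (k * a + - a)) (?v c)"
      by (simp only: u(1) u(5)) (simp add: m_def conj_by_def u(4,5) mult_assoc minv_mult)
    ultimately show ?thesis by (simp add: algebra_simps)
  qed
  have moebius: "conj_by (?u a) (?v (c * z)) = ?v (c * z / (1 + z))" if z: "z \<noteq> 0" "1 + z \<noteq> 0" for z
  proof -
    (* conjugating step for k = 1 + z by this t rescales (k - 1) a to a and c to c z *)
    obtain t where t: "t \<in> T" "\<beta> t = inverse z" using root_surj [OF \<beta>, of "inverse z"] z by auto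
    have "conj_by t (conj_by (?u ((1 + z - 1) * a)) (?v c)) = conj_by t (?v (c / (1 + z)))"
      by (simp only: step [OF z(2)])
    also have "conj_by t (conj_by (?u ((1 + z - 1) * a)) (?v c))
        = conj_by (conj_by t (?u (z * a))) (conj_by t (?v c))"
      using t by (simp add: conj_by_comp u(4)) (simp add: conj_by_def mult_assoc)
    also have "\<dots> = conj_by (?u a) (?v (c * z))"
      using t z by (simp add: v_conj u(6) divide_inverse mult.assoc [symmetric])
    finally show ?thesis using t by (simp add: v_conj divide_inverse mult_ac)
  qed
  have "\<exists>p. p \<notin> {0, -1, -2 :: 'a}"
    by (rule ex_new_if_finite [OF infinite_UNIV_alg_closed]) simp
  then obtain p :: 'a where p: "p \<noteq> 0" "1 + p \<noteq> 0" "2 + p \<noteq> 0"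
    by (auto simp: add_eq_0_iff)
  have "\<exists>z. z \<notin> {0, -1, p, p + 1}"
    by (rule ex_new_if_finite [OF infinite_UNIV_alg_closed]) simp
  then obtain z where z: "z \<noteq> 0" "1 + z \<noteq> 0" "z \<noteq> p" "z \<noteq> p + 1"
    by (auto simp: add_eq_0_iff)
  (* p and z avoid all values at which a denominator below or the final factor 2 + p vanishes *)
  define w where "w = p - z"
  have w: "w \<noteq> 0" "1 + w \<noteq> 0" "z + w = p" using z by (auto simp: w_def algebra_simps)
  have "?v (c * p / (1 + p)) = conj_by (?u a) (?v (c * z) ** ?v (c * w))"
    using moebius [OF p(1,2)] w(3) by (simp add: v(1) [symmetric] distrib_left [symmetric])
  also have "\<dots> = ?v (c * z / (1 + z)) ** ?v (c * w / (1 + w))"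
    using z w by (simp add: conj_by_mult u(4) moebius)
  finally have "c * p / (1 + p) = c * z / (1 + z) + c * w / (1 + w)"
    by (simp only: v(1) [symmetric] v(2))
  then have "c * (p / (1 + p)) = c * (z / (1 + z) + w / (1 + w))"
    by (simp add: distrib_left)
  then have "p / (1 + p) = z / (1 + z) + w / (1 + w)" using c by (simp only: mult_cancel_left) simp
  then have "p * ((1 + z) * (1 + w)) = (z * (1 + w) + w * (1 + z)) * (1 + p)"
    using p z w by (simp add: divide_simps)
  then have "z * w * (2 + p) = 0" unfolding w(3) [symmetric] by (simp add: algebra_simps)
  then show False using z w p by simp
qed

lemma conj_reflection:
  assumes n: "n \<in> N" and \<alpha>: "\<alpha> \<in> \<Phi>" and t: "t \<in> T"
  shows "conj_by (conj_by n (sigma_root R \<alpha>)) t = t ** minv (conj_by n (coroot R \<alpha> (act_char n \<alpha> t)))"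
proof -
  define s where "s = conj_by (minv n) t"
  have s: "s \<in> T" "t = conj_by n s" using n t by (auto simp: s_def)
  have nz: "\<alpha> s \<noteq> 0" using s by (simp add: root_simps \<alpha>)
  have "conj_by (conj_by n (sigma_root R \<alpha>)) t = conj_by n (conj_by (sigma_root R \<alpha>) s)"
    using n \<alpha> sigma_in_N s
    by (simp add: conj_by_comp) (simp add: conj_by_def mult_assoc)
  then show ?thesis
    using n \<alpha> s nz
    by (simp add: sigma_conj conj_by_mult conj_by_minv coroot_simps act_char_conj)
qed

text \<open>
  Conjugation by \<open>n \<in> N\<close> carries the triple defining \<open>\<sigma>\<^sub>\<alpha>\<close> to a triple for the root \<open>n \<alpha>\<close>,
  hence to a multiple of \<open>\<sigma>\<close> of that root by a value of its coroot.
\<close>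
lemma conj_sigma:
  assumes n: "n \<in> N" and \<alpha>: "\<alpha> \<in> \<Phi>"
    and coroot: "\<And>x. x \<noteq> 0 \<Longrightarrow> conj_by n (coroot R \<alpha> x) = coroot R (act_char n \<alpha>) x"
  shows "\<exists>c. c \<noteq> 0 \<and> conj_by n (sigma_root R \<alpha>)
    = coroot R (act_char n \<alpha>) c ** sigma_root R (act_char n \<alpha>)"
proof -
  let ?\<beta> = "act_char n \<alpha>" and ?m = "conj_by n (sigma_root R \<alpha>)"
  have \<beta>: "?\<beta> \<in> \<Phi>" by (rule act_char_root [OF n \<alpha>])
  obtain a where a: "a \<noteq> 0" "\<And>x. conj_by n (root_hom R \<alpha> x) = root_hom R ?\<beta> (a * x)"
    using conj_root_hom [OF n \<alpha>] by blast
  obtain b where b: "b \<noteq> 0" "\<And>x. conj_by n (root_hom R (neg \<alpha>) x) = root_hom R (neg ?\<beta>) (b * x)"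
    using conj_root_hom [OF n neg_root [OF \<alpha>]] n by (auto simp: act_char_neg)
  have m: "?m = root_hom R ?\<beta> a ** root_hom R (neg ?\<beta>) (- b) ** root_hom R ?\<beta> a"
    using n by (simp add: sigma_root_def conj_by_mult a b)
  have "conj_by ?m t = conj_by (sigma_root R ?\<beta>) t" if t: "t \<in> T" for t
  proof -
    have "?\<beta> t \<noteq> 0" using t \<beta> by (simp add: root_simps)
    then show ?thesis using conj_reflection [OF n \<alpha> t] t by (simp add: sigma_conj \<beta> coroot)
  qed
  then have "b = inverse a" by (rule reflection_triple [OF \<beta> a(1) m])
  then show ?thesis using m reflection_factorization [OF \<beta> a(1)] a(1) by auto
qed

end

section \<open>Coordinates on the torus\<close>

lemma regular_Gm_laurent:
  fixes f :: "'a::field \<Rightarrow> 'a"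
  assumes "f \<in> regular_Gm"
  shows "\<exists>p n. \<forall>x. x \<noteq> 0 \<longrightarrow> f x * x ^ n = poly p x"
  using assms unfolding regular_Gm_def
proof induction
  case (const c)
  show ?case by (intro exI [of _ "[:c:]"] exI [of _ 0]) simp
next
  case (gen f)
  then consider "f = (\<lambda>x. x)" | "f = (\<lambda>x. inverse x)" by blast
  then show ?case
  proof cases
    case 1
    then show ?thesis by (intro exI [of _ "[:0, 1:]"] exI [of _ 0]) simp
  next
    case 2
    then show ?thesis by (intro exI [of _ 1] exI [of _ 1]) simp
  qed
next
  case (add f g)
  then obtain p n q m where
    "\<forall>x. x \<noteq> 0 \<longrightarrow> f x * x ^ n = poly p x" "\<forall>x. x \<noteq> 0 \<longrightarrow> g x * x ^ m = poly q x" by blast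
  then have "(f x + g x) * x ^ (n + m) = poly (p * monom 1 m + q * monom 1 n) x" if "x \<noteq> 0" for x
    using that by (simp add: poly_monom power_add distrib_right) (metis mult.assoc mult.commute)
  then show ?case by blast
next
  case (mult f g)
  then obtain p n q m where
    "\<forall>x. x \<noteq> 0 \<longrightarrow> f x * x ^ n = poly p x" "\<forall>x. x \<noteq> 0 \<longrightarrow> g x * x ^ m = poly q x" by blast
  then have "(f x * g x) * x ^ (n + m) = poly (p * q) x" if "x \<noteq> 0" for x
    using that by (simp add: power_add) (metis mult.assoc mult.commute)
  then show ?case by blast
qed

lemma poly_eq_on_nonzero:
  fixes p q :: "'a::alg_closed_field poly"
  assumes "\<And>x. x \<noteq> 0 \<Longrightarrow> poly p x = poly q x"
  shows "p = q"
proof (rule ccontr)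
  assume "p \<noteq> q"
  then have "finite {x. poly (p - q) x = 0}" by (intro poly_roots_finite) simp
  moreover have "- {0} \<subseteq> {x. poly (p - q) x = 0}" using assms by auto
  ultimately have "finite (- {0 :: 'a})" by (rule rev_finite_subset)
  then show False using infinite_UNIV_alg_closed [where 'a = 'a] by simp
qed

text \<open>
  With \<open>f\<close> the polynomial \<open>p = x\<^sup>n f\<close> is multiplicative, \<open>p(y x) = p(y) p(x)\<close>, and comparing coefficients of \<open>x\<^sup>i\<close> gives \<open>p(y) = y\<^sup>i\<close> for every
  \<open>i\<close> in the support of \<open>p\<close>.
\<close>
lemma regular_Gm_hom_power:
  fixes f :: "'a::alg_closed_field \<Rightarrow> 'a"
  assumes f: "f \<in> regular_Gm" and one: "f 1 = 1"
    and mult: "\<And>x y. \<lbrakk>x \<noteq> 0; y \<noteq> 0\<rbrakk> \<Longrightarrow> f (x * y) = f x * f y"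
  shows "\<exists>k::int. \<forall>x. x \<noteq> 0 \<longrightarrow> f x = x powi k"
proof -
  obtain p n where p: "\<And>x. x \<noteq> 0 \<Longrightarrow> f x * x ^ n = poly p x"
    using regular_Gm_laurent [OF f] by blast
  have "poly p 1 = 1" using p [of 1] one by simp
  then have "p \<noteq> 0" by auto
  then obtain i where i: "coeff p i \<noteq> 0" by (auto simp: poly_eq_iff)
  have "f y = y powi (int i - int n)" if y: "y \<noteq> 0" for y
  proof -
    have "pcompose p [:0, y:] = smult (poly p y) p"
    proof (rule poly_eq_on_nonzero)
      fix x :: 'a assume x: "x \<noteq> 0"
      have "poly p (y * x) = f (y * x) * (y * x) ^ n" using x y p [of "y * x"] by simp
      also have "\<dots> = (f y * y ^ n) * (f x * x ^ n)"
        using x y by (simp add: mult power_mult_distrib mult_ac)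
      also have "\<dots> = poly p y * poly p x" using x y p by simp
      finally have "poly p (y * x) = poly p y * poly p x" .
      then show "poly (pcompose p [:0, y:]) x = poly (smult (poly p y) p) x"
        by (simp add: poly_pcompose mult.commute)
    qed
    then have "coeff (pcompose p [:0, y:]) i = coeff (smult (poly p y) p) i" by simp
    then have "y ^ i = poly p y" using i by (simp add: coeff_pcompose_linear)
    then have "f y = y ^ i / y ^ n" using p [OF y] y by (simp add: field_simps)
    then show ?thesis using y by (simp add: power_int_diff)
  qed
  then show ?thesis by blast
qed

lemma powi_eq_imp_eq:
  assumes "\<And>x::'a::alg_closed_field. x \<noteq> 0 \<Longrightarrow> x powi k = x powi l"
  shows "k = l"
proof -
  have aux: "d = 0" if "\<And>x::'a. x \<noteq> 0 \<Longrightarrow> x ^ d = 1" for d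
  proof -
    have "monom 1 d = (1 :: 'a poly)"
      using that by (intro poly_eq_on_nonzero) (simp add: poly_monom)
    then show ?thesis by (metis degree_1 degree_monom_eq zero_neq_one)
  qed
  have "nat \<bar>k - l\<bar> = 0"
  proof (rule aux)
    fix x :: 'a assume x: "x \<noteq> 0"
    have "x powi (k - l) = 1" "x powi (l - k) = 1" using assms [OF x] x by (simp_all add: power_int_diff)
    moreover have "\<bar>k - l\<bar> = k - l \<or> \<bar>k - l\<bar> = l - k" by arith
    ultimately have "x powi \<bar>k - l\<bar> = 1" by metis
    then show "x ^ nat \<bar>k - l\<bar> = 1" by (simp add: power_int_def)
  qed
  then show ?thesis by simp
qed

lemma powi_prod: "x \<noteq> 0 \<Longrightarrow> (\<Prod>i\<in>S. x powi f i) = (x::'a::field) powi (\<Sum>i\<in>S. f i)"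
  by (induction S rule: infinite_finite_induct) (auto simp: power_int_add)

lemma prod_powi: "(\<Prod>i\<in>S. f i) powi k = (\<Prod>i\<in>S. (f i::'a::field) powi k)"
  by (induction S rule: infinite_finite_induct) (auto simp: power_int_mult_distrib)

text \<open>
  Along a homomorphism \<open>\<nu>\<close>, the inverse of \<open>det \<nu>(x)\<close> is \<open>det \<nu>(x\<^sup>-\<^sup>1)\<close>, which is polynomial in
  regular functions.
\<close>
lemma cocharacter_coordinate:
  fixes \<nu> :: "'a::alg_closed_field \<Rightarrow> 'a ^ 'n::finite ^ 'n"
  assumes \<nu>: "\<And>x. x \<noteq> 0 \<Longrightarrow> invertible (\<nu> x)" "\<And>x y. \<lbrakk>x \<noteq> 0; y \<noteq> 0\<rbrakk> \<Longrightarrow> \<nu> (x * y) = \<nu> x ** \<nu> y"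
      "\<nu> 1 = mat 1" "regular_map regular_Gm (UNIV - {0}) \<nu>"
    and g: "g \<in> regular_GLn"
  shows "\<exists>f\<in>regular_Gm. \<forall>x\<in>UNIV - {0}. g (\<nu> x) = f x"
proof -
  let ?D = "{\<lambda>x. x, \<lambda>x. inverse x} :: ('a \<Rightarrow> 'a) set"
  have entry: "\<exists>f\<in>function_algebra ?D. \<forall>x\<in>UNIV - {0}. \<nu> x $ i $ j = f x" for i j
    using \<nu>(4) by (simp add: regular_map_def regular_Gm_def)
  have inverse_entry: "\<exists>f\<in>function_algebra ?D. \<forall>x\<in>UNIV - {0}. \<nu> (inverse x) $ i $ j = f x" for i j
  proof -
    obtain f where f: "f \<in> function_algebra ?D" "\<forall>x\<in>UNIV - {0}. \<nu> x $ i $ j = f x"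
      using entry by blast
    have "\<exists>f'\<in>function_algebra ?D. \<forall>x\<in>UNIV - {0}. f (inverse x) = f' x"
    proof (rule function_algebra_comp [OF f(1)])
      fix g assume "g \<in> ?D"
      then have "(\<lambda>x. g (inverse x)) \<in> ?D" by auto
      then show "\<exists>g'\<in>function_algebra ?D. \<forall>x\<in>UNIV - {0}. g (inverse x) = g' x"
        by (rule rev_bexI [OF function_algebra.gen]) simp
    qed
    then show ?thesis using f(2) by auto
  qed
  obtain f where f: "\<And>i j. f i j \<in> function_algebra ?D"
    "\<And>i j x. x \<noteq> 0 \<Longrightarrow> \<nu> (inverse x) $ i $ j = f i j x"
    using inverse_entry by (metis DiffI UNIV_I singletonD)
  have "(\<lambda>x. det (\<chi> i j. f i j x)) \<in> function_algebra ?D"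
    unfolding det_def
    by (intro function_algebra_sum function_algebra.mult function_algebra.const)
      (simp add: f function_algebra_prod)
  moreover have "inverse (det (\<nu> x)) = det (\<chi> i j. f i j x)" if x: "x \<noteq> 0" for x
  proof -
    have "(\<chi> i j. f i j x) = \<nu> (inverse x)" using f(2) [OF x] by (simp add: vec_eq_iff)
    moreover have "\<nu> x ** \<nu> (inverse x) = mat 1"
      using \<nu>(2) [of x "inverse x"] \<nu>(3) x by simp
    then have "det (\<nu> x) * det (\<nu> (inverse x)) = 1" by (simp add: det_mul [symmetric])
    ultimately show ?thesis by (metis inverse_unique)
  qed
  ultimately have det: "\<exists>f\<in>function_algebra ?D. \<forall>x\<in>UNIV - {0}. inverse (det (\<nu> x)) = f x" by auto
  show ?thesis unfolding regular_Gm_def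
    by (rule function_algebra_comp [OF g [unfolded regular_GLn_def]]) (use entry det in auto)
qed

lemma (in realized_group) cocharacter_conj_by:
  assumes n: "n \<in> N" and \<nu>: "\<nu> \<in> cocharacters T"
  shows "(\<lambda>x. conj_by n (\<nu> x)) \<in> cocharacters T"
proof -
  have "\<exists>f. f \<in> regular_Gm \<and> (\<forall>x. x \<noteq> 0 \<longrightarrow> \<nu> x $ i $ j = f x)" for i j
    using \<nu> by (force simp: cocharacters_def regular_map_def)
  then obtain f where f: "\<And>i j. f i j \<in> regular_Gm" "\<And>i j x. x \<noteq> 0 \<Longrightarrow> \<nu> x $ i $ j = f i j x"
    by metis
  have "\<exists>g\<in>regular_Gm. \<forall>x\<in>UNIV - {0}. conj_by n (\<nu> x) $ i $ j = g x" for i j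
  proof (rule bexI)
    show "(\<lambda>x. \<Sum>l\<in>UNIV. (\<Sum>k\<in>UNIV. n $ i $ k * f k l x) * minv n $ l $ j) \<in> regular_Gm"
      using f(1) unfolding regular_Gm_def
      by (intro function_algebra_sum function_algebra.mult function_algebra.const)
  qed (simp add: conj_by_entry f(2))
  then show ?thesis
    using n \<nu> by (simp add: cocharacters_def regular_map_def conj_by_mult)
qed

lemma (in realized_group) cocharacter_square:
  assumes \<nu>: "\<nu> \<in> cocharacters T"
  shows "(\<lambda>x. \<nu> (x ^ 2)) \<in> cocharacters T"
proof -
  have "regular_map regular_Gm (UNIV - {0}) (\<lambda>x. \<nu> (x ^ 2))"
    unfolding regular_map_def
  proof (intro allI)
    fix i j
    obtain f where f: "f \<in> regular_Gm" "\<forall>x\<in>UNIV - {0}. \<nu> x $ i $ j = f x"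
      using \<nu> unfolding cocharacters_def regular_map_def by blast
    let ?D = "{\<lambda>x. x, \<lambda>x. inverse x} :: ('a \<Rightarrow> 'a) set"
    have "\<exists>g\<in>function_algebra ?D. \<forall>x\<in>UNIV - {0}. f (x ^ 2) = g x"
    proof (rule function_algebra_comp [OF f(1) [unfolded regular_Gm_def]])
      fix h assume h: "h \<in> ?D"
      have "h (x ^ 2) = h x * h x" for x using h by (auto simp: power2_eq_square)
      moreover have "(\<lambda>x. h x * h x) \<in> function_algebra ?D"
        using h by (intro function_algebra.mult function_algebra.gen)
      ultimately show "\<exists>g'\<in>function_algebra ?D. \<forall>x\<in>UNIV - {0}. h (x ^ 2) = g' x"
        by (intro rev_bexI) auto
    qed
    then show "\<exists>g\<in>regular_Gm. \<forall>x\<in>UNIV - {0}. \<nu> (x ^ 2) $ i $ j = g x"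
      using f(2) by (simp add: regular_Gm_def)
  qed
  then show ?thesis
    using \<nu> by (simp add: cocharacters_def power_mult_distrib)
qed

lemma (in realized_group) cocharacter_coordinate_power:
  assumes \<nu>: "\<nu> \<in> cocharacters T" and g: "g \<in> regular_GLn" and one: "g (mat 1) = 1"
    and mult: "\<And>s t. \<lbrakk>s \<in> T; t \<in> T\<rbrakk> \<Longrightarrow> g (s ** t) = g s * g t"
  shows "\<exists>k::int. \<forall>x. x \<noteq> 0 \<longrightarrow> g (\<nu> x) = x powi k"
proof -
  note c = cocharacter [OF \<nu>]
  obtain f where f: "f \<in> regular_Gm" "\<And>x. x \<noteq> 0 \<Longrightarrow> g (\<nu> x) = f x"
    using cocharacter_coordinate [of \<nu> g] c g \<nu> by (auto simp: cocharacters_def)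
  have "\<exists>k::int. \<forall>x. x \<noteq> 0 \<longrightarrow> f x = x powi k"
    by (rule regular_Gm_hom_power [OF f(1)])
      (use f(2) c one mult in \<open>simp_all add: f(2) [symmetric]\<close>)
  then show ?thesis using f(2) by auto
qed

text \<open>
  The coordinate embeddings of \<open>F\<^sup>\<times>\<close> into a torus are cocharacters; simple connectedness will be
  applied to them.
\<close>
lemma (in realized_group) exists_torus_coordinates:
  "\<exists>r \<phi> c. bij_betw \<phi> (Gm_power r) T \<and>
    (\<forall>x\<in>Gm_power r. \<forall>y\<in>Gm_power r. \<phi> (\<lambda>k\<in>{..<r}. x k * y k) = \<phi> x ** \<phi> y) \<and>
    (\<forall>m<r. (\<lambda>x. \<phi> (\<lambda>k\<in>{..<r}. if k = m then x else 1)) \<in> cocharacters T) \<and>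
    (\<forall>k<r. c k \<in> regular_GLn \<and> (\<forall>x\<in>Gm_power r. c k (\<phi> x) = x k))"
proof -
  obtain r \<phi> where bij: "bij_betw \<phi> (Gm_power r :: (nat \<Rightarrow> 'a) set) T"
    and mult: "\<forall>x\<in>Gm_power r. \<forall>y\<in>Gm_power r. \<phi> (\<lambda>k\<in>{..<r}. x k * y k) = \<phi> x ** \<phi> y"
    and reg: "regular_map (regular_Gm_power r) (Gm_power r) \<phi>"
    and coord: "\<forall>k<r. \<exists>g\<in>regular_GLn. \<forall>x\<in>Gm_power r. g (\<phi> x) = x k"
    using tor(1) unfolding torus_def by blast
  obtain c where c: "\<forall>k<r. c k \<in> regular_GLn \<and> (\<forall>x\<in>Gm_power r. c k (\<phi> x) = x k)"
    using coord by metis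
  have "(\<lambda>x. \<phi> (\<lambda>k\<in>{..<r}. if k = m then x else 1)) \<in> cocharacters T" if m: "m < r" for m
  proof -
    let ?e = "\<lambda>x::'a. \<lambda>k\<in>{..<r}. if k = m then x else 1"
    have e: "?e x \<in> Gm_power r" if "x \<noteq> 0" for x
      using that by (auto simp: Gm_power_def)
    have "\<phi> (?e x) \<in> T" if "x \<noteq> 0" for x
      using bij e [OF that] by (auto simp: bij_betw_def)
    moreover have "\<phi> (?e (x * y)) = \<phi> (?e x) ** \<phi> (?e y)" if "x \<noteq> 0" "y \<noteq> 0" for x y
    proof -
      have "?e (x * y) = (\<lambda>k\<in>{..<r}. ?e x k * ?e y k)" by (rule ext) auto
      moreover have "\<phi> (\<lambda>k\<in>{..<r}. ?e x k * ?e y k) = \<phi> (?e x) ** \<phi> (?e y)"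
        using that by (intro mult [rule_format] e)
      ultimately show ?thesis by (simp only:)
    qed
    moreover have "regular_map regular_Gm (UNIV - {0}) (\<lambda>x. \<phi> (?e x))"
      unfolding regular_map_def
    proof (intro allI)
      fix i j
      obtain g where g: "g \<in> regular_Gm_power r" "\<forall>x\<in>Gm_power r. \<phi> x $ i $ j = g x"
        using reg unfolding regular_map_def by blast
      have "\<exists>f\<in>regular_Gm. \<forall>x\<in>UNIV - {0}. g (?e x) = f x"
        unfolding regular_Gm_def
      proof (rule function_algebra_comp [OF g(1) [unfolded regular_Gm_power_def]])
        let ?D = "{\<lambda>x. x, \<lambda>x. inverse x} :: ('a \<Rightarrow> 'a) set"
        fix h :: "(nat \<Rightarrow> 'a) \<Rightarrow> 'a"
        assume "h \<in> {\<lambda>x. x k | k. k < r} \<union> {\<lambda>x. inverse (x k) | k. k < r}"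
        then obtain k where k: "k < r" "h = (\<lambda>x. x k) \<or> h = (\<lambda>x. inverse (x k))" by blast
        have "(\<lambda>x. h (?e x)) = (\<lambda>_. 1) \<or> (\<lambda>x. h (?e x)) \<in> ?D"
          using k by (cases "k = m") auto
        then have "(\<lambda>x. h (?e x)) \<in> function_algebra ?D"
          by (elim disjE) (simp_all only: function_algebra.const function_algebra.gen)
        then show "\<exists>g'\<in>function_algebra ?D. \<forall>x\<in>UNIV - {0}. h (?e x) = g' x" by (rule rev_bexI) simp
      qed
      then show "\<exists>f\<in>regular_Gm. \<forall>x\<in>UNIV - {0}. \<phi> (?e x) $ i $ j = f x"
        using g(2) e by simp
    qed
    ultimately show ?thesis by (simp add: cocharacters_def)
  qed
  then show ?thesis using bij mult c by blast
qed

section \<open>The simply connected group of type \<open>E\<^sub>6\<close>\<close>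

text \<open>Keeps the first node in the form \<open>1\<close>, like the numerals denoting the other nodes.\<close>
declare One_nat_def [simp del]

lemma nodes: "{1..6::nat} = {1, 2, 3, 4, 5, 6}"
  by auto

lemma E6_edge_simps: "{i, j} \<in> E6_edges \<longleftrightarrow>
   (i, j) \<in> {(1, 3), (3, 4), (4, 5), (5, 6), (2, 4), (3, 1), (4, 3), (5, 4), (6, 5), (4, 2)}"
  by (auto simp: E6_edges_def doubleton_eq_iff)

lemma sum_nodes: "(\<Sum>i\<in>{1..6::nat}. f i) = f 1 + f 2 + f 3 + f 4 + f 5 + f 6"
  for f :: "nat \<Rightarrow> 'b::comm_monoid_add"
  by (simp add: nodes add_ac)

lemma prod_nodes: "(\<Prod>i\<in>{1..6::nat}. f i) = f 1 * f 2 * f 3 * f 4 * f 5 * f 6"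
  for f :: "nat \<Rightarrow> 'b::comm_monoid_mult"
  by (simp add: nodes mult_ac)

lemma E6_cartan_nonsingular:
  assumes "\<And>l. l \<in> {1..6} \<Longrightarrow> (\<Sum>j\<in>{1..6}. m j * E6_cartan j l) = 0" and "j \<in> {1..6}"
  shows "m j = 0"
proof -
  have "2 * m 1 - m 3 = 0" "2 * m 2 - m 4 = 0" "2 * m 3 - m 1 - m 4 = 0"
    "2 * m 4 - m 2 - m 3 - m 5 = 0" "2 * m 5 - m 4 - m 6 = 0" "2 * m 6 - m 5 = 0"
    using assms(1) [of 1] assms(1) [of 2] assms(1) [of 3] assms(1) [of 4] assms(1) [of 5]
      assms(1) [of 6]
    by (simp_all add: sum_nodes E6_cartan_def E6_edge_simps)
  then have "m 1 = 0" "m 2 = 0" "m 3 = 0" "m 4 = 0" "m 5 = 0" "m 6 = 0" by linarith+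
  then show ?thesis using assms(2) unfolding nodes by auto
qed

locale E6_group =
  fixes R :: "('a::alg_closed_field, 'n::finite) realization"
  assumes E6: "simply_connected_E6 R"

sublocale E6_group \<subseteq> realized_group
  using E6
  by unfold_locales
    (auto simp: simply_connected_E6_def connected_reductive_def maximal_torus_def)

context E6_group
begin

abbreviation "\<alpha> \<equiv> simple_root R"
abbreviation "\<alpha>v i \<equiv> coroot R (simple_root R i)"

definition units :: "(nat \<Rightarrow> 'a) \<Rightarrow> bool" where
  "units x \<longleftrightarrow> (\<forall>i\<in>{1..6}. x i \<noteq> 0)"

lemma E6_facts:
  shows base: "is_base R" and simply_connected: "simply_connected_group R"
    and pairing: "\<lbrakk>i \<in> {1..6}; j \<in> {1..6}; x \<noteq> 0\<rbrakk> \<Longrightarrow> \<alpha> j (\<alpha>v i x) = x powi E6_cartan i j"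
    and generators: "generate W (simple_reflection R ` {1..6}) = carrier W"
  using E6 by (auto simp: simply_connected_E6_def type_E6_def)

lemma simple_root_root: "i \<in> {1..6} \<Longrightarrow> \<alpha> i \<in> \<Phi>"
  using base by (auto simp: is_base_def)

lemmas simple_root_simps = root_simps [OF simple_root_root]
lemmas simple_coroot_simps = coroot_simps [OF simple_root_root]

lemma unitsD: "\<lbrakk>units x; i \<in> {1..6}\<rbrakk> \<Longrightarrow> x i \<noteq> 0"
  by (simp add: units_def)

lemma units_intros [intro]:
  "\<lbrakk>units x; units y\<rbrakk> \<Longrightarrow> units (\<lambda>i. x i * y i)" "units (\<lambda>_. 1)"
  "units x \<Longrightarrow> units (\<lambda>i. inverse (x i))" "units x \<Longrightarrow> units (\<lambda>i. x i ^ k)"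
  "\<lbrakk>units x; z \<noteq> 0\<rbrakk> \<Longrightarrow> units (x(i := z))" "z \<noteq> 0 \<Longrightarrow> units (\<lambda>i. z powi m i)"
  by (auto simp: units_def)

lemma units_prod [intro]:
  "(\<And>k. k \<in> K \<Longrightarrow> units (f k)) \<Longrightarrow> units (\<lambda>i. \<Prod>k\<in>K. f k i)"
  unfolding units_def by (cases "finite K") (auto simp: prod_zero_iff)

lemma tor_elt_eq:
  "tor_elt R x = \<alpha>v 1 (x 1) ** (\<alpha>v 2 (x 2) ** (\<alpha>v 3 (x 3) ** (\<alpha>v 4 (x 4) ** (\<alpha>v 5 (x 5) ** \<alpha>v 6 (x 6)))))"
  by (simp add: tor_elt_def)

lemma tor_elt_cong: "(\<And>i. i \<in> {1..6} \<Longrightarrow> x i = y i) \<Longrightarrow> tor_elt R x = tor_elt R y"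
  by (simp add: tor_elt_eq)

lemma tor_elt_in_T [simp]: "units x \<Longrightarrow> tor_elt R x \<in> T"
  by (simp add: tor_elt_eq simple_coroot_simps unitsD)

lemma tor_elt_mult:
  assumes "units x" "units y"
  shows "tor_elt R x ** tor_elt R y = tor_elt R (\<lambda>i. x i * y i)"
proof -
  have swap: "(a ** b) ** (c ** d) = (a ** c) ** (b ** d)"
    if "a \<in> T" "b \<in> T" "c \<in> T" "d \<in> T" for a b c d
    using that T_commute [of b c] by (metis matrix_mul_assoc)
  show ?thesis
    using assms by (simp add: tor_elt_eq swap simple_coroot_simps unitsD)
qed

lemma tor_elt_one [simp]: "tor_elt R (\<lambda>_. 1) = mat 1"
  by (simp add: tor_elt_eq simple_coroot_simps)

lemma tor_elt_inverse: "units x \<Longrightarrow> tor_elt R (\<lambda>i. inverse (x i)) = minv (tor_elt R x)"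
proof -
  assume x: "units x"
  have "tor_elt R x ** tor_elt R (\<lambda>i. inverse (x i)) = tor_elt R (\<lambda>i. x i * inverse (x i))"
    using x by (intro tor_elt_mult) auto
  also have "\<dots> = tor_elt R (\<lambda>_. 1)"
    using x by (intro tor_elt_cong) (simp add: unitsD)
  finally have "tor_elt R x ** tor_elt R (\<lambda>i. inverse (x i)) = tor_elt R (\<lambda>_. 1)" .
  then show ?thesis using x by (simp add: minv_unique)
qed

lemma coroot_eq_tor_elt:
  "\<lbrakk>i \<in> {1..6}; z \<noteq> 0\<rbrakk> \<Longrightarrow> \<alpha>v i z = tor_elt R ((\<lambda>_. 1)(i := z))"
  unfolding nodes by (auto simp: tor_elt_eq simple_coroot_simps)

lemma character_tor_elt:
  assumes "\<beta> \<in> characters T" "units x"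
  shows "\<beta> (tor_elt R x) = (\<Prod>i\<in>{1..6}. \<beta> (\<alpha>v i (x i)))"
  using assms by (simp add: tor_elt_eq prod_nodes character simple_coroot_simps unitsD)

lemma simple_root_tor_elt_powi:
  "\<lbrakk>units x; j \<in> {1..6}\<rbrakk> \<Longrightarrow> \<alpha> j (tor_elt R x) = (\<Prod>i\<in>{1..6}. x i powi E6_cartan i j)"
  by (simp add: character_tor_elt root_character simple_root_root pairing unitsD)

lemma simple_root_tor_elt:
  assumes "units x"
  shows "\<alpha> 1 (tor_elt R x) = x 1 ^ 2 / x 3" "\<alpha> 2 (tor_elt R x) = x 2 ^ 2 / x 4"
    "\<alpha> 3 (tor_elt R x) = x 3 ^ 2 / (x 1 * x 4)" "\<alpha> 4 (tor_elt R x) = x 4 ^ 2 / (x 2 * x 3 * x 5)"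
    "\<alpha> 5 (tor_elt R x) = x 5 ^ 2 / (x 4 * x 6)" "\<alpha> 6 (tor_elt R x) = x 6 ^ 2 / x 5"
  using assms
  by (simp_all add: simple_root_tor_elt_powi prod_nodes E6_cartan_def E6_edge_simps
      power_int_minus divide_inverse)

text \<open>
  The simple coroots are a basis of the cocharacter lattice, hence coordinates on the torus.
  With \<open>\<phi>\<close> any isomorphism of \<open>(F\<^sup>\<times>)\<^sup>r\<close> with \<open>T\<close>, simple connectedness writes the coordinate
  cocharacters of \<open>\<phi>\<close> through the simple coroots (exponents \<open>K\<close>), and the coordinates of the simple
  coroots are powers (exponents \<open>L\<close>).  Pairing with the simple roots gives \<open>L K A = A\<close> for the
  Cartan matrix \<open>A\<close>, so \<open>L K = 1\<close> because \<open>A\<close> is nonsingular.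
\<close>
lemma tor_elt_coordinates:
  shows tor_elt_surj: "t \<in> T \<Longrightarrow> \<exists>x. units x \<and> t = tor_elt R x"
    and tor_elt_eq_one: "\<lbrakk>units x; tor_elt R x = mat 1; i \<in> {1..6}\<rbrakk> \<Longrightarrow> x i = 1"
proof -
  obtain r \<phi> c where \<phi>: "bij_betw \<phi> (Gm_power r :: (nat \<Rightarrow> 'a) set) T"
    and mult: "\<And>x y. \<lbrakk>x \<in> Gm_power r; y \<in> Gm_power r\<rbrakk> \<Longrightarrow> \<phi> (\<lambda>k\<in>{..<r}. x k * y k) = \<phi> x ** \<phi> y"
    and cochar: "\<And>m. m < r \<Longrightarrow> (\<lambda>x. \<phi> (\<lambda>k\<in>{..<r}. if k = m then x else 1)) \<in> cocharacters T"
    and c: "\<And>k. k < r \<Longrightarrow> c k \<in> regular_GLn"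
      "\<And>k x. \<lbrakk>k < r; x \<in> Gm_power r\<rbrakk> \<Longrightarrow> c k (\<phi> x) = x k"
    using exists_torus_coordinates by blast
  have \<phi>_T: "\<phi> x \<in> T" if "x \<in> Gm_power r" for x using \<phi> that by (auto simp: bij_betw_def)
  have T_\<phi>: "\<exists>x\<in>Gm_power r. t = \<phi> x" if "t \<in> T" for t using \<phi> that unfolding bij_betw_def by blast
  have Gm: "x \<in> Gm_power r \<longleftrightarrow> (\<forall>k<r. x k \<noteq> 0) \<and> x \<in> extensional {..<r}" for x :: "nat \<Rightarrow> 'a"
    by (auto simp: Gm_power_def PiE_iff)
  have \<phi>_one: "\<phi> (\<lambda>k\<in>{..<r}. 1) = mat 1"
  proof -
    let ?e = "\<lambda>k\<in>{..<r}. 1 :: 'a"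
    have e: "?e \<in> Gm_power r" by (simp add: Gm)
    have "(\<lambda>k\<in>{..<r}. ?e k * ?e k) = ?e" by (rule ext) simp
    then have "\<phi> ?e ** \<phi> ?e = \<phi> ?e ** mat 1" using mult [OF e e] by simp
    then show ?thesis using mult_cancel(1) [of "\<phi> ?e" "\<phi> ?e" "mat 1"] \<phi>_T [OF e] by simp
  qed
  have c_mult: "c k (s ** t) = c k s * c k t" if k: "k < r" and s: "s \<in> T" and t: "t \<in> T" for k s t
  proof -
    obtain x y where xy: "x \<in> Gm_power r" "s = \<phi> x" "y \<in> Gm_power r" "t = \<phi> y"
      using T_\<phi> s t by blast
    then have "(\<lambda>k\<in>{..<r}. x k * y k) \<in> Gm_power r" by (simp add: Gm)
    then show ?thesis using mult [OF xy(1,3)] xy k by (simp add: c(2) flip: mult)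
  qed
  have c_one: "c k (mat 1) = 1" if "k < r" for k
    using c(2) [OF that, of "\<lambda>k\<in>{..<r}. 1"] \<phi>_one that by (simp add: Gm)
  have "\<exists>K. \<forall>x. x \<noteq> 0 \<longrightarrow> \<phi> (\<lambda>k\<in>{..<r}. if k = m then x else 1) = tor_elt R (\<lambda>i. x powi K i)"
    if "m < r" for m
    using bspec [OF simply_connected [unfolded simply_connected_group_def] cochar [OF that]]
    by auto
  then obtain K where K: "\<And>m x. \<lbrakk>m < r; x \<noteq> 0\<rbrakk> \<Longrightarrow>
      \<phi> (\<lambda>k\<in>{..<r}. if k = m then x else 1) = tor_elt R (\<lambda>i. x powi K m i)" by metis
  have "\<exists>l::int. \<forall>x. x \<noteq> 0 \<longrightarrow> c k (\<alpha>v i x) = x powi l" if "k < r" "i \<in> {1..6}" for k i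
    using that c_mult c_one c(1)
    by (intro cocharacter_coordinate_power coroot_cocharacter simple_root_root) auto
  then obtain L where L: "\<And>k i x. \<lbrakk>k < r; i \<in> {1..6}; x \<noteq> 0\<rbrakk> \<Longrightarrow> c k (\<alpha>v i x) = x powi L k i" by metis
  have \<phi>_K: "\<phi> z = tor_elt R (\<lambda>i. \<Prod>k<r. z k powi K k i)" if z: "z \<in> Gm_power r" for z
  proof -
    have "\<phi> (\<lambda>k\<in>{..<r}. if k < m then z k else 1) = tor_elt R (\<lambda>i. \<Prod>k<m. z k powi K k i)"
      if "m \<le> r" for m
      using that
    proof (induction m)
      case 0
      then show ?case using \<phi>_one by (simp add: restrict_def)
    next
      case (Suc m)
      let ?z = "\<lambda>k\<in>{..<r}. if k < m then z k else 1"
      let ?e = "\<lambda>k\<in>{..<r}. if k = m then z m else 1"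
      have nz: "z k \<noteq> 0" if "k < r" for k using z that by (simp add: Gm)
      have u: "units (\<lambda>i. \<Prod>k<m. z k powi K k i)" "units (\<lambda>i. z m powi K m i)"
        using nz Suc.prems by (auto intro!: units_intros)
      have "(\<lambda>k\<in>{..<r}. if k < Suc m then z k else 1) = (\<lambda>k\<in>{..<r}. ?z k * ?e k)"
        using Suc.prems by (auto simp: fun_eq_iff less_Suc_eq)
      moreover have "?z \<in> Gm_power r" "?e \<in> Gm_power r" using nz Suc.prems by (auto simp: Gm)
      ultimately have "\<phi> (\<lambda>k\<in>{..<r}. if k < Suc m then z k else 1) = \<phi> ?z ** \<phi> ?e"
        by (simp only: mult)
      also have "\<phi> ?z = tor_elt R (\<lambda>i. \<Prod>k<m. z k powi K k i)"
        using Suc.prems by (intro Suc.IH) simp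
      also have "\<phi> ?e = tor_elt R (\<lambda>i. z m powi K m i)"
        using Suc.prems nz by (intro K) auto
      also have "tor_elt R (\<lambda>i. \<Prod>k<m. z k powi K k i) ** tor_elt R (\<lambda>i. z m powi K m i)
          = tor_elt R (\<lambda>i. \<Prod>k<Suc m. z k powi K k i)" using u by (simp add: tor_elt_mult)
      finally show ?case .
    qed
    from this [of r] have "\<phi> (\<lambda>k\<in>{..<r}. if k < r then z k else 1) = tor_elt R (\<lambda>i. \<Prod>k<r. z k powi K k i)"
      by simp
    moreover have "(\<lambda>k\<in>{..<r}. if k < r then z k else 1) = z"
      using z by (auto simp: fun_eq_iff Gm extensional_def)
    ultimately show ?thesis by simp
  qed
  have units_K: "units (\<lambda>i. \<Prod>k<r. z k powi K k i)" if "\<And>k. k < r \<Longrightarrow> z k \<noteq> 0" for z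
    using that by (auto intro!: units_intros)
  show "t \<in> T \<Longrightarrow> \<exists>x. units x \<and> t = tor_elt R x"
  proof -
    assume "t \<in> T"
    then obtain z where z: "z \<in> Gm_power r" "t = \<phi> z" using T_\<phi> by blast
    then show ?thesis using \<phi>_K [OF z(1)] units_K [of z] by (auto simp: Gm)
  qed
  define M where "M i j = (\<Sum>k<r. L k i * K k j)" for i j
  have t_c: "t = tor_elt R (\<lambda>j. \<Prod>k<r. c k t powi K k j)" if t: "t \<in> T" for t
  proof -
    obtain z where z: "z \<in> Gm_power r" "t = \<phi> z" using T_\<phi> t by blast
    show ?thesis unfolding z(2) by (subst \<phi>_K [OF z(1)]) (simp add: c(2) [OF _ z(1)])
  qed
  have coroot_M: "\<alpha>v i x = tor_elt R (\<lambda>j. x powi M i j)" if "i \<in> {1..6}" "x \<noteq> 0" for i x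
  proof -
    have "\<alpha>v i x = tor_elt R (\<lambda>j. \<Prod>k<r. (x powi L k i) powi K k j)"
      using t_c [of "\<alpha>v i x"] that by (simp add: simple_coroot_simps L)
    then show ?thesis using that by (simp add: powi_prod M_def flip: power_int_mult)
  qed
  have M_cartan: "(\<Sum>j\<in>{1..6}. M i j * E6_cartan j l) = E6_cartan i l"
    if "i \<in> {1..6}" "l \<in> {1..6}" for i l
  proof (rule powi_eq_imp_eq)
    fix x :: 'a assume x: "x \<noteq> 0"
    have "x powi E6_cartan i l = \<alpha> l (tor_elt R (\<lambda>j. x powi M i j))"
      using pairing [OF that x] coroot_M [OF that(1) x] by simp
    also have "\<dots> = x powi (\<Sum>j\<in>{1..6}. M i j * E6_cartan j l)"
      using that x by (subst simple_root_tor_elt_powi) (auto simp: powi_prod simp flip: power_int_mult)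
    finally show "x powi (\<Sum>j\<in>{1..6}. M i j * E6_cartan j l) = x powi E6_cartan i l" by simp
  qed
  have M: "M i j = (if j = i then 1 else 0)" if i: "i \<in> {1..6}" and j: "j \<in> {1..6}" for i j
  proof -
    have "M i j - (if j = i then 1 else 0) = 0"
    proof (rule E6_cartan_nonsingular [OF _ j])
      fix l :: nat assume l: "l \<in> {1..6}"
      have "(\<Sum>j\<in>{1..6}. (if j = i then 1 else 0) * E6_cartan j l) = E6_cartan i l"
        using i by (simp add: if_distrib [of "\<lambda>a. a * _"] cong: if_cong)
      then show "(\<Sum>j\<in>{1..6}. (M i j - (if j = i then 1 else 0)) * E6_cartan j l) = 0"
        using M_cartan [OF i l] by (simp add: left_diff_distrib sum_subtractf)
    qed
    then show ?thesis by simp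
  qed
  show "x j = 1" if x: "units x" and one: "tor_elt R x = mat 1" and j: "j \<in> {1..6}" for x j
  proof -
    have "(\<Prod>i\<in>{1..6}. x i powi L k i) = 1" if "k < r" for k
    proof -
      have "c k (tor_elt R x) = (\<Prod>i\<in>{1..6}. x i powi L k i)"
        using x that by (simp add: tor_elt_eq c_mult simple_coroot_simps unitsD L prod_nodes)
      then show ?thesis using one c_one that by simp
    qed
    then have "1 = (\<Prod>k<r. (\<Prod>i\<in>{1..6}. x i powi L k i) powi K k j)" by simp
    also have "\<dots> = (\<Prod>k<r. \<Prod>i\<in>{1..6}. x i powi (L k i * K k j))"
      by (simp add: prod_powi power_int_mult)
    also have "\<dots> = (\<Prod>i\<in>{1..6}. \<Prod>k<r. x i powi (L k i * K k j))" by (rule prod.swap)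
    also have "\<dots> = (\<Prod>i\<in>{1..6}. x i powi M i j)"
      using x by (intro prod.cong) (simp_all add: powi_prod M_def unitsD)
    also have "\<dots> = (\<Prod>i\<in>{1..6}. if i = j then x j else 1)"
      using j by (intro prod.cong) (auto simp: M)
    also have "\<dots> = x j" using j by simp
    finally show ?thesis by simp
  qed
qed

lemma tor_elt_inj:
  assumes "units x" "units y" "tor_elt R x = tor_elt R y" "i \<in> {1..6}"
  shows "x i = y i"
proof -
  have "tor_elt R (\<lambda>i. x i * inverse (y i)) = tor_elt R x ** tor_elt R (\<lambda>i. inverse (y i))"
    using assms by (intro tor_elt_mult [symmetric]) auto
  also have "\<dots> = mat 1" using assms by (simp add: tor_elt_inverse)
  finally have "x i * inverse (y i) = 1"
    using assms by (intro tor_elt_eq_one) auto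
  then show ?thesis using assms unitsD by (simp add: field_simps)
qed

lemma tor_elt_eq_iff:
  "\<lbrakk>units x; units y\<rbrakk> \<Longrightarrow> tor_elt R x = tor_elt R y \<longleftrightarrow> (\<forall>i\<in>{1..6}. x i = y i)"
  using tor_elt_inj tor_elt_cong by blast

lemma sigma_conj_tor_elt:
  assumes "i \<in> {1..6}" "units x"
  shows "conj_by (sigma R i) (tor_elt R x) = tor_elt R (x(i := x i / \<alpha> i (tor_elt R x)))"
proof -
  let ?a = "\<alpha> i (tor_elt R x)"
  have a: "?a \<noteq> 0" using assms by (simp add: simple_root_simps)
  have "conj_by (sigma R i) (tor_elt R x) = tor_elt R x ** \<alpha>v i (inverse ?a)"
    using assms a by (simp add: sigma_conj simple_root_root simple_coroot_simps)
  also have "\<dots> = tor_elt R (\<lambda>k. x k * ((\<lambda>_. 1)(i := inverse ?a)) k)"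
    using assms a by (subst coroot_eq_tor_elt) (auto simp: tor_elt_mult units_intros)
  also have "\<dots> = tor_elt R (x(i := x i / ?a))"
    by (rule tor_elt_cong) (simp add: divide_inverse)
  finally show ?thesis .
qed

end

section \<open>Positive roots and the braid relations for the Tits lifts\<close>

context E6_group
begin

definition has_coeffs :: "('a ^ 'n ^ 'n \<Rightarrow> 'a) \<Rightarrow> (nat \<Rightarrow> int) \<Rightarrow> bool" where
  "has_coeffs \<beta> k \<longleftrightarrow> (\<forall>t\<in>T. \<beta> t = (\<Prod>i\<in>{1..6}. \<alpha> i t powi k i))"

definition positive :: "('a ^ 'n ^ 'n \<Rightarrow> 'a) \<Rightarrow> bool" where
  "positive \<beta> \<longleftrightarrow> (\<exists>k. has_coeffs \<beta> k \<and> (\<forall>i\<in>{1..6}. k i \<ge> 0))"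

lemma has_coeffs_unique:
  assumes "has_coeffs \<beta> k" "has_coeffs \<beta> l" "i \<in> {1..6}"
  shows "k i = l i"
proof -
  have "(\<Prod>i\<in>{1..6}. \<alpha> i t powi (k i - l i)) = 1" if t: "t \<in> T" for t
  proof -
    have nz: "\<alpha> i t \<noteq> 0" if "i \<in> {1..6}" for i using t that by (simp add: simple_root_simps)
    have "(\<Prod>i\<in>{1..6}. \<alpha> i t powi (k i - l i)) = (\<Prod>i\<in>{1..6}. \<alpha> i t powi k i) / (\<Prod>i\<in>{1..6}. \<alpha> i t powi l i)"
      using nz by (simp add: power_int_diff flip: prod_dividef)
    also have "\<dots> = \<beta> t / \<beta> t" using assms t by (simp add: has_coeffs_def)
    also have "\<dots> = 1" using assms(1) t nz by (simp add: has_coeffs_def)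
    finally show ?thesis .
  qed
  then have "\<forall>i\<in>{1..6}. k i - l i = 0"
    using base unfolding is_base_def by (elim conjE allE [of _ "\<lambda>i. k i - l i"]) blast
  then show ?thesis using assms(3) by simp
qed

lemma has_coeffs_eqI:
  assumes "has_coeffs \<beta> k" "has_coeffs \<gamma> l" "\<beta> \<in> \<Phi>" "\<gamma> \<in> \<Phi>" "\<And>i. i \<in> {1..6} \<Longrightarrow> k i = l i"
  shows "\<beta> = \<gamma>"
proof
  fix t show "\<beta> t = \<gamma> t"
    using assms by (cases "t \<in> T") (auto simp: has_coeffs_def root_simps(5))
qed

lemma root_coeffs:
  assumes "\<beta> \<in> \<Phi>"
  obtains k where "has_coeffs \<beta> k"
  using assms base unfolding is_base_def has_coeffs_def by blast

lemma root_coeffs_sign: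
  assumes \<beta>: "\<beta> \<in> \<Phi>" and k: "has_coeffs \<beta> k"
  shows "(\<forall>i\<in>{1..6}. k i \<ge> 0) \<or> (\<forall>i\<in>{1..6}. k i \<le> 0)"
proof -
  obtain l where "has_coeffs \<beta> l" "(\<forall>i\<in>{1..6}. l i \<ge> 0) \<or> (\<forall>i\<in>{1..6}. l i \<le> 0)"
    using \<beta> base unfolding is_base_def has_coeffs_def by blast
  then show ?thesis using has_coeffs_unique [OF k] by metis
qed

lemma root_coeffs_nonzero:
  assumes \<beta>: "\<beta> \<in> \<Phi>" and k: "has_coeffs \<beta> k"
  shows "\<exists>i\<in>{1..6}. k i \<noteq> 0"
proof (rule ccontr)
  assume "\<not> ?thesis"
  then have "\<beta> t = 1" if "t \<in> T" for t using k that by (simp add: has_coeffs_def)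
  then show False using \<beta> by (auto simp: roots_def)
qed

lemma has_coeffs_simple_root: "i \<in> {1..6} \<Longrightarrow> has_coeffs (\<alpha> i) (\<lambda>j. if j = i then 1 else 0)"
  by (simp add: has_coeffs_def if_distrib [of "\<lambda>k. _ powi k"] cong: if_cong)

lemma has_coeffs_neg: "has_coeffs \<beta> k \<Longrightarrow> has_coeffs (neg \<beta>) (\<lambda>i. - k i)"
  by (simp add: has_coeffs_def neg_char_def power_int_minus comp_def flip: prod_inversef)

lemma positive_simple_root: "i \<in> {1..6} \<Longrightarrow> positive (\<alpha> i)"
  using has_coeffs_simple_root unfolding positive_def by force

lemma positive_coeffs:
  "\<lbrakk>has_coeffs \<beta> k\<rbrakk> \<Longrightarrow> positive \<beta> \<longleftrightarrow> (\<forall>i\<in>{1..6}. k i \<ge> 0)"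
  unfolding positive_def using has_coeffs_unique by metis

lemma positive_neg:
  assumes "\<beta> \<in> \<Phi>" shows "positive (neg \<beta>) \<longleftrightarrow> \<not> positive \<beta>"
proof -
  obtain k where k: "has_coeffs \<beta> k" using root_coeffs assms by blast
  have "positive (neg \<beta>) \<longleftrightarrow> (\<forall>i\<in>{1..6}. k i \<le> 0)"
    using positive_coeffs [OF has_coeffs_neg [OF k]] by simp
  then show ?thesis
    using positive_coeffs [OF k] root_coeffs_sign [OF assms k] root_coeffs_nonzero [OF assms k]
    by (metis order_antisym)
qed

lemma simple_root_inj: "inj_on \<alpha> {1..6}"
proof (rule inj_onI)
  fix i j :: nat assume ij: "i \<in> {1..6}" "j \<in> {1..6}" "\<alpha> i = \<alpha> j"
  have "has_coeffs (\<alpha> i) (\<lambda>l. if l = j then 1 else 0)"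
    unfolding ij(3) by (rule has_coeffs_simple_root [OF ij(2)])
  from has_coeffs_unique [OF this has_coeffs_simple_root [OF ij(1)] ij(1)]
  show "i = j" by (simp split: if_splits)
qed

lemma cocharacter_exponents:
  assumes "\<nu> \<in> cocharacters T"
  shows "\<exists>k. \<forall>x. x \<noteq> 0 \<longrightarrow> \<nu> x = tor_elt R (\<lambda>i. x powi k i)"
  using bspec [OF simply_connected [unfolded simply_connected_group_def] assms] by auto

lemma simple_root_tor_elt_powers:
  "\<lbrakk>j \<in> {1..6}; x \<noteq> 0\<rbrakk> \<Longrightarrow>
    \<alpha> j (tor_elt R (\<lambda>i. x powi k i)) = x powi (\<Sum>i\<in>{1..6}. k i * E6_cartan i j)"
  by (subst simple_root_tor_elt_powi) (auto simp: powi_prod simp flip: power_int_mult)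

lemma cocharacter_pairing:
  assumes "\<nu> \<in> cocharacters T"
  shows "\<exists>p. \<forall>j x. j \<in> {1..6} \<longrightarrow> x \<noteq> 0 \<longrightarrow> \<alpha> j (\<nu> x) = x powi p j"
proof -
  obtain k where "\<forall>x. x \<noteq> 0 \<longrightarrow> \<nu> x = tor_elt R (\<lambda>i. x powi k i)"
    using cocharacter_exponents [OF assms] by blast
  then show ?thesis
    using simple_root_tor_elt_powers
    by (intro exI [of _ "\<lambda>j. \<Sum>i\<in>{1..6}. k i * E6_cartan i j"]) simp
qed

text \<open>
  Pairings with the simple roots determine a cocharacter, since the Cartan matrix is nonsingular.
\<close>
lemma cocharacter_eqI:
  assumes \<nu>: "\<nu> \<in> cocharacters T" and \<mu>: "\<mu> \<in> cocharacters T"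
    and eq: "\<And>j x. \<lbrakk>j \<in> {1..6}; x \<noteq> 0\<rbrakk> \<Longrightarrow> \<alpha> j (\<nu> x) = \<alpha> j (\<mu> x)" and x: "x \<noteq> 0"
  shows "\<nu> x = \<mu> x"
proof -
  obtain k where k: "\<forall>x. x \<noteq> 0 \<longrightarrow> \<nu> x = tor_elt R (\<lambda>i. x powi k i)"
    using cocharacter_exponents [OF \<nu>] by blast
  obtain l where l: "\<forall>x. x \<noteq> 0 \<longrightarrow> \<mu> x = tor_elt R (\<lambda>i. x powi l i)"
    using cocharacter_exponents [OF \<mu>] by blast
  have pq: "(\<Sum>i\<in>{1..6}. k i * E6_cartan i j) = (\<Sum>i\<in>{1..6}. l i * E6_cartan i j)"
    if j: "j \<in> {1..6}" for j
  proof (rule powi_eq_imp_eq)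
    fix x :: 'a assume x: "x \<noteq> 0"
    show "x powi (\<Sum>i\<in>{1..6}. k i * E6_cartan i j) = x powi (\<Sum>i\<in>{1..6}. l i * E6_cartan i j)"
      using eq [OF j x] j x k l by (simp add: simple_root_tor_elt_powers)
  qed
  have "k i - l i = 0" if "i \<in> {1..6}" for i
    using pq that
    by (intro E6_cartan_nonsingular [of "\<lambda>i. k i - l i"])
      (simp_all add: left_diff_distrib sum_subtractf)
  then show ?thesis using x k l by simp (rule tor_elt_cong, simp)
qed

text \<open>
  Since \<open>\<beta>(\<nu>(x))\<close> is a power of \<open>x\<close>, an element acting on \<open>T\<close> by \<open>t \<mapsto> t \<nu>(\<alpha>\<^sub>i(t))\<^sup>-\<^sup>1\<close> multiplies
  \<open>\<beta>\<close> by a power of \<open>\<alpha>\<^sub>i\<close>.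
\<close>
lemma reflection_coeffs:
  assumes m: "m \<in> N" and i: "i \<in> {1..6}" and \<nu>: "\<nu> \<in> cocharacters T"
    and p: "\<And>j x. \<lbrakk>j \<in> {1..6}; x \<noteq> 0\<rbrakk> \<Longrightarrow> \<alpha> j (\<nu> x) = x powi p j" and two: "p i = 2"
    and refl: "\<And>t. t \<in> T \<Longrightarrow> conj_by m t = t ** minv (\<nu> (\<alpha> i t))"
    and \<beta>: "\<beta> \<in> \<Phi>" "has_coeffs \<beta> k"
  shows "has_coeffs (act_char m \<beta>) (k(i := k i - (\<Sum>j\<in>{1..6}. k j * p j)))"
  unfolding has_coeffs_def
proof
  fix t assume t: "t \<in> T"
  let ?d = "\<Sum>j\<in>{1..6}. k j * p j"
  have nz: "\<alpha> j t \<noteq> 0" if "j \<in> {1..6}" for j using that t by (simp add: simple_root_simps)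
  note \<nu>' = cocharacter [OF \<nu>]
  have "\<beta> (\<nu> x) = x powi ?d" if "x \<noteq> 0" for x
    using \<beta>(2) that \<nu>'(1)
    by (simp add: has_coeffs_def p powi_prod mult.commute flip: power_int_mult)
  then have "act_char m \<beta> t = \<beta> t * inverse (\<alpha> i t powi ?d)"
    using t \<beta>(1) \<nu>'(1) nz [OF i]
      reflection_involutive [OF m root_character [OF simple_root_root [OF i]] \<nu> _ refl t] p [OF i] two
    by (simp add: act_char_def root_simps)
  also have "\<dots> = (\<Prod>j\<in>{1..6}. \<alpha> j t powi k j) * (\<Prod>j\<in>{1..6}. if j = i then inverse (\<alpha> j t powi ?d) else 1)"
    using \<beta>(2) t i by (simp add: has_coeffs_def)
  also have "\<dots> = (\<Prod>j\<in>{1..6}. \<alpha> j t powi (k(i := k i - ?d)) j)"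
    unfolding prod.distrib [symmetric] using nz
    by (intro prod.cong) (auto simp: power_int_diff divide_inverse)
  finally show "act_char m \<beta> t = (\<Prod>j\<in>{1..6}. \<alpha> j t powi (k(i := k i - ?d)) j)" .
qed

lemma sigma_coeffs:
  assumes "i \<in> {1..6}" "\<beta> \<in> \<Phi>" "has_coeffs \<beta> k"
  shows "has_coeffs (act_char (sigma R i) \<beta>) (k(i := k i - (\<Sum>j\<in>{1..6}. k j * E6_cartan i j)))"
  using assms
  by (intro reflection_coeffs [of _ _ "\<alpha>v i"])
    (auto simp: sigma_in_N simple_root_root coroot_cocharacter sigma_conj pairing E6_cartan_def)

text \<open>
  A reflection in \<open>N\<close> along \<open>\<alpha>\<^sub>i\<close> uses the coroot \<open>\<alpha>\<^sub>i\<^sup>\<or>\<close>: if \<open>m\<close> is another one, then both products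
  of \<open>m\<close> and \<open>\<sigma>\<^sub>i\<close> add multiples of \<open>\<alpha>\<^sub>i\<close>, opposite to each other, to \<open>\<alpha>\<^sub>j\<close>.  Roots have no
  mixed signs, so these multiples vanish.
\<close>
lemma reflection_unique:
  assumes m: "m \<in> N" and i: "i \<in> {1..6}" and \<nu>: "\<nu> \<in> cocharacters T"
    and two: "\<And>x. x \<noteq> 0 \<Longrightarrow> \<alpha> i (\<nu> x) = x ^ 2"
    and refl: "\<And>t. t \<in> T \<Longrightarrow> conj_by m t = t ** minv (\<nu> (\<alpha> i t))" and x: "x \<noteq> 0"
  shows "\<nu> x = \<alpha>v i x"
proof -
  obtain p where p: "\<And>j x. \<lbrakk>j \<in> {1..6}; x \<noteq> 0\<rbrakk> \<Longrightarrow> \<alpha> j (\<nu> x) = x powi p j"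
    using cocharacter_pairing [OF \<nu>] by metis
  have p2: "p i = 2"
  proof (rule powi_eq_imp_eq)
    show "x powi p i = x powi 2" if "x \<noteq> 0" for x :: 'a
      using p [OF i that] two [OF that] by simp
  qed
  have "p j = E6_cartan i j" if j: "j \<in> {1..6}" for j
  proof (cases "j = i")
    case True
    then show ?thesis using p2 by (simp add: E6_cartan_def)
  next
    case False
    let ?\<delta> = "\<lambda>l. if l = j then 1 else 0 :: int"
    note \<delta> = has_coeffs_simple_root [OF j] and \<alpha>j = simple_root_root [OF j]
    have \<sigma>: "sigma R i \<in> N" using i by (simp add: sigma_in_N simple_root_root)
    have sum: "(\<Sum>l\<in>{1..6}. (?\<delta>(i := c)) l * q l) = q j + c * q i" for c and q :: "nat \<Rightarrow> int"
    proof -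
      have "(\<Sum>l\<in>{1..6}. (?\<delta>(i := c)) l * q l)
          = (\<Sum>l\<in>{1..6}. (if l = j then q l else 0) + (if l = i then c * q l else 0))"
        using False by (intro sum.cong) auto
      then show ?thesis using i j by (simp add: sum.distrib)
    qed
    have sum0: "(\<Sum>l\<in>{1..6}. ?\<delta> l * q l) = q j" for q :: "nat \<Rightarrow> int"
      using j by (simp add: if_distrib [of "\<lambda>a. a * _"] cong: if_cong)
    have cii: "E6_cartan i i = 2" by (simp add: E6_cartan_def)
    have A: "has_coeffs (act_char m (\<alpha> j)) (?\<delta>(i := - p j))"
      using reflection_coeffs [OF m i \<nu> p p2 refl \<alpha>j \<delta>] False by (simp add: sum0)
    have B: "has_coeffs (act_char (sigma R i) (\<alpha> j)) (?\<delta>(i := - E6_cartan i j))"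
      using sigma_coeffs [OF i \<alpha>j \<delta>] False by (simp add: sum0)
    have A': "has_coeffs (act_char (sigma R i) (act_char m (\<alpha> j))) (?\<delta>(i := p j - E6_cartan i j))"
      using sigma_coeffs [OF i act_char_root [OF m \<alpha>j] A, unfolded sum] by (simp add: cii)
    have B': "has_coeffs (act_char m (act_char (sigma R i) (\<alpha> j))) (?\<delta>(i := E6_cartan i j - p j))"
      using reflection_coeffs [OF m i \<nu> p p2 refl act_char_root [OF \<sigma> \<alpha>j] B, unfolded sum]
      by (simp add: p2)
    have "p j - E6_cartan i j \<ge> 0"
      using root_coeffs_sign [OF act_char_root [OF \<sigma> act_char_root [OF m \<alpha>j]] A'] i j False by force
    moreover have "E6_cartan i j - p j \<ge> 0"
      using root_coeffs_sign [OF act_char_root [OF m act_char_root [OF \<sigma> \<alpha>j]] B'] i j False by force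
    ultimately show ?thesis by simp
  qed
  then show ?thesis
    using x i by (intro cocharacter_eqI [OF \<nu>]) (auto simp: p pairing coroot_cocharacter simple_root_root)
qed

text \<open>
  The conjugate by \<open>n\<close> of the reflection in \<open>\<alpha>\<^sub>i\<close> is a reflection along \<open>\<alpha>\<^sub>j\<close>, so its coroot is
  \<open>\<alpha>\<^sub>j\<^sup>\<or>\<close> by uniqueness.
\<close>
lemma conj_by_coroot:
  assumes n: "n \<in> N" and i: "i \<in> {1..6}" and j: "j \<in> {1..6}" and act: "act_char n (\<alpha> i) = \<alpha> j"
    and x: "x \<noteq> 0"
  shows "conj_by n (\<alpha>v i x) = \<alpha>v j x"
proof (rule reflection_unique [of "conj_by n (sigma R i)" j "\<lambda>x. conj_by n (\<alpha>v i x)"])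
  have \<sigma>: "sigma R i \<in> N" using i by (simp add: sigma_in_N simple_root_root)
  show "conj_by n (sigma R i) \<in> N" using n \<sigma> by (simp add: conj_by_def)
  show "(\<lambda>x. conj_by n (\<alpha>v i x)) \<in> cocharacters T"
    using n i by (intro cocharacter_conj_by coroot_cocharacter simple_root_root)
  have \<alpha>j: "\<alpha> j (conj_by n t) = \<alpha> i t" if "t \<in> T" for t
    using act_char_conj [OF n that, of "\<alpha> i"] by (simp add: act)
  show "\<alpha> j (conj_by n (\<alpha>v i x)) = x ^ 2" if "x \<noteq> 0" for x
    using that i by (simp add: \<alpha>j simple_coroot_simps root_coroot simple_root_root)
  show "conj_by (conj_by n (sigma R i)) t = t ** minv (conj_by n (\<alpha>v i (\<alpha> j t)))" if "t \<in> T" for t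
    using conj_reflection [OF n simple_root_root [OF i] that] by (simp add: act)
qed (use j x in auto)

lemma conj_by_sigma:
  assumes n: "n \<in> N" and i: "i \<in> {1..6}" and j: "j \<in> {1..6}" and act: "act_char n (\<alpha> i) = \<alpha> j"
  shows "\<exists>c. c \<noteq> 0 \<and> conj_by n (sigma R i) = \<alpha>v j c ** sigma R j"
  using conj_sigma [OF n simple_root_root [OF i]] conj_by_coroot [OF n i j act] by (simp add: act)

lemma exists_neighbour: "i \<in> {1..6} \<Longrightarrow> \<exists>j\<in>{1..6}. E6_cartan i j = -1"
  unfolding nodes by (auto simp: E6_cartan_def E6_edge_simps)

text \<open>
  The root system is reduced: since \<open>\<langle>\<beta>, \<beta>\<^sup>\<or>\<rangle> = 2\<close>, the only other candidate is \<open>\<beta> = 2\<alpha>\<^sub>i\<close>, but then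
  \<open>2\<beta>\<^sup>\<or>\<close> would be the coroot of \<open>\<alpha>\<^sub>i\<close>, which pairs to \<open>-1\<close> with a neighbouring simple root.
\<close>
lemma multiple_of_simple_root:
  assumes \<beta>: "\<beta> \<in> \<Phi>" and i: "i \<in> {1..6}" and k: "has_coeffs \<beta> k" "k i > 0"
    and only_i: "\<And>j. \<lbrakk>j \<in> {1..6}; j \<noteq> i\<rbrakk> \<Longrightarrow> k j = 0"
  shows "\<beta> = \<alpha> i"
proof -
  have \<beta>t: "\<beta> t = \<alpha> i t powi k i" if "t \<in> T" for t
  proof -
    have "\<beta> t = (\<Prod>j\<in>{1..6}. \<alpha> j t powi k j)" using k(1) that by (simp add: has_coeffs_def)
    also have "\<dots> = (\<Prod>j\<in>{1..6}. if j = i then \<alpha> i t powi k i else 1)"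
      by (rule prod.cong) (simp_all add: only_i)
    finally have "\<beta> t = (\<Prod>j\<in>{1..6}. if j = i then \<alpha> i t powi k i else 1)" .
    then show ?thesis using i by simp
  qed
  let ?\<nu> = "coroot R \<beta>"
  obtain p where p: "\<And>j x. \<lbrakk>j \<in> {1..6}; x \<noteq> 0\<rbrakk> \<Longrightarrow> \<alpha> j (?\<nu> x) = x powi p j"
    using cocharacter_pairing [OF coroot_cocharacter [OF \<beta>]] by metis
  have pk: "p i * k i = 2"
  proof (rule powi_eq_imp_eq)
    fix x :: 'a assume x: "x \<noteq> 0"
    have "x powi (p i * k i) = \<beta> (?\<nu> x)"
      using x \<beta> i by (simp add: \<beta>t coroot_simps p power_int_mult)
    then show "x powi (p i * k i) = x powi 2" using x \<beta> by (simp add: root_coroot)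
  qed
  have "k i \<noteq> 2"
  proof
    assume k2: "k i = 2"
    then have p1: "p i = 1" using pk by simp
    have \<nu>2: "?\<nu> (x ^ 2) = \<alpha>v i x" if "x \<noteq> 0" for x
    proof (rule reflection_unique [of "sigma_root R \<beta>" i "\<lambda>x. ?\<nu> (x ^ 2)"])
      show "(\<lambda>x. ?\<nu> (x ^ 2)) \<in> cocharacters T"
        by (intro cocharacter_square coroot_cocharacter \<beta>)
      show "\<alpha> i (?\<nu> (x ^ 2)) = x ^ 2" if "x \<noteq> 0" for x using that i by (simp add: p p1)
      show "conj_by (sigma_root R \<beta>) t = t ** minv (?\<nu> ((\<alpha> i t) ^ 2))" if "t \<in> T" for t
        using that \<beta> by (simp add: sigma_conj \<beta>t k2)
    qed (use \<beta> i that in \<open>auto simp: sigma_in_N\<close>)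
    obtain j where j: "j \<in> {1..6}" "E6_cartan i j = -1" using exists_neighbour [OF i] by blast
    have "2 * p j = E6_cartan i j"
    proof (rule powi_eq_imp_eq)
      fix x :: 'a assume x: "x \<noteq> 0"
      have "x powi (2 * p j) = (x ^ 2) powi p j" by (simp add: power_int_mult)
      also have "\<dots> = \<alpha> j (?\<nu> (x ^ 2))" using p [OF j(1), of "x ^ 2"] x by simp
      also have "\<dots> = x powi E6_cartan i j" using x \<nu>2 pairing [OF i j(1) x] by simp
      finally show "x powi (2 * p j) = x powi E6_cartan i j" .
    qed
    then show False using j by presburger
  qed
  moreover have "k i dvd 2" using pk by (metis dvd_triv_right)
  then have "k i \<le> 2" by (rule zdvd_imp_le) simp
  ultimately have "k i = 1" using k(2) by simp
  then show ?thesis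
    using only_i i by (intro has_coeffs_eqI [OF k(1) has_coeffs_simple_root \<beta> simple_root_root]) auto
qed

text \<open>
  Only the \<open>i\<close>-th coefficient changes, so a change of sign leaves no other nonzero coefficient.
\<close>
lemma sigma_positive:
  assumes i: "i \<in> {1..6}" and \<beta>: "\<beta> \<in> \<Phi>" "positive \<beta>" "\<beta> \<noteq> \<alpha> i"
  shows "positive (act_char (sigma R i) \<beta>)"
proof (rule ccontr)
  assume neg: "\<not> positive (act_char (sigma R i) \<beta>)"
  obtain k where k: "has_coeffs \<beta> k" "\<forall>i\<in>{1..6}. k i \<ge> 0" using \<beta> by (auto simp: positive_def)
  let ?k = "k(i := k i - (\<Sum>j\<in>{1..6}. k j * E6_cartan i j))"
  have k': "has_coeffs (act_char (sigma R i) \<beta>) ?k" by (rule sigma_coeffs [OF i \<beta>(1) k(1)])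
  have "act_char (sigma R i) \<beta> \<in> \<Phi>"
    using i \<beta> by (intro act_char_root sigma_in_N simple_root_root)
  from root_coeffs_sign [OF this k'] neg positive_coeffs [OF k'] have "\<forall>j\<in>{1..6}. ?k j \<le> 0" by blast
  then have zero: "k j = 0" if "j \<in> {1..6}" "j \<noteq> i" for j using k(2) that by force
  then have "k i > 0" using root_coeffs_nonzero [OF \<beta>(1) k(1)] k(2) i by force
  then show False using multiple_of_simple_root [OF \<beta>(1) i k(1)] zero \<beta>(3) by blast
qed

definition adjacent :: "nat \<Rightarrow> nat \<Rightarrow> bool" where
  "adjacent i j \<longleftrightarrow> {i, j} \<in> E6_edges"

lemma adjacent_sym: "adjacent i j \<longleftrightarrow> adjacent j i"
  by (simp add: adjacent_def insert_commute)

lemma adjacent_imp_neq: "adjacent i j \<Longrightarrow> i \<noteq> j"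
  by (auto simp: adjacent_def E6_edge_simps)

lemma sigma_simple_root:
  assumes i: "i \<in> {1..6}" and j: "j \<in> {1..6}" and "i \<noteq> j"
  shows "has_coeffs (act_char (sigma R i) (\<alpha> j))
    (\<lambda>l. if l = j then 1 else if l = i \<and> adjacent i j then 1 else 0)"
proof -
  have "(\<Sum>l\<in>{1..6}. (if l = j then 1 else 0) * E6_cartan i l) = E6_cartan i j"
    using j by (simp add: if_distrib [of "\<lambda>a. a * _"] cong: if_cong)
  moreover have "(\<lambda>l. if l = j then 1 else 0)(i := - E6_cartan i j)
      = (\<lambda>l. if l = j then 1 else if l = i \<and> adjacent i j then 1 else 0)"
    using assms by (auto simp: fun_eq_iff E6_cartan_def adjacent_def)
  ultimately show ?thesis
    using sigma_coeffs [OF i simple_root_root [OF j] has_coeffs_simple_root [OF j]] assms by simp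
qed

lemma sigma_N [simp]: "i \<in> {1..6} \<Longrightarrow> sigma R i \<in> N"
  by (simp add: sigma_in_N simple_root_root)

lemma sigma_fixes_nonadjacent:
  assumes "i \<in> {1..6}" "j \<in> {1..6}" "i \<noteq> j" "\<not> adjacent i j"
  shows "act_char (sigma R i) (\<alpha> j) = \<alpha> j"
proof -
  have "act_char (sigma R i) (\<alpha> j) \<in> \<Phi>" using assms by (intro act_char_root simple_root_root sigma_N)
  then show ?thesis
    using assms
    by (intro has_coeffs_eqI [OF sigma_simple_root has_coeffs_simple_root]) (auto intro: simple_root_root)
qed

lemma sigma_sigma_adjacent:
  assumes i: "i \<in> {1..6}" and j: "j \<in> {1..6}" and adj: "adjacent i j"
  shows "act_char (sigma R i) (act_char (sigma R j) (\<alpha> i)) = \<alpha> j"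
proof -
  have ij: "i \<noteq> j" using adj adjacent_imp_neq by blast
  have roots: "act_char (sigma R j) (\<alpha> i) \<in> \<Phi>" using i j by (intro act_char_root simple_root_root) auto
  let ?k = "\<lambda>l. if l = i then 1 else if l = j \<and> adjacent j i then 1 else 0 :: int"
  have "(\<Sum>l\<in>{1..6}. ?k l * E6_cartan i l)
      = (\<Sum>l\<in>{1..6}. (if l = i then 2 else 0) + (if l = j then -1 else 0))"
    using adj ij adjacent_sym by (intro sum.cong) (auto simp: E6_cartan_def adjacent_def insert_commute)
  also have "\<dots> = 1" using i j by (simp add: sum.distrib)
  finally have sum: "(\<Sum>l\<in>{1..6}. ?k l * E6_cartan i l) = 1" .
  have "has_coeffs (act_char (sigma R i) (act_char (sigma R j) (\<alpha> i))) (?k(i := ?k i - 1))"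
    using sigma_coeffs [OF i roots sigma_simple_root [OF j i]] ij unfolding sum by simp
  from has_coeffs_eqI [OF this has_coeffs_simple_root [OF j] _ simple_root_root [OF j]] show ?thesis
    using ij adj i adjacent_sym by (simp add: act_char_root roots)
qed

lemma coroot_mult_eq_one:
  assumes "i \<in> {1..6}" "j \<in> {1..6}" "i \<noteq> j" "c \<noteq> 0" "d \<noteq> 0" "\<alpha>v i c ** \<alpha>v j d = mat 1"
  shows "c = 1"
proof -
  let ?x = "\<lambda>k. ((\<lambda>_. 1)(i := c)) k * ((\<lambda>_. 1)(j := d)) k"
  have u: "units ((\<lambda>_. 1)(i := c))" "units ((\<lambda>_. 1)(j := d))"
    using assms by (auto simp: units_def)
  have "tor_elt R ?x = mat 1"
    using assms(6) tor_elt_mult [OF u] coroot_eq_tor_elt [OF assms(1,4)]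
      coroot_eq_tor_elt [OF assms(2,5)] by metis
  from tor_elt_eq_one [OF units_intros(1) [OF u] this assms(1)] have "?x i = 1" .
  then show ?thesis using assms by simp
qed

text \<open>
  Both braid relations hold up to a factor in the image of \<open>\<alpha>\<^sub>j\<^sup>\<or>\<close>, by conjugation of Tits lifts.
  Exchanging \<open>i\<close> and \<open>j\<close> puts the inverse factor into the image of \<open>\<alpha>\<^sub>i\<^sup>\<or>\<close>.  The simple coroots
  are independent, so the factor is trivial.
\<close>
lemma sigma_commute:
  assumes i: "i \<in> {1..6}" and j: "j \<in> {1..6}" and ij: "i \<noteq> j" "\<not> adjacent i j"
  shows "sigma R i ** sigma R j = sigma R j ** sigma R i"
proof -
  have step: "\<exists>c. c \<noteq> 0 \<and> sigma R i ** sigma R j = \<alpha>v j c ** (sigma R j ** sigma R i)"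
    if "i \<in> {1..6}" "j \<in> {1..6}" "i \<noteq> j" "\<not> adjacent i j" for i j
    using conj_by_sigma [OF sigma_N [OF that(1)] that(2,2) sigma_fixes_nonadjacent [OF that]] that
    by (auto simp: conj_by_eq_iff mult_assoc)
  obtain c where c: "c \<noteq> 0" "sigma R i ** sigma R j = \<alpha>v j c ** (sigma R j ** sigma R i)"
    using step [OF i j ij] by blast
  obtain d where d: "d \<noteq> 0" "sigma R j ** sigma R i = \<alpha>v i d ** (sigma R i ** sigma R j)"
    using step [OF j i] ij adjacent_sym by blast
  have "(\<alpha>v j c ** \<alpha>v i d) ** (sigma R i ** sigma R j) = mat 1 ** (sigma R i ** sigma R j)"
    using c(2) d(2) by (simp add: mult_assoc)
  then have "\<alpha>v j c ** \<alpha>v i d = mat 1" using i j by (simp only: mult_cancel invertible_mult N_invertible sigma_N)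
  then have "c = 1" using coroot_mult_eq_one [OF j i] ij c d by auto
  then show ?thesis using c j by (simp add: simple_coroot_simps)
qed

lemma sigma_braid:
  assumes i: "i \<in> {1..6}" and j: "j \<in> {1..6}" and adj: "adjacent i j"
  shows "sigma R i ** (sigma R j ** sigma R i) = sigma R j ** (sigma R i ** sigma R j)"
proof -
  have step: "\<exists>c. c \<noteq> 0 \<and>
      sigma R i ** (sigma R j ** sigma R i) = \<alpha>v j c ** (sigma R j ** (sigma R i ** sigma R j))"
    if ij: "i \<in> {1..6}" "j \<in> {1..6}" "adjacent i j" for i j
  proof -
    have "act_char (sigma R i ** sigma R j) (\<alpha> i) = \<alpha> j"
      using sigma_sigma_adjacent [OF ij] ij by (simp add: act_char_comp)
    from conj_by_sigma [OF _ ij(1,2) this] ij show ?thesis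
      by (auto simp: conj_by_eq_iff mult_assoc invertible_mult)
  qed
  obtain c where c: "c \<noteq> 0"
    "sigma R i ** (sigma R j ** sigma R i) = \<alpha>v j c ** (sigma R j ** (sigma R i ** sigma R j))"
    using step [OF i j adj] by blast
  obtain d where d: "d \<noteq> 0"
    "sigma R j ** (sigma R i ** sigma R j) = \<alpha>v i d ** (sigma R i ** (sigma R j ** sigma R i))"
    using step [OF j i] adj adjacent_sym by blast
  let ?w = "sigma R i ** (sigma R j ** sigma R i)"
  have "(\<alpha>v j c ** \<alpha>v i d) ** ?w = mat 1 ** ?w" using c(2) d(2) by (simp add: mult_assoc)
  then have "\<alpha>v j c ** \<alpha>v i d = mat 1" using i j by (simp only: mult_cancel invertible_mult N_invertible sigma_N)
  then have "c = 1" using coroot_mult_eq_one [OF j i] adjacent_imp_neq [OF adj] c d by auto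
  then show ?thesis using c j by (simp add: simple_coroot_simps)
qed

text \<open>
  At \<open>x = -1\<close> the factorization of \<open>\<alpha>\<^sub>i\<^sup>\<or>(x) \<sigma>\<^sub>i\<close> is the inverse of the one of \<open>\<sigma>\<^sub>i\<close>.
\<close>
lemma sigma_square:
  assumes i: "i \<in> {1..6}"
  shows "sigma R i ** sigma R i = \<alpha>v i (-1)"
proof -
  note \<alpha>i = simple_root_root [OF i]
  note u = root_hom_simps [OF \<alpha>i] and v = root_hom_simps [OF neg_root [OF \<alpha>i]]
  have "\<alpha>v i (-1) ** sigma R i
      = root_hom R (\<alpha> i) (-1) ** root_hom R (neg (\<alpha> i)) 1 ** root_hom R (\<alpha> i) (-1)"
    using reflection_factorization [OF \<alpha>i, of "-1"] by simp
  then have "(\<alpha>v i (-1) ** sigma R i) ** sigma R i = mat 1"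
    by (simp add: sigma_root_def mult_assoc u(4,5) v(4,5))
  then have "\<alpha>v i (-1) ** (sigma R i ** sigma R i) = \<alpha>v i (-1) ** \<alpha>v i (-1)"
    using i simple_coroot_simps(2) [OF i, of "-1" "-1"] by (simp add: mult_assoc simple_coroot_simps)
  then show ?thesis using i mult_cancel(1) [of "\<alpha>v i (-1)"] simple_coroot_simps(1) [OF i, of "-1"] by simp
qed

end

section \<open>The Weyl group and its sections\<close>

context realized_group
begin

lemma T_normal: "T \<lhd> subgrp N"
proof -
  interpret GL: group "GLn :: ('a ^ 'n ^ 'n) monoid" by (rule group_GLn)
  have grpN: "group (subgrp N)" by (rule subgroup.subgroup_is_group [OF subgroup_N group_GLn])
  have "subgroup T (subgrp N)"
    by (rule GL.subgroup_incl [OF subgroup_T subgroup_N]) (auto intro: T_subset_N)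
  then show ?thesis
    unfolding group.normal_inv_iff [OF grpN]
    using GL.m_inv_consistent [OF subgroup_N] N_conj by (simp add: conj_by_def)
qed

lemma group_weyl: "group W"
  unfolding weyl_group_def by (rule normal.factorgroup_is_group [OF T_normal])

lemma proj_eq_image: "proj R n = (\<lambda>t. t ** n) ` T"
  by (auto simp: proj_def r_coset_def)

lemma proj_eq_subgrp: "proj R n = T #>\<^bsub>subgrp N\<^esub> n"
  by (simp add: proj_def r_coset_def)

lemma carrier_weyl: "carrier W = proj R ` N"
  by (auto simp: weyl_group_def FactGroup_def RCOSETS_def proj_eq_subgrp)

lemma proj_closed [simp]: "n \<in> N \<Longrightarrow> proj R n \<in> carrier W"
  by (simp add: carrier_weyl)

lemma proj_mult: "\<lbrakk>n \<in> N; m \<in> N\<rbrakk> \<Longrightarrow> proj R n \<otimes>\<^bsub>W\<^esub> proj R m = proj R (n ** m)"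
  using normal.rcos_sum [OF T_normal, of n m] by (simp add: weyl_group_def FactGroup_def proj_eq_subgrp)

lemma proj_T_mult: "t \<in> T \<Longrightarrow> proj R (t ** n) = proj R n"
proof -
  assume t: "t \<in> T"
  have "s ** n \<in> proj R (t ** n)" if "s \<in> T" for s
    unfolding proj_eq_image using t that
    by (intro image_eqI [of _ _ "s ** minv t"]) (simp_all add: mult_assoc)
  moreover have "s ** (t ** n) \<in> proj R n" if "s \<in> T" for s
    unfolding proj_eq_image using t that
    by (intro image_eqI [of _ _ "s ** t"]) (simp_all add: mult_assoc)
  ultimately show ?thesis unfolding proj_eq_image by blast
qed

lemma proj_eq_iff: "\<lbrakk>n \<in> N; m \<in> N\<rbrakk> \<Longrightarrow> proj R n = proj R m \<longleftrightarrow> (\<exists>t\<in>T. n = t ** m)"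
proof
  assume "proj R n = proj R m"
  moreover have "n \<in> proj R n" unfolding proj_eq_image by (intro image_eqI [of _ _ "mat 1"]) simp_all
  ultimately show "\<exists>t\<in>T. n = t ** m" by (auto simp: proj_eq_image)
qed (auto simp: proj_T_mult)

lemma proj_T: "t \<in> T \<Longrightarrow> proj R t = \<one>\<^bsub>W\<^esub>"
proof -
  assume "t \<in> T"
  then have "proj R t = proj R (mat 1)" using proj_T_mult [of t "mat 1"] by simp
  also have "\<dots> = T" by (simp add: proj_eq_image)
  finally show ?thesis by (simp add: weyl_group_def FactGroup_def)
qed

lemma act_char_T_mult: "\<lbrakk>t \<in> T; n \<in> N; \<beta> \<in> characters T\<rbrakk> \<Longrightarrow> act_char (t ** n) \<beta> = act_char n \<beta>"
  by (rule ext) (simp add: act_char_def minv_mult conj_by_comp [symmetric] conj_by_T)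

lemma act_char_proj_cong:
  "\<lbrakk>n \<in> N; m \<in> N; proj R n = proj R m; \<beta> \<in> characters T\<rbrakk> \<Longrightarrow> act_char n \<beta> = act_char m \<beta>"
  using act_char_T_mult by (auto simp: proj_eq_iff)

end

context E6_group
begin

abbreviation "s \<equiv> simple_reflection R"

definition lift_word :: "(nat \<Rightarrow> 'a ^ 'n ^ 'n) \<Rightarrow> nat list \<Rightarrow> 'a ^ 'n ^ 'n" where
  "lift_word g u = foldr (\<lambda>i n. g i ** n) u (mat 1)"

lemma lift_word_simps [simp]:
  "lift_word g [] = mat 1" "lift_word g (i # u) = g i ** lift_word g u"
  by (simp_all add: lift_word_def)

definition is_lift :: "(nat \<Rightarrow> 'a ^ 'n ^ 'n) \<Rightarrow> bool" where
  "is_lift g \<longleftrightarrow> (\<forall>i\<in>{1..6}. g i \<in> N \<and> proj R (g i) = s i)"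

lemma is_lift_sigma: "is_lift (sigma R)"
  by (simp add: is_lift_def simple_reflection_def)

lemma lift_word_N: "\<lbrakk>is_lift g; set u \<subseteq> {1..6}\<rbrakk> \<Longrightarrow> lift_word g u \<in> N"
  by (induction u) (auto simp: is_lift_def)

lemma proj_lift_word: "\<lbrakk>is_lift g; set u \<subseteq> {1..6}\<rbrakk> \<Longrightarrow> proj R (lift_word g u) = word_prod R u"
proof (induction u)
  case Nil
  then show ?case by (simp add: word_prod_def proj_T)
next
  case (Cons i u)
  have g: "g i \<in> N" "proj R (g i) = s i" and u: "lift_word g u \<in> N" "proj R (lift_word g u) = word_prod R u"
    using Cons lift_word_N by (auto simp: is_lift_def)
  have "proj R (lift_word g (i # u)) = s i \<otimes>\<^bsub>W\<^esub> word_prod R u"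
    using g u by (simp flip: proj_mult)
  then show ?case by (simp add: word_prod_def)
qed

lemma act_lift_word:
  assumes "set u \<subseteq> {1..6}" "\<beta> \<in> \<Phi>"
  shows "foldr (\<lambda>i. act_char (sigma R i)) u \<beta> = act_char (lift_word (sigma R) u) \<beta>"
  using assms
  by (induction u) (simp_all add: act_char_one root_character act_char_comp lift_word_N is_lift_sigma)

end

sublocale E6_group \<subseteq> weyl: reflection_system "weyl_group R" "{1..6}" "simple_reflection R" adjacent
  "roots (grp R) (tor R)" "simple_root R" "\<lambda>i. act_char (sigma R i)" "neg_char (tor R)" positive
proof (intro reflection_system.intro group_weyl reflection_system_axioms.intro)
  fix i :: nat assume i: "i \<in> {1..6}"
  note [simp] = simple_reflection_def proj_mult
  have square: "sigma R i ** sigma R i \<in> T"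
    using i by (simp add: sigma_square simple_coroot_simps)
  show "s i \<in> carrier W" using i by simp
  show "s i \<otimes>\<^bsub>W\<^esub> s i = \<one>\<^bsub>W\<^esub>" using i square by (simp add: proj_T)
  show "\<alpha> i \<in> \<Phi>" by (rule simple_root_root [OF i])
  show "positive (\<alpha> i)" by (rule positive_simple_root [OF i])
  show "act_char (sigma R i) (\<alpha> i) = neg (\<alpha> i)" by (rule neg_root_act [OF simple_root_root [OF i]])
  fix \<beta> assume \<beta>: "\<beta> \<in> \<Phi>"
  show "act_char (sigma R i) \<beta> \<in> \<Phi>" using i \<beta> by (simp add: act_char_root)
  show "act_char (sigma R i) (act_char (sigma R i) \<beta>) = \<beta>"
    using act_char_T_mult [OF square, of "mat 1" \<beta>] i \<beta>
    by (simp add: act_char_comp act_char_one root_character)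
  show "act_char (sigma R i) (neg \<beta>) = neg (act_char (sigma R i) \<beta>)" using i by (simp add: act_char_neg)
  show "positive (act_char (sigma R i) \<beta>)" if "positive \<beta>" "\<beta> \<noteq> \<alpha> i"
    by (rule sigma_positive [OF i \<beta> that])
next
  note [simp] = simple_reflection_def proj_mult
  fix i j :: nat assume ij: "i \<in> {1..6}" "j \<in> {1..6}"
  show "s i \<otimes>\<^bsub>W\<^esub> s j = s j \<otimes>\<^bsub>W\<^esub> s i" if "i \<noteq> j" "\<not> adjacent i j"
    using sigma_commute [OF ij that] ij by simp
  show "s i \<otimes>\<^bsub>W\<^esub> (s j \<otimes>\<^bsub>W\<^esub> s i) = s j \<otimes>\<^bsub>W\<^esub> (s i \<otimes>\<^bsub>W\<^esub> s j)"
    if "adjacent i j"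
    using sigma_braid [OF ij that] ij by simp
  show "s i \<otimes>\<^bsub>W\<^esub> s j \<noteq> s j \<otimes>\<^bsub>W\<^esub> s i" if adj: "adjacent i j"
  proof
    assume "s i \<otimes>\<^bsub>W\<^esub> s j = s j \<otimes>\<^bsub>W\<^esub> s i"
    then have "act_char (sigma R i ** sigma R j) (\<alpha> i) = act_char (sigma R j ** sigma R i) (\<alpha> i)"
      using ij by (intro act_char_proj_cong) (simp_all add: root_character simple_root_root)
    then have "\<alpha> j = act_char (sigma R j) (neg (\<alpha> i))"
      using ij sigma_sigma_adjacent [OF ij adj] neg_root_act [OF simple_root_root [OF ij(1)]]
      by (simp add: act_char_comp [symmetric])
    then have "\<alpha> j = neg (act_char (sigma R j) (\<alpha> i))" using ij by (simp add: act_char_neg)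
    moreover have "positive (act_char (sigma R j) (\<alpha> i))"
      using ij adjacent_imp_neq [OF adj] simple_root_inj
      by (intro sigma_positive simple_root_root positive_simple_root) (auto simp: inj_on_def)
    ultimately show False
      using positive_simple_root [OF ij(2)] positive_neg [of "act_char (sigma R j) (\<alpha> i)"] ij
      by (simp add: act_char_root simple_root_root)
  qed
  let ?word = "foldr (\<lambda>k. (\<otimes>\<^bsub>W\<^esub>) (s k))"
  fix u assume u: "set u \<subseteq> {1..6}" and act: "foldr (\<lambda>i. act_char (sigma R i)) u (\<alpha> i) = \<alpha> j"
  let ?n = "lift_word (sigma R) u"
  have n: "?n \<in> N" "proj R ?n = ?word u \<one>\<^bsub>W\<^esub>"
    using u lift_word_N [OF is_lift_sigma] proj_lift_word [OF is_lift_sigma]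
    by (auto simp: word_prod_def)
  have "act_char ?n (\<alpha> i) = \<alpha> j" using act u ij by (simp add: act_lift_word simple_root_root)
  then obtain c where "c \<noteq> 0" "conj_by ?n (sigma R i) = \<alpha>v j c ** sigma R j"
    using conj_by_sigma [OF n(1) ij] by blast
  then have "proj R (?n ** sigma R i) = proj R (sigma R j ** ?n)"
    using n ij proj_T_mult by (simp add: conj_by_eq_iff mult_assoc simple_coroot_simps)
  then show "?word u \<one>\<^bsub>W\<^esub> \<otimes>\<^bsub>W\<^esub> s i
      = s j \<otimes>\<^bsub>W\<^esub> ?word u \<one>\<^bsub>W\<^esub>"
    unfolding n(2) [symmetric] using n(1) ij by simp
next
  show "inj_on \<alpha> {1..6}" by (rule simple_root_inj)
  fix \<beta> assume \<beta>: "\<beta> \<in> \<Phi>"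
  show "positive (neg \<beta>) \<longleftrightarrow> \<not> positive \<beta>" by (rule positive_neg [OF \<beta>])
  let ?word = "foldr (\<lambda>k. (\<otimes>\<^bsub>W\<^esub>) (s k))"
  fix u v assume u: "set u \<subseteq> {1..6}" and v: "set v \<subseteq> {1..6}"
    and eq: "?word u \<one>\<^bsub>W\<^esub>
      = ?word v \<one>\<^bsub>W\<^esub>"
  have "proj R (lift_word (sigma R) u) = proj R (lift_word (sigma R) v)"
    using eq u v by (simp add: proj_lift_word is_lift_sigma word_prod_def)
  then show "foldr (\<lambda>i. act_char (sigma R i)) u \<beta> = foldr (\<lambda>i. act_char (sigma R i)) v \<beta>"
    using u v \<beta>
    by (simp add: act_lift_word) (intro act_char_proj_cong lift_word_N is_lift_sigma root_character)
qed

context E6_group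
begin

lemma word_prod_eq: "word_prod R u = weyl.word u"
  by (simp add: word_prod_def weyl.word_def)

lemma reduced_eq: "reduced R u \<longleftrightarrow> weyl.is_reduced u"
  by (simp add: reduced_def weyl.is_reduced_def word_prod_eq)

lemma exists_reduced_word: "w \<in> carrier W \<Longrightarrow> \<exists>u. reduced R u \<and> word_prod R u = w"
proof -
  assume "w \<in> carrier W"
  then have "w \<in> generate W (s ` {1..6})" by (simp add: generators)
  then have "\<exists>u. set u \<subseteq> {1..6} \<and> weyl.word u = w"
  proof induction
    case one
    show ?case by (rule exI [of _ "[]"]) simp
  next
    case (incl h)
    then obtain i where "i \<in> {1..6}" "h = s i" by blast
    then show ?case by (intro exI [of _ "[i]"]) (simp add: weyl.s_closed)
  next
    case (inv h)
    then obtain i where "i \<in> {1..6}" "h = s i" by blast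
    then show ?case by (intro exI [of _ "[i]"]) (simp add: weyl.s_closed weyl.s_inv)
  next
    case (eng h1 h2)
    then obtain u v where "set u \<subseteq> {1..6}" "weyl.word u = h1" "set v \<subseteq> {1..6}" "weyl.word v = h2"
      by blast
    then show ?case by (intro exI [of _ "u @ v"]) (simp add: weyl.word_append)
  qed
  then show ?thesis using weyl.exists_reduced_word by (auto simp: reduced_eq word_prod_eq)
qed

lemma reduced_subset: "reduced R u \<Longrightarrow> set u \<subseteq> {1..6}"
  by (simp add: reduced_def)

definition satisfies_braid_relations :: "(nat \<Rightarrow> 'a ^ 'n ^ 'n) \<Rightarrow> bool" where
  "satisfies_braid_relations g \<longleftrightarrow> (\<forall>i\<in>{1..6}. \<forall>j\<in>{1..6}.
     (i \<noteq> j \<and> \<not> adjacent i j \<longrightarrow> g i ** g j = g j ** g i) \<and>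
     (adjacent i j \<longrightarrow> g i ** (g j ** g i) = g j ** (g i ** g j)))"

lemma section_lift:
  assumes "\<S> \<in> sections R"
  shows "is_lift (\<lambda>i. \<S> (s i))"
  using assms weyl.s_closed by (auto simp: sections_def is_lift_def PiE_iff)

lemma section_word:
  "\<lbrakk>\<S> \<in> sections R; reduced R u\<rbrakk> \<Longrightarrow> \<S> (word_prod R u) = lift_word (\<lambda>i. \<S> (s i)) u"
  by (simp add: sections_def lift_word_def)

text \<open>
  Both sides of a braid relation between simple reflections are reduced words for the same element,
  and a section is multiplicative along both.
\<close>
lemma section_braid_relations:
  assumes S: "\<S> \<in> sections R"
  shows "satisfies_braid_relations (\<lambda>i. \<S> (s i))"
  unfolding satisfies_braid_relations_def
proof (intro ballI conjI impI)
  fix i j :: nat assume ij: "i \<in> {1..6}" "j \<in> {1..6}"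
  note [simp] = weyl.s_closed
  show "\<S> (s i) ** \<S> (s j) = \<S> (s j) ** \<S> (s i)" if "i \<noteq> j \<and> \<not> adjacent i j"
  proof -
    have "weyl.is_reduced [i, j]" "weyl.is_reduced [j, i]"
      using that ij weyl.is_reduced_pair by auto
    moreover have "weyl.word [i, j] = weyl.word [j, i]"
      using weyl.commuting [of i j] that ij by simp
    ultimately show ?thesis
      using section_word [OF S, of "[i, j]"] section_word [OF S, of "[j, i]"]
      by (simp add: reduced_eq word_prod_eq)
  qed
  show "\<S> (s i) ** (\<S> (s j) ** \<S> (s i)) = \<S> (s j) ** (\<S> (s i) ** \<S> (s j))" if adj: "adjacent i j"
  proof -
    have adj': "adjacent j i" using adj adjacent_sym by simp
    note adjacent_imp_neq [OF adj] adjacent_imp_neq [OF adj']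
    then have "weyl.is_reduced [j, i, j]" "weyl.is_reduced [i, j, i]"
      using ij sigma_sigma_adjacent [OF ij adj] sigma_sigma_adjacent [OF ij(2,1) adj']
      by (auto intro!: weyl.is_reduced_braid_word)
    moreover have "weyl.word [i, j, i] = weyl.word [j, i, j]"
      using weyl.braid [OF ij adj] ij by simp
    ultimately show ?thesis
      using section_word [OF S, of "[i, j, i]"] section_word [OF S, of "[j, i, j]"]
      by (simp add: reduced_eq word_prod_eq)
  qed
qed

lemma section_eqI:
  assumes "\<S> \<in> sections R" "\<S>' \<in> sections R" "\<And>i. i \<in> {1..6} \<Longrightarrow> \<S> (s i) = \<S>' (s i)"
  shows "\<S> = \<S>'"
proof
  fix w
  show "\<S> w = \<S>' w"
  proof (cases "w \<in> carrier W")
    case True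
    then obtain u where u: "reduced R u" "w = word_prod R u" using exists_reduced_word by blast
    have "lift_word (\<lambda>i. \<S> (s i)) u = lift_word (\<lambda>i. \<S>' (s i)) u"
      using reduced_subset [OF u(1)] assms(3) by (induction u) auto
    then show ?thesis using u assms by (simp add: section_word)
  next
    case False
    then show ?thesis using assms(1,2) by (auto simp: sections_def PiE_iff extensional_def)
  qed
qed

text \<open>
  The lift of \<open>w\<close> is the product of the given lifts along a chosen reduced word; by Matsumoto's
  theorem the choice does not matter.
\<close>
lemma exists_section:
  assumes g: "is_lift g" and braid: "satisfies_braid_relations g"
  shows "\<exists>\<S>\<in>sections R. \<forall>i\<in>{1..6}. \<S> (s i) = g i"
proof -
  define rw where "rw w = (SOME u. reduced R u \<and> word_prod R u = w)" for w
  have rw: "reduced R (rw w)" "word_prod R (rw w) = w" if "w \<in> carrier W" for w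
    using someI_ex [OF exists_reduced_word [OF that]] by (auto simp: rw_def)
  define \<S> where "\<S> = (\<lambda>w\<in>carrier W. lift_word g (rw w))"
  have S_word: "\<S> (word_prod R u) = lift_word g u" if u: "reduced R u" for u
  proof -
    have "word_prod R u \<in> carrier W"
      using reduced_subset [OF u] by (simp add: word_prod_eq weyl.word_closed)
    note rw = rw [OF this]
    have "foldr (\<lambda>i n. g i ** n) (rw (word_prod R u)) (mat 1) = foldr (\<lambda>i n. g i ** n) u (mat 1)"
    proof (rule weyl.matsumoto)
      show "g i ** (g j ** x) = g j ** (g i ** x)"
        if "i \<in> {1..6}" "j \<in> {1..6}" "i \<noteq> j" "\<not> adjacent i j" for i j x
      proof -
        have "g i ** g j = g j ** g i"
          using braid that unfolding satisfies_braid_relations_def by blast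
        then show ?thesis by (simp add: matrix_mul_assoc)
      qed
      show "g i ** (g j ** (g i ** x)) = g j ** (g i ** (g j ** x))"
        if "i \<in> {1..6}" "j \<in> {1..6}" "adjacent i j" for i j x
      proof -
        have "g i ** (g j ** g i) = g j ** (g i ** g j)"
          using braid that unfolding satisfies_braid_relations_def by blast
        then show ?thesis by (simp add: matrix_mul_assoc)
      qed
    qed (use rw u in \<open>simp_all add: reduced_eq word_prod_eq\<close>)
    then show ?thesis
      using \<open>word_prod R u \<in> carrier W\<close> by (simp add: \<S>_def lift_word_def)
  qed
  have S_simple: "\<S> (s i) = g i" if i: "i \<in> {1..6}" for i
  proof -
    have "reduced R [i]"
      using weyl.is_reduced_ConsI [OF weyl.is_reduced_Nil i] i positive_simple_root
      by (simp add: reduced_eq)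
    then show ?thesis using S_word [of "[i]"] i by (simp add: word_prod_eq weyl.s_closed)
  qed
  have "\<S> \<in> sections R"
    unfolding sections_def
  proof (intro CollectI conjI ballI allI impI)
    show "\<S> \<in> carrier W \<rightarrow>\<^sub>E N"
      using lift_word_N [OF g reduced_subset [OF rw(1)]] by (auto simp: \<S>_def)
    show "proj R (\<S> w) = w" if "w \<in> carrier W" for w
      using that g rw reduced_subset by (simp add: \<S>_def proj_lift_word)
    show "\<S> (word_prod R u) = foldr (\<lambda>i n. \<S> (s i) ** n) u (mat 1)" if u: "reduced R u" for u
    proof -
      have "foldr (\<lambda>i n. \<S> (s i) ** n) u (mat 1) = lift_word g u"
        using reduced_subset [OF u] by (induction u) (auto simp: S_simple)
      then show ?thesis using S_word [OF u] by simp
    qed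
  qed
  then show ?thesis using S_simple by blast
qed

lemma tits_section:
  shows "tits_section R \<in> sections R"
    and tits_section_simple: "i \<in> {1..6} \<Longrightarrow> tits_section R (s i) = sigma R i"
proof -
  have "satisfies_braid_relations (sigma R)"
    unfolding satisfies_braid_relations_def using sigma_commute sigma_braid by blast
  then obtain \<S> where S: "\<S> \<in> sections R" "\<forall>i\<in>{1..6}. \<S> (s i) = sigma R i"
    using exists_section [OF is_lift_sigma] by blast
  have "tits_section R = \<S>"
    unfolding tits_section_def
  proof (rule the_equality)
    show "\<S> \<in> sections R \<and> (\<forall>i\<in>{1..6}. \<S> (s i) = sigma R i)" using S by blast
    fix \<S>' assume S': "\<S>' \<in> sections R \<and> (\<forall>i\<in>{1..6}. \<S>' (s i) = sigma R i)"
    then show "\<S>' = \<S>" by (intro section_eqI) (simp_all add: S)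
  qed
  then show "tits_section R \<in> sections R" "i \<in> {1..6} \<Longrightarrow> tits_section R (s i) = sigma R i"
    using S by simp_all
qed

end

section \<open>Classification of the sections\<close>

context E6_group
begin

definition reflect :: "nat \<Rightarrow> (nat \<Rightarrow> 'a) \<Rightarrow> nat \<Rightarrow> 'a" where
  "reflect i x = x(i := x i / \<alpha> i (tor_elt R x))"

lemma units_reflect [intro]: "\<lbrakk>i \<in> {1..6}; units x\<rbrakk> \<Longrightarrow> units (reflect i x)"
  unfolding reflect_def by (intro units_intros) (simp_all add: unitsD simple_root_simps)

lemma sigma_tor_elt:
  assumes "i \<in> {1..6}" "units x"
  shows "sigma R i ** tor_elt R x = tor_elt R (reflect i x) ** sigma R i"
    "sigma R i ** (tor_elt R x ** A) = tor_elt R (reflect i x) ** (sigma R i ** A)"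
proof -
  show "sigma R i ** tor_elt R x = tor_elt R (reflect i x) ** sigma R i"
    using sigma_conj_tor_elt [OF assms] assms(1) by (simp add: reflect_def conj_by_eq_iff)
  then show "sigma R i ** (tor_elt R x ** A) = tor_elt R (reflect i x) ** (sigma R i ** A)"
    by (simp add: matrix_mul_assoc)
qed

text \<open>
  This is \<open>s\<^sub>j \<alpha>\<^sub>i = \<alpha>\<^sub>i + \<alpha>\<^sub>j\<close>.
\<close>
lemma root_adjacent_reflect:
  assumes i: "i \<in> {1..6}" and j: "j \<in> {1..6}" and adj: "adjacent i j" and x: "units x"
  shows "\<alpha> i (tor_elt R (reflect j x)) = \<alpha> i (tor_elt R x) * \<alpha> j (tor_elt R x)"
proof -
  let ?t = "tor_elt R x"
  have nz: "\<alpha> j ?t \<noteq> 0" using j x by (simp add: simple_root_simps)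
  have "E6_cartan j i = -1"
    using adj adjacent_imp_neq [OF adj] by (auto simp: E6_cartan_def adjacent_def insert_commute)
  then have "\<alpha> i (\<alpha>v j (\<alpha> j ?t)) = inverse (\<alpha> j ?t)"
    using pairing [OF j i nz] by (simp add: power_int_minus)
  moreover have "tor_elt R (reflect j x) = ?t ** minv (\<alpha>v j (\<alpha> j ?t))"
    using sigma_conj_tor_elt [OF j x] sigma_conj [OF simple_root_root [OF j], of ?t] x
    by (simp add: reflect_def)
  ultimately show ?thesis
    using i j x nz by (simp add: simple_root_simps simple_coroot_simps)
qed

text \<open>
  The reflection \<open>s\<^sub>j\<close> fixes the \<open>i\<close>-th coordinate, so the two products agree there only if \<open>s\<^sub>i\<close>
  fixes the \<open>i\<close>-th coordinate of \<open>y\<close>.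
\<close>
lemma lifts_commute_imp:
  assumes i: "i \<in> {1..6}" and j: "j \<in> {1..6}" and ij: "i \<noteq> j" "\<not> adjacent i j"
    and x: "units x" and y: "units y"
    and eq: "(tor_elt R x ** sigma R i) ** (tor_elt R y ** sigma R j)
      = (tor_elt R y ** sigma R j) ** (tor_elt R x ** sigma R i)"
  shows "\<alpha> i (tor_elt R y) = 1"
proof -
  note u = units_reflect [OF i y] units_reflect [OF j x]
  have "tor_elt R (\<lambda>k. x k * reflect i y k) ** (sigma R i ** sigma R j)
      = tor_elt R (\<lambda>k. y k * reflect j x k) ** (sigma R j ** sigma R i)"
    using eq i j x y u by (simp add: mult_assoc sigma_tor_elt) (simp add: matrix_mul_assoc tor_elt_mult)
  then have "tor_elt R (\<lambda>k. x k * reflect i y k) = tor_elt R (\<lambda>k. y k * reflect j x k)"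
    using i j by (simp add: sigma_commute [OF i j ij] mult_cancel invertible_mult)
  then have "x i * reflect i y i = y i * reflect j x i"
    using i u x y by (intro tor_elt_inj [of "\<lambda>k. x k * reflect i y k"]) auto
  then show ?thesis
    using ij unitsD [OF x i] unitsD [OF y i] simple_root_simps(2) [OF i, of "tor_elt R y"] y
    by (simp add: reflect_def field_simps)
qed

lemma lift_triple:
  assumes i: "i \<in> {1..6}" and j: "j \<in> {1..6}" and x: "units x" and y: "units y"
  shows "(tor_elt R x ** sigma R i) ** ((tor_elt R y ** sigma R j) ** (tor_elt R x ** sigma R i))
    = tor_elt R (\<lambda>k. x k * reflect i (\<lambda>k. y k * reflect j x k) k) ** (sigma R i ** (sigma R j ** sigma R i))"
proof -
  let ?yx = "\<lambda>k. y k * reflect j x k"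
  have u: "units (reflect j x)" "units ?yx" "units (reflect i ?yx)"
    using i j x y by (auto intro!: units_reflect units_intros)
  have "(tor_elt R x ** sigma R i) ** ((tor_elt R y ** sigma R j) ** (tor_elt R x ** sigma R i))
      = tor_elt R x ** (sigma R i ** (tor_elt R ?yx ** (sigma R j ** sigma R i)))"
    using j x y u by (simp add: mult_assoc sigma_tor_elt tor_elt_mult [symmetric])
  also have "\<dots> = tor_elt R (\<lambda>k. x k * reflect i ?yx k) ** (sigma R i ** (sigma R j ** sigma R i))"
    using i x u by (simp add: sigma_tor_elt(2) tor_elt_mult [symmetric] mult_assoc)
  finally show ?thesis .
qed

text \<open>
  Coordinates other than the \<open>i\<close>-th and \<open>j\<close>-th are fixed by both reflections and give \<open>x\<^sub>k = y\<^sub>k\<close>.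
  The second conclusion is the equation of the \<open>i\<close>-th coordinates.
\<close>
lemma lifts_braid_imp:
  assumes i: "i \<in> {1..6}" and j: "j \<in> {1..6}" and adj: "adjacent i j"
    and x: "units x" and y: "units y"
    and eq: "(tor_elt R x ** sigma R i) ** ((tor_elt R y ** sigma R j) ** (tor_elt R x ** sigma R i))
      = (tor_elt R y ** sigma R j) ** ((tor_elt R x ** sigma R i) ** (tor_elt R y ** sigma R j))"
  shows "\<lbrakk>k \<in> {1..6}; k \<noteq> i; k \<noteq> j\<rbrakk> \<Longrightarrow> x k = y k"
    and "x i = y i * (\<alpha> i (tor_elt R x) * \<alpha> j (tor_elt R x))"
proof -
  have ij: "i \<noteq> j" by (rule adjacent_imp_neq [OF adj])
  let ?yx = "\<lambda>k. y k * reflect j x k" and ?xy = "\<lambda>k. x k * reflect i y k"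
  have u: "units (reflect i y)" "units (reflect j x)" "units ?yx" "units ?xy"
    "units (reflect i ?yx)" "units (reflect j ?xy)"
    using i j x y by (auto intro!: units_reflect units_intros)
  have "tor_elt R (\<lambda>k. x k * reflect i ?yx k) ** (sigma R i ** (sigma R j ** sigma R i))
      = tor_elt R (\<lambda>k. y k * reflect j ?xy k) ** (sigma R j ** (sigma R i ** sigma R j))"
    using eq unfolding lift_triple [OF i j x y] lift_triple [OF j i y x] .
  then have "tor_elt R (\<lambda>k. x k * reflect i ?yx k) = tor_elt R (\<lambda>k. y k * reflect j ?xy k)"
    using i j by (simp add: sigma_braid [OF i j adj] mult_cancel invertible_mult)
  then have coord: "x k * reflect i ?yx k = y k * reflect j ?xy k" if "k \<in> {1..6}" for k
    using that u x y
    by (intro tor_elt_inj [of "\<lambda>k. x k * reflect i ?yx k" "\<lambda>k. y k * reflect j ?xy k"] units_intros)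
  show "x k = y k" if k: "k \<in> {1..6}" "k \<noteq> i" "k \<noteq> j"
  proof -
    have "x k * y k * x k = x k * y k * y k"
      using coord [OF k(1)] k by (simp add: reflect_def mult_ac)
    then show ?thesis using unitsD [OF x k(1)] unitsD [OF y k(1)] by simp
  qed
  have nz: "x i \<noteq> 0" "y i \<noteq> 0" "\<alpha> i (tor_elt R y) \<noteq> 0" "\<alpha> i (tor_elt R x) \<noteq> 0" "\<alpha> j (tor_elt R x) \<noteq> 0"
    using i j x y by (auto simp: unitsD simple_root_simps)
  have "\<alpha> i (tor_elt R ?yx) = \<alpha> i (tor_elt R y) * (\<alpha> i (tor_elt R x) * \<alpha> j (tor_elt R x))"
    using i y u by (simp add: tor_elt_mult [symmetric] simple_root_simps root_adjacent_reflect [OF i j adj x])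
  then have "x i * (y i * x i / (\<alpha> i (tor_elt R y) * (\<alpha> i (tor_elt R x) * \<alpha> j (tor_elt R x))))
      = y i * (x i * (y i / \<alpha> i (tor_elt R y)))"
    using coord [OF i] ij by (simp add: reflect_def)
  then show "x i = y i * (\<alpha> i (tor_elt R x) * \<alpha> j (tor_elt R x))"
    using nz by (simp add: field_simps)
qed

lemma E6_coords_simps [simp]:
  "E6_coords y 1 = y ^ 2" "E6_coords y 2 = 1" "E6_coords y 3 = y" "E6_coords y 4 = 1"
  "E6_coords y 5 = y ^ 2" "E6_coords y 6 = y"
  by (simp_all add: E6_coords_def numeral_eq_Suc One_nat_def)

lemma E6_coords_cube: "\<lbrakk>i \<in> {1..6}; y ^ 3 = 1\<rbrakk> \<Longrightarrow> E6_coords y i ^ 3 = 1"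
proof -
  assume i: "i \<in> {1..6}" and y: "y ^ 3 = 1"
  have "(y ^ 2) ^ 3 = (y ^ 3) ^ 2" by (simp flip: power_mult)
  then show ?thesis using i y unfolding nodes by auto
qed

lemma units_E6_coords: "\<lbrakk>y ^ 3 = 1; z \<noteq> 0\<rbrakk> \<Longrightarrow> units ((E6_coords y)(i := z))" "y ^ 3 = 1 \<Longrightarrow> units (E6_coords y)"
proof -
  have "units (E6_coords y)" if y: "y ^ 3 = 1" for y :: 'a
    unfolding units_def
  proof
    fix i :: nat assume "i \<in> {1..6}"
    from E6_coords_cube [OF this y] show "E6_coords y i \<noteq> 0" by auto
  qed
  then show "\<lbrakk>y ^ 3 = 1; z \<noteq> 0\<rbrakk> \<Longrightarrow> units ((E6_coords y)(i := z))" "y ^ 3 = 1 \<Longrightarrow> units (E6_coords y)"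
    by (auto intro: units_intros)
qed

text \<open>
  The product of the coordinates of \<open>(y\<^sup>2, 1, y, 1, y\<^sup>2, y)\<close> at the neighbours of \<open>i\<close> is the square
  of its \<open>i\<close>-th coordinate.  For \<open>z\<close> equal to that coordinate this says that the element is central.
\<close>
lemma simple_root_E6_coords:
  assumes i: "i \<in> {1..6}" and y: "y ^ 3 = 1" and z: "z \<noteq> 0"
  shows "\<alpha> i (tor_elt R ((E6_coords y)(i := z))) = z ^ 2 / E6_coords y i ^ 2"
proof -
  have y4: "(y ^ 2) ^ 2 = y"
  proof -
    have "(y ^ 2) ^ 2 = y ^ 3 * y" by (simp add: power2_eq_square power3_eq_cube mult_ac)
    then show ?thesis using y by simp
  qed
  have y3: "y * y ^ 2 = 1" using y by (simp add: power2_eq_square power3_eq_cube mult_ac)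
  note u = units_E6_coords(1) [OF y z]
  show ?thesis
    using i y4 y3 unfolding nodes
    by (auto simp: simple_root_tor_elt [OF u] mult_ac)
qed

lemma central_element:
  assumes i: "i \<in> {1..6}" and y: "y ^ 3 = 1"
  shows "sigma R i ** tor_elt R (E6_coords y) = tor_elt R (E6_coords y) ** sigma R i"
proof -
  note u = units_E6_coords(2) [OF y]
  have nz: "E6_coords y i \<noteq> 0" using u i by (rule unitsD)
  have "\<alpha> i (tor_elt R (E6_coords y)) = 1"
    using simple_root_E6_coords [OF i y nz] nz by simp
  then show ?thesis using sigma_tor_elt(1) [OF i u] by (simp add: reflect_def)
qed

lemma exists_section_with_y:
  assumes y: "y ^ 3 = 1"
  shows "\<exists>\<S>\<in>sections R. has_y_value R \<S> y"
proof -
  let ?c = "tor_elt R (E6_coords y)"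
  let ?g = "\<lambda>i. ?c ** sigma R i"
  note u = units_E6_coords(2) [OF y]
  have c: "?c \<in> T" using u by simp
  have swap: "sigma R i ** (?c ** A) = ?c ** (sigma R i ** A)" if "i \<in> {1..6}" for i A
    using central_element [OF that y] by (metis matrix_mul_assoc)
  have "is_lift ?g"
    using c by (auto simp: is_lift_def simple_reflection_def proj_T_mult T_subset_N)
  moreover have "satisfies_braid_relations ?g"
    unfolding satisfies_braid_relations_def
  proof (intro ballI conjI impI)
    fix i j :: nat assume ij: "i \<in> {1..6}" "j \<in> {1..6}"
    show "?g i ** ?g j = ?g j ** ?g i" if "i \<noteq> j \<and> \<not> adjacent i j"
      using sigma_commute [OF ij] that by (simp add: mult_assoc swap [OF ij(1)] swap [OF ij(2)])
    show "?g i ** (?g j ** ?g i) = ?g j ** (?g i ** ?g j)" if "adjacent i j"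
      using sigma_braid [OF ij that] by (simp add: mult_assoc swap [OF ij(1)] swap [OF ij(2)])
  qed
  ultimately obtain \<S> where S: "\<S> \<in> sections R" "\<forall>i\<in>{1..6}. \<S> (s i) = ?g i"
    using exists_section by blast
  have "has_y_value R \<S> y"
    unfolding has_y_value_def
  proof (intro conjI ballI y)
    fix i :: nat assume i: "i \<in> {1..6}"
    show "\<exists>z. z \<noteq> 0 \<and> \<S> (s i) = tor_elt R ((E6_coords y)(i := z)) ** sigma R i"
      using S(2) i unitsD [OF u i] by (intro exI [of _ "E6_coords y i"]) simp
  qed
  then show ?thesis using S(1) by blast
qed

end

text \<open>
  The \<open>k\<close>-th coordinate of \<open>t\<^sub>i\<close> is constant while \<open>i\<close> runs through a connected component of the
  diagram without the node \<open>k\<close>.  Thus \<open>a\<^sub>1, a\<^sub>2, a\<^sub>6\<close> stand for the coordinates at the end nodes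
  \<open>1, 2, 6\<close>, the variables \<open>b, c\<close> for those at the node \<open>3\<close> on the components \<open>{1}\<close> and
  \<open>{2, 4, 5, 6}\<close>, \<open>d, e\<close> for those at the node \<open>5\<close> on \<open>{6}\<close> and \<open>{1, 2, 3, 4}\<close>, and \<open>f, g, h\<close>
  for those at the node \<open>4\<close> on \<open>{2}\<close>, \<open>{1, 3}\<close> and \<open>{5, 6}\<close>.
\<close>
lemma E6_equations:
  fixes a1 a2 a6 b c d e f g h :: "'a::field"
  assumes nz: "a1 \<noteq> 0" "a2 \<noteq> 0" "a6 \<noteq> 0" "f \<noteq> 0"
    and eqs: "a2 ^ 2 = g" "e ^ 2 = g * a6" "a6 ^ 2 = e" "a1 ^ 2 = c" "c ^ 2 = a1 * f"
      "e ^ 2 = f * a6" "c ^ 2 = a1 * h" "b * a1 = g" "h = a6 * d" "c * e = a2 * f"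
      "a1 * a2 * e = c * g"
  shows "a6 ^ 3 = 1 \<and> a1 = a6 ^ 2 \<and> a2 = 1 \<and> b = a6 \<and> c = a6 \<and> d = a6 ^ 2 \<and> e = a6 ^ 2 \<and>
    f = 1 \<and> g = 1 \<and> h = 1"
proof -
  have e: "e = a6 ^ 2" and c: "c = a1 ^ 2" using eqs by auto
  have "a6 * a6 ^ 3 = a6 * f" using eqs(6) by (simp add: e power2_eq_square power3_eq_cube mult_ac)
  then have f6: "a6 ^ 3 = f" using nz by simp
  have "g * a6 = f * a6" using eqs(2,6) by metis
  then have g: "g = f" using nz by simp
  have "a1 * a1 ^ 3 = a1 * f" using eqs(5) by (simp add: c power2_eq_square power3_eq_cube mult_ac)
  then have f1: "a1 ^ 3 = f" using nz by simp
  have "a1 * h = a1 * f" using eqs(5,7) by simp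
  then have h: "h = f" using nz by simp
  have "(a1 * a6 ^ 2) * a2 = (a1 * a6 ^ 2) * (a1 * a6)"
    using eqs(11) by (simp add: e c g f6 [symmetric] power2_eq_square power3_eq_cube mult_ac)
  then have a2: "a2 = a1 * a6" using nz by simp
  have "a2 * a2 = a2 * f"
    using eqs(10) by (simp add: a2 c e power2_eq_square mult_ac)
  then have "a2 = f" using nz by simp
  moreover have "a2 * a2 = f" using eqs(1) g by (simp add: power2_eq_square)
  ultimately have f: "f = 1" "a2 = 1" using nz by auto
  have "a1 * a6 = a6 ^ 2 * a6" using f f6 a2 by (simp add: power2_eq_square power3_eq_cube)
  then have a1: "a1 = a6 ^ 2" using nz by simp
  have c6: "c = a6"
  proof -
    have "c = a6 ^ 3 * a6" by (simp add: c a1 power2_eq_square power3_eq_cube mult_ac)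
    then show ?thesis using f6 f by simp
  qed
  have "b * a1 = a6 * a1" using eqs(8) g f a2 by (simp add: mult.commute)
  then have b: "b = a6" using nz by simp
  have "a6 * d = a6 * a6 ^ 2" using eqs(9) h f f6 by (simp add: power2_eq_square power3_eq_cube mult_ac)
  then have "d = a6 ^ 2" using nz by simp
  then show ?thesis using f6 f a1 b c6 e g h by simp
qed

context E6_group
begin

lemma section_has_y_value:
  assumes S: "\<S> \<in> sections R"
  shows "\<exists>y. has_y_value R \<S> y"
proof -
  have "\<exists>x. units x \<and> \<S> (s i) = tor_elt R x ** sigma R i" if i: "i \<in> {1..6}" for i
  proof -
    have "\<S> (s i) \<in> N" "proj R (\<S> (s i)) = proj R (sigma R i)"
      using section_lift [OF S] i by (auto simp: is_lift_def simple_reflection_def)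
    then obtain t where "t \<in> T" "\<S> (s i) = t ** sigma R i" using proj_eq_iff i by auto
    then show ?thesis using tor_elt_surj by blast
  qed
  then obtain X where X: "\<And>i. i \<in> {1..6} \<Longrightarrow> units (X i)"
    "\<And>i. i \<in> {1..6} \<Longrightarrow> \<S> (s i) = tor_elt R (X i) ** sigma R i" by metis
  note braid = section_braid_relations [OF S, unfolded satisfies_braid_relations_def]
  have comm: "\<alpha> i (tor_elt R (X j)) = 1"
    if "i \<in> {1..6}" "j \<in> {1..6}" "i \<noteq> j" "\<not> adjacent i j" for i j
    using braid that X by (intro lifts_commute_imp [OF that X(1) [OF that(1)] X(1) [OF that(2)]]) metis
  have eq: "(tor_elt R (X i) ** sigma R i) ** ((tor_elt R (X j) ** sigma R j) ** (tor_elt R (X i) ** sigma R i))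
      = (tor_elt R (X j) ** sigma R j) ** ((tor_elt R (X i) ** sigma R i) ** (tor_elt R (X j) ** sigma R j))"
    if "i \<in> {1..6}" "j \<in> {1..6}" "adjacent i j" for i j
    using braid that X by metis
  have same: "X i k = X j k"
    if "i \<in> {1..6}" "j \<in> {1..6}" "adjacent i j" "k \<in> {1..6}" "k \<noteq> i" "k \<noteq> j" for i j k
    using lifts_braid_imp(1) [OF that(1-3) X(1) [OF that(1)] X(1) [OF that(2)] eq [OF that(1-3)] that(4-6)] .
  have adj: "X i i = X j i * (\<alpha> i (tor_elt R (X i)) * \<alpha> j (tor_elt R (X i)))"
    if "i \<in> {1..6}" "j \<in> {1..6}" "adjacent i j" for i j
    using lifts_braid_imp(2) [OF that X(1) [OF that(1)] X(1) [OF that(2)] eq [OF that]] .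
  have edge: "adjacent 1 3" "adjacent 3 4" "adjacent 4 5" "adjacent 5 6" "adjacent 2 4" "adjacent 6 5"
    by (simp_all add: adjacent_def E6_edge_simps)
  have non_edge: "\<not> adjacent 2 1" "\<not> adjacent 5 1" "\<not> adjacent 6 1" "\<not> adjacent 1 2" "\<not> adjacent 3 2"
    "\<not> adjacent 5 2" "\<not> adjacent 3 6"
    by (simp_all add: adjacent_def E6_edge_simps)
  have nz: "X i k \<noteq> 0" if "i \<in> {1..6}" "k \<in> {1..6}" for i k using X(1) that unitsD by blast
  have x1: "X 3 1 = X 6 1" "X 4 1 = X 6 1" "X 5 1 = X 6 1" "X 2 1 = X 6 1"
    using same [of 3 4 1] same [of 4 5 1] same [of 5 6 1] same [of 2 4 1] edge by simp_all
  have x2: "X 3 2 = X 1 2" "X 4 2 = X 1 2" "X 5 2 = X 1 2" "X 6 2 = X 1 2"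
    using same [of 1 3 2] same [of 3 4 2] same [of 4 5 2] same [of 5 6 2] edge by simp_all
  have x6: "X 3 6 = X 1 6" "X 4 6 = X 1 6" "X 5 6 = X 1 6" "X 2 6 = X 1 6"
    using same [of 1 3 6] same [of 3 4 6] same [of 4 5 6] same [of 2 4 6] edge by simp_all
  have x3: "X 4 3 = X 2 3" "X 5 3 = X 2 3" "X 6 3 = X 2 3"
    using same [of 2 4 3] same [of 4 5 3] same [of 5 6 3] edge by simp_all
  have x5: "X 3 5 = X 1 5" "X 4 5 = X 1 5" "X 2 5 = X 1 5"
    using same [of 1 3 5] same [of 3 4 5] same [of 2 4 5] edge by simp_all
  have x4: "X 3 4 = X 1 4" "X 6 4 = X 5 4"
    using same [of 1 3 4] same [of 5 6 4] edge by simp_all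
  define y where "y = X 1 6"
  have "y ^ 3 = 1 \<and> X 6 1 = y ^ 2 \<and> X 1 2 = 1 \<and> X 1 3 = y \<and> X 2 3 = y \<and> X 6 5 = y ^ 2 \<and> X 1 5 = y ^ 2 \<and>
    X 2 4 = 1 \<and> X 1 4 = 1 \<and> X 5 4 = 1"
    unfolding y_def
  proof (rule E6_equations)
    show "X 6 1 \<noteq> 0" "X 1 2 \<noteq> 0" "X 1 6 \<noteq> 0" "X 2 4 \<noteq> 0" by (simp_all add: nz)
    note roots = simple_root_tor_elt [OF X(1)]
    show "X 1 2 ^ 2 = X 1 4" using comm [of 2 1] non_edge by (simp add: roots nz)
    show "X 1 5 ^ 2 = X 1 4 * X 1 6" using comm [of 5 1] non_edge by (simp add: roots nz)
    show "X 1 6 ^ 2 = X 1 5" using comm [of 6 1] non_edge by (simp add: roots nz)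
    show "X 6 1 ^ 2 = X 2 3" using comm [of 1 2] non_edge by (simp add: roots nz x1)
    show "X 2 3 ^ 2 = X 6 1 * X 2 4" using comm [of 3 2] non_edge by (simp add: roots nz x1)
    show "X 1 5 ^ 2 = X 2 4 * X 1 6" using comm [of 5 2] non_edge by (simp add: roots nz x5 x6)
    show "X 2 3 ^ 2 = X 6 1 * X 5 4" using comm [of 3 6] non_edge by (simp add: roots nz x3 x4)
    show "X 1 3 * X 6 1 = X 1 4"
      using adj [of 1 3] edge by (simp add: roots nz x1 field_simps power2_eq_square)
    show "X 5 4 = X 1 6 * X 6 5"
      using adj [of 6 5] edge by (simp add: roots nz x4 x6 field_simps power2_eq_square)
    show "X 2 3 * X 1 5 = X 1 2 * X 2 4"
      using adj [of 2 4] edge by (simp add: roots nz x2 x5 field_simps power2_eq_square)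
    show "X 6 1 * X 1 2 * X 1 5 = X 2 3 * X 1 4"
      using adj [of 3 4] edge by (simp add: roots nz x1 x2 x3 x4 x5 field_simps power2_eq_square)
  qed
  note sol = this [THEN conjunct1] this [THEN conjunct2]
  have coords: "X i k = E6_coords y k" if "i \<in> {1..6}" "k \<in> {1..6}" "k \<noteq> i" for i k
    using that sol(2) y_def [symmetric] unfolding nodes
    by (auto simp: x1 x2 x3 x4 x5 x6)
  have "has_y_value R \<S> y"
    unfolding has_y_value_def
  proof (intro conjI ballI sol(1))
    fix i :: nat assume i: "i \<in> {1..6}"
    have "tor_elt R (X i) = tor_elt R ((E6_coords y)(i := X i i))"
      using coords [OF i] by (intro tor_elt_cong) simp
    then show "\<exists>z. z \<noteq> 0 \<and> \<S> (s i) = tor_elt R ((E6_coords y)(i := z)) ** sigma R i"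
      using X(2) [OF i] nz [OF i i] by (intro exI [of _ "X i i"]) simp
  qed
  then show ?thesis by blast
qed

lemma has_y_valueE:
  assumes "has_y_value R \<S> y" "i \<in> {1..6}"
  obtains z where "y ^ 3 = 1" "z \<noteq> 0" "\<S> (s i) = tor_elt R ((E6_coords y)(i := z)) ** sigma R i"
  using assms unfolding has_y_value_def by blast

lemma y_value_unique:
  assumes y: "has_y_value R \<S> y" and y': "has_y_value R \<S> y'"
  shows "y = y'"
proof -
  have 1: "(1::nat) \<in> {1..6}" "(3::nat) \<in> {1..6}" by simp_all
  obtain z where z: "y ^ 3 = 1" "z \<noteq> 0" "\<S> (s 1) = tor_elt R ((E6_coords y)(1 := z)) ** sigma R 1"
    using has_y_valueE [OF y 1(1)] .
  obtain z' where z': "y' ^ 3 = 1" "z' \<noteq> 0" "\<S> (s 1) = tor_elt R ((E6_coords y')(1 := z')) ** sigma R 1"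
    using has_y_valueE [OF y' 1(1)] .
  have "tor_elt R ((E6_coords y)(1 := z)) = tor_elt R ((E6_coords y')(1 := z'))"
    using z(3) z'(3) sigma_N [OF 1(1)] mult_cancel(2) N_invertible by metis
  from tor_elt_inj [OF units_E6_coords(1) [OF z(1,2)] units_E6_coords(1) [OF z'(1,2)] this 1(2)]
  have "((E6_coords y)(1 := z)) 3 = ((E6_coords y')(1 := z')) 3" .
  then show ?thesis by simp
qed

lemma tits_y_value: "has_y_value R (tits_section R) 1"
  unfolding has_y_value_def
proof (intro conjI ballI)
  fix i :: nat assume i: "i \<in> {1..6}"
  have "tor_elt R ((E6_coords 1)(i := 1)) = tor_elt R (\<lambda>_. 1)"
    by (rule tor_elt_cong) (auto simp: nodes)
  then show "\<exists>z. z \<noteq> 0 \<and> tits_section R (s i) = tor_elt R ((E6_coords 1)(i := z)) ** sigma R i"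
    using i by (intro exI [of _ 1]) (simp add: tits_section_simple)
qed simp

end

section \<open>Orders of the lifts and conjugacy of sections\<close>

text \<open>Three times the inverse of the Cartan matrix, whose determinant is \<open>3\<close>.\<close>
definition E6_adjugate :: "nat \<Rightarrow> nat \<Rightarrow> int" where
  "E6_adjugate k i = [[4, 3, 5, 6, 4, 2], [3, 6, 6, 9, 6, 3], [5, 6, 10, 12, 8, 4],
    [6, 9, 12, 18, 12, 6], [4, 6, 8, 12, 10, 5], [2, 3, 4, 6, 5, 4]] ! (k - 1) ! (i - 1)"

lemma E6_adjugate_cartan:
  "\<lbrakk>k \<in> {1..6}; j \<in> {1..6}\<rbrakk> \<Longrightarrow>
    (\<Sum>i\<in>{1..6}. E6_adjugate k i * E6_cartan i j) = (if k = j then 3 else 0)"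
  unfolding sum_nodes E6_cartan_def E6_edge_simps unfolding nodes
  by (elim insertE emptyE) (simp_all add: E6_adjugate_def numeral_eq_Suc One_nat_def)

lemma minus_one_power_eq_one_iff:
  "(-1 :: 'a::field) ^ m = 1 \<longleftrightarrow> (if CHAR('a) = 2 then 1 else 2) dvd m"
proof -
  have "(-1 :: 'a) = 1 \<longleftrightarrow> CHAR('a) = 2"
  proof -
    have "(-1 :: 'a) = 1 \<longleftrightarrow> of_nat 2 = (0 :: 'a)"
      by (simp add: eq_neg_iff_add_eq_0 [symmetric]) (metis one_add_one add.inverse_inverse eq_neg_iff_add_eq_0)
    also have "\<dots> \<longleftrightarrow> CHAR('a) dvd 2" by (rule of_nat_eq_0_iff_char_dvd)
    also have "\<dots> \<longleftrightarrow> CHAR('a) = 2"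
      using two_is_prime_nat CHAR_not_1 [where 'a = 'a]
      unfolding prime_nat_iff One_nat_def by (metis dvd_refl)
    finally show ?thesis .
  qed
  then show ?thesis by (cases "even m") auto
qed

lemma cube_root_of_unity_power:
  fixes y :: "'a::field"
  assumes "y ^ 3 = 1" "y \<noteq> 1"
  shows "y ^ m = 1 \<longleftrightarrow> 3 dvd m"
proof -
  have "y ^ m = (y ^ 3) ^ (m div 3) * y ^ (m mod 3)"
    by (simp flip: power_mult power_add)
  then have red: "y ^ m = y ^ (m mod 3)" using assms by simp
  have "y ^ 2 \<noteq> 1" using assms by (metis mult_1 power2_eq_square power3_eq_cube)
  moreover have "m mod 3 = 0 \<or> m mod 3 = 1 \<or> m mod 3 = 2" by arith
  ultimately show ?thesis using assms red by (auto simp: dvd_eq_mod_eq_0)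
qed

lemma exists_cube_root_of_unity:
  assumes "CHAR('a::alg_closed_field) \<noteq> 3"
  shows "\<exists>y::'a. y ^ 3 = 1 \<and> y \<noteq> 1"
proof -
  have "degree [:1, 1, 1 :: 'a:] > 0" by simp
  then obtain y :: 'a where y: "poly [:1, 1, 1:] y = 0" using alg_closed_imp_poly_has_root by blast
  have "y ^ 3 - 1 = (y - 1) * poly [:1, 1, 1:] y" by (simp add: algebra_simps power3_eq_cube)
  then have "y ^ 3 = 1" using y by simp
  moreover have "y \<noteq> 1"
  proof
    assume "y = 1"
    then have "of_nat 3 = (0 :: 'a)" using y by simp
    then have "CHAR('a) dvd 3" by (simp only: of_nat_eq_0_iff_char_dvd)
    moreover have "prime (3 :: nat)" by simp
    ultimately show False using assms CHAR_not_1 [where 'a = 'a]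
      unfolding prime_nat_iff One_nat_def by metis
  qed
  ultimately show ?thesis by blast
qed

context E6_group
begin

text \<open>
  Let \<open>d\<^sub>k\<close> be a cube root of \<open>c\<^sub>k\<close>, and let the \<open>i\<close>-th coordinate be the product of the powers of
  the \<open>d\<^sub>k\<close> with the adjugate exponents.  As these are three times the inverse of the Cartan matrix,
  \<open>\<alpha>\<^sub>j\<close> takes the value \<open>d\<^sub>j\<^sup>3\<close>.
\<close>
lemma exists_tor_elt_roots:
  assumes c: "\<And>j. j \<in> {1..6} \<Longrightarrow> c j \<noteq> 0"
  shows "\<exists>t\<in>T. \<forall>j\<in>{1..6}. \<alpha> j t = c j"
proof -
  have "\<forall>k. \<exists>d. d ^ 3 = c k" by (intro allI nth_root_exists) simp
  then obtain d where d: "\<And>k. d k ^ 3 = c k" by metis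
  have nz: "d k \<noteq> 0" if "k \<in> {1..6}" for k using d [of k] c [OF that] by auto
  define x where "x i = (\<Prod>k\<in>{1..6}. d k powi E6_adjugate k i)" for i
  have x: "units x" using nz by (simp add: units_def x_def)
  have "\<alpha> j (tor_elt R x) = c j" if j: "j \<in> {1..6}" for j
  proof -
    have "\<alpha> j (tor_elt R x) = (\<Prod>i\<in>{1..6}. \<Prod>k\<in>{1..6}. d k powi (E6_adjugate k i * E6_cartan i j))"
      unfolding simple_root_tor_elt_powi [OF x j] by (simp add: x_def prod_powi power_int_mult)
    also have "\<dots> = (\<Prod>k\<in>{1..6}. \<Prod>i\<in>{1..6}. d k powi (E6_adjugate k i * E6_cartan i j))"
      by (rule prod.swap)
    also have "\<dots> = (\<Prod>k\<in>{1..6}. d k powi (if k = j then 3 else 0))"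
    proof (rule prod.cong)
      fix k :: nat assume k: "k \<in> {1..6}"
      show "(\<Prod>i\<in>{1..6}. d k powi (E6_adjugate k i * E6_cartan i j)) = d k powi (if k = j then 3 else 0)"
        unfolding powi_prod [OF nz [OF k]] E6_adjugate_cartan [OF k j] ..
    qed simp
    also have "\<dots> = (\<Prod>k\<in>{1..6}. if k = j then d k ^ 3 else 1)"
      by (intro prod.cong) auto
    also have "\<dots> = c j" using j d by simp
    finally show ?thesis .
  qed
  then show ?thesis using x by (intro bexI [of _ "tor_elt R x"]) auto
qed

lemma conj_by_torus_lift:
  assumes i: "i \<in> {1..6}" and t: "t \<in> T" and x: "units x"
  shows "conj_by t (tor_elt R x ** sigma R i) = tor_elt R (x(i := x i * \<alpha> i t)) ** sigma R i"
proof -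
  have nz: "\<alpha> i t \<noteq> 0" using i t by (simp add: simple_root_simps)
  have \<sigma>: "invertible (sigma R i)" using i by simp
  have "conj_by t (sigma R i) = t ** conj_by (sigma R i) (minv t) ** sigma R i"
    using \<sigma> by (simp add: conj_by_def mult_assoc)
  also have "conj_by (sigma R i) (minv t) = minv t ** \<alpha>v i (\<alpha> i t)"
    using i t nz \<sigma>
    by (simp add: sigma_conj simple_root_root simple_root_simps simple_coroot_simps)
  also have "t ** (minv t ** \<alpha>v i (\<alpha> i t)) ** sigma R i = \<alpha>v i (\<alpha> i t) ** sigma R i"
    using t by (simp add: mult_assoc)
  finally have "conj_by t (tor_elt R x ** sigma R i) = tor_elt R x ** (\<alpha>v i (\<alpha> i t) ** sigma R i)"
    using t x by (simp add: conj_by_mult conj_by_T)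
  also have "\<dots> = tor_elt R (\<lambda>k. x k * ((\<lambda>_. 1)(i := \<alpha> i t)) k) ** sigma R i"
    using i nz x tor_elt_mult [OF x units_intros(5) [OF units_intros(2) nz]]
    by (simp add: matrix_mul_assoc coroot_eq_tor_elt)
  also have "tor_elt R (\<lambda>k. x k * ((\<lambda>_. 1)(i := \<alpha> i t)) k) = tor_elt R (x(i := x i * \<alpha> i t))"
    by (rule tor_elt_cong) simp
  finally show ?thesis .
qed

lemma T_conjugate_iff:
  assumes S: "\<S> \<in> sections R" and S': "\<S>' \<in> sections R"
  shows "T_conjugate R \<S> \<S>' \<longleftrightarrow> (\<exists>y. has_y_value R \<S> y \<and> has_y_value R \<S>' y)"
proof
  assume "T_conjugate R \<S> \<S>'"
  then obtain t where t: "t \<in> T" "\<And>w. w \<in> carrier W \<Longrightarrow> conj_by t (\<S> w) = \<S>' w"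
    by (auto simp: T_conjugate_def conj_by_def)
  obtain y where y: "has_y_value R \<S> y" using section_has_y_value [OF S] by blast
  then have y3: "y ^ 3 = 1" by (simp add: has_y_value_def)
  have "has_y_value R \<S>' y"
    unfolding has_y_value_def
  proof (intro conjI ballI y3)
    fix i :: nat assume i: "i \<in> {1..6}"
    obtain z where z: "z \<noteq> 0" "\<S> (s i) = tor_elt R ((E6_coords y)(i := z)) ** sigma R i"
      using has_y_valueE [OF y i] by metis
    have "\<S>' (s i) = conj_by t (\<S> (s i))" using t(2) weyl.s_closed [OF i] by simp
    also have "\<dots> = tor_elt R ((E6_coords y)(i := z * \<alpha> i t)) ** sigma R i"
      using conj_by_torus_lift [OF i t(1) units_E6_coords(1) [OF y3 z(1)]] z(2) by simp
    finally show "\<exists>z. z \<noteq> 0 \<and> \<S>' (s i) = tor_elt R ((E6_coords y)(i := z)) ** sigma R i"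
      using z(1) i t(1) simple_root_simps(2) by (intro exI [of _ "z * \<alpha> i t"]) auto
  qed
  then show "\<exists>y. has_y_value R \<S> y \<and> has_y_value R \<S>' y" using y by blast
next
  assume "\<exists>y. has_y_value R \<S> y \<and> has_y_value R \<S>' y"
  then obtain y where y: "has_y_value R \<S> y" "has_y_value R \<S>' y" by blast
  then have y3: "y ^ 3 = 1" by (simp add: has_y_value_def)
  obtain z where z: "\<And>i. i \<in> {1..6} \<Longrightarrow> z i \<noteq> 0"
    "\<And>i. i \<in> {1..6} \<Longrightarrow> \<S> (s i) = tor_elt R ((E6_coords y)(i := z i)) ** sigma R i"
    using y(1) unfolding has_y_value_def by metis
  obtain z' where z': "\<And>i. i \<in> {1..6} \<Longrightarrow> z' i \<noteq> 0"
    "\<And>i. i \<in> {1..6} \<Longrightarrow> \<S>' (s i) = tor_elt R ((E6_coords y)(i := z' i)) ** sigma R i"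
    using y(2) unfolding has_y_value_def by metis
  have "\<exists>t\<in>T. \<forall>i\<in>{1..6}. \<alpha> i t = z' i / z i"
    using z(1) z'(1) by (intro exists_tor_elt_roots) simp
  then obtain t where t: "t \<in> T" "\<And>i. i \<in> {1..6} \<Longrightarrow> \<alpha> i t = z' i / z i" by blast
  have conj_simple: "conj_by t (\<S> (s i)) = \<S>' (s i)" if i: "i \<in> {1..6}" for i
  proof -
    have "z i * \<alpha> i t = z' i" using t(2) [OF i] z(1) [OF i] by simp
    then show ?thesis
      using conj_by_torus_lift [OF i t(1) units_E6_coords(1) [OF y3 z(1) [OF i]]] z(2) [OF i] z'(2) [OF i]
      by simp
  qed
  have "conj_by t (\<S> w) = \<S>' w" if "w \<in> carrier W" for w
  proof -
    obtain u where u: "reduced R u" "word_prod R u = w" using exists_reduced_word \<open>w \<in> _\<close> by blast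
    have "conj_by t (lift_word (\<lambda>i. \<S> (s i)) u) = lift_word (\<lambda>i. \<S>' (s i)) u"
      using reduced_subset [OF u(1)] t(1)
      by (induction u) (simp_all add: conj_by_mult conj_simple)
    then show ?thesis using section_word [OF S u(1)] section_word [OF S' u(1)] u(2) by simp
  qed
  then show "T_conjugate R \<S> \<S>'" using t(1) by (auto simp: T_conjugate_def conj_by_def)
qed

lemma tor_elt_pow: "units x \<Longrightarrow> tor_elt R x [^]\<^bsub>GLn\<^esub> (m::nat) = tor_elt R (\<lambda>k. x k ^ m)"
  by (induction m) (auto simp: tor_elt_mult units_intros mult.commute)

lemma sigma_not_T: "i \<in> {1..6} \<Longrightarrow> sigma R i \<notin> T"
proof
  assume i: "i \<in> {1..6}" and T: "sigma R i \<in> T"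
  have "act_char (sigma R i) (\<alpha> i) = \<alpha> i"
    using act_char_T_mult [OF T, of "mat 1" "\<alpha> i"] i
    by (simp add: root_character simple_root_root act_char_one)
  then show False
    using neg_root_act [OF simple_root_root [OF i]] positive_simple_root [OF i]
      positive_neg [OF simple_root_root [OF i]] by simp
qed

text \<open>The coordinates of \<open>c\<^sup>2 \<alpha>\<^sub>i\<^sup>\<or>(-1)\<close> for the central element \<open>c = (y\<^sup>2, 1, y, 1, y\<^sup>2, y)\<close>.\<close>
definition square_coords :: "'a \<Rightarrow> nat \<Rightarrow> nat \<Rightarrow> 'a" where
  "square_coords y i = (\<lambda>k. E6_coords y k ^ 2)(i := - (E6_coords y i ^ 2))"

lemma lift_square:
  assumes i: "i \<in> {1..6}" and y: "y ^ 3 = 1" and z: "z \<noteq> 0"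
  shows "(tor_elt R ((E6_coords y)(i := z)) ** sigma R i) ** (tor_elt R ((E6_coords y)(i := z)) ** sigma R i)
    = tor_elt R (square_coords y i)" (is "(tor_elt R ?x ** _) ** _ = _")
proof -
  note u = units_E6_coords(1) [OF y z, of i]
  note u' = units_reflect [OF i u]
  have u1: "units ((\<lambda>_. 1)(i := -1))" by (simp add: units_def)
  have "(tor_elt R ?x ** sigma R i) ** (tor_elt R ?x ** sigma R i)
      = tor_elt R ?x ** (tor_elt R (reflect i ?x) ** tor_elt R ((\<lambda>_. 1)(i := -1)))"
    using i u by (simp add: mult_assoc sigma_tor_elt sigma_square coroot_eq_tor_elt)
  also have "\<dots> = tor_elt R (\<lambda>k. ?x k * (reflect i ?x k * ((\<lambda>_. 1)(i := -1)) k))"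
    by (simp only: tor_elt_mult [OF u' u1] tor_elt_mult [OF u units_intros(1) [OF u' u1]])
  also have "\<dots> = tor_elt R (square_coords y i)"
  proof (rule tor_elt_cong)
    fix k :: nat assume "k \<in> {1..6}"
    show "?x k * (reflect i ?x k * ((\<lambda>_. 1)(i := -1)) k) = square_coords y i k"
      using z simple_root_E6_coords [OF i y z]
      by (auto simp: reflect_def square_coords_def power2_eq_square)
  qed
  finally show ?thesis .
qed

lemma units_square_coords: "\<lbrakk>i \<in> {1..6}; y ^ 3 = 1\<rbrakk> \<Longrightarrow> units (square_coords y i)"
  using unitsD [OF units_E6_coords(2)] by (auto simp: square_coords_def units_def)

text \<open>
  A lift of a simple reflection lies outside \<open>T\<close> and its square inside, so only even powers can be
  trivial.
\<close>
lemma lift_pow_eq_one_iff: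
  assumes S: "has_y_value R \<S> y" and i: "i \<in> {1..6}"
  shows "\<S> (s i) [^]\<^bsub>GLn\<^esub> (k::nat) = mat 1 \<longleftrightarrow>
    even k \<and> (\<forall>l\<in>{1..6}. square_coords y i l ^ (k div 2) = 1)"
proof -
  interpret GL: group "GLn :: ('a ^ 'n ^ 'n) monoid" by (rule group_GLn)
  obtain z where y: "y ^ 3 = 1" and z: "z \<noteq> 0" "\<S> (s i) = tor_elt R ((E6_coords y)(i := z)) ** sigma R i"
    using has_y_valueE [OF S i] .
  let ?n = "\<S> (s i)"
  have tx: "tor_elt R ((E6_coords y)(i := z)) \<in> T" using units_E6_coords(1) [OF y z(1)] by simp
  have n: "?n \<in> carrier GLn" using z(2) tx i by (simp add: invertible_mult)
  have nT: "?n \<notin> T"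
  proof
    assume "?n \<in> T"
    then have "minv (tor_elt R ((E6_coords y)(i := z))) ** ?n \<in> T" using tx by simp
    then show False using z(2) tx sigma_not_T [OF i] by simp
  qed
  have even_pow: "?n [^]\<^bsub>GLn\<^esub> (2 * m) = tor_elt R (\<lambda>l. square_coords y i l ^ m)" for m :: nat
  proof -
    have "?n [^]\<^bsub>GLn\<^esub> (2 * m) = (?n [^]\<^bsub>GLn\<^esub> (2::nat)) [^]\<^bsub>GLn\<^esub> m"
      using GL.nat_pow_pow [OF n] by simp
    also have "?n [^]\<^bsub>GLn\<^esub> (2::nat) = tor_elt R (square_coords y i)"
      using n lift_square [OF i y z(1)] z(2) by (simp add: numeral_2_eq_2)
    finally show ?thesis using units_square_coords [OF i y] by (simp add: tor_elt_pow)
  qed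
  have u: "units (\<lambda>l. square_coords y i l ^ m)" for m using units_square_coords [OF i y] by auto
  show ?thesis
  proof (cases "even k")
    case True
    then obtain m where k: "k = 2 * m" by blast
    have "tor_elt R (\<lambda>l. square_coords y i l ^ m) = mat 1 \<longleftrightarrow> (\<forall>l\<in>{1..6}. square_coords y i l ^ m = 1)"
      using tor_elt_eq_iff [OF u units_intros(2)] by simp
    then show ?thesis using even_pow k by simp
  next
    case False
    then obtain m where k: "k = Suc (2 * m)" by (auto elim: oddE)
    let ?t = "tor_elt R (\<lambda>l. square_coords y i l ^ m)"
    have t: "?t \<in> T" using u by simp
    have "?n [^]\<^bsub>GLn\<^esub> k = ?t ** ?n" using even_pow k by simp
    moreover have "?t ** ?n \<noteq> mat 1"
    proof
      assume "?t ** ?n = mat 1"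
      then have "?n = minv ?t" using t by (simp add: minv_unique)
      then show False using nT t by simp
    qed
    ultimately show ?thesis using False by simp
  qed
qed

text \<open>
  Some coordinate other than the \<open>i\<close>-th is \<open>y\<^sup>2\<close> and detects the order of \<open>y\<close>; the \<open>i\<close>-th one then
  detects the order of \<open>-1\<close>.
\<close>
lemma square_coords_pow_eq_one_iff:
  assumes i: "i \<in> {1..6}" and y: "y ^ 3 = 1"
  shows "(\<forall>l\<in>{1..6}. square_coords y i l ^ m = 1) \<longleftrightarrow>
    (if CHAR('a) = 2 then 1 else 2) dvd m \<and> (y = 1 \<or> 3 dvd m)"
proof
  assume all: "\<forall>l\<in>{1..6}. square_coords y i l ^ m = 1"
  have y_m: "y ^ m = 1"
  proof -
    (* the central element has coordinate y at the nodes 3 and 6, and one of them is not i *)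
    define l :: nat where "l = (if i = 3 then 6 else 3)"
    have l: "l \<in> {1..6}" and sq: "square_coords y i l = y ^ 2"
      by (auto simp: l_def square_coords_def)
    have "(y ^ 2) ^ m = 1" using all [rule_format, OF l] unfolding sq .
    then have "(y ^ m) ^ 2 = 1" by (simp add: mult.commute flip: power_mult)
    moreover have "(y ^ m) ^ 3 = (y ^ 3) ^ m" by (simp add: mult.commute flip: power_mult)
    then have "(y ^ m) ^ 3 = 1" using y by simp
    ultimately show ?thesis by (simp add: power3_eq_cube power2_eq_square)
  qed
  have "E6_coords y i ^ m = 1"
    using i y_m unfolding nodes by (auto simp: power_mult [symmetric] mult.commute [of 2]) (simp_all add: power_mult)
  then have "(E6_coords y i ^ 2) ^ m = 1" by (simp add: mult.commute [of 2] flip: power_mult) (simp add: power_mult)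
  moreover have "(- (E6_coords y i ^ 2)) ^ m = 1" using all [rule_format, OF i] by (simp add: square_coords_def)
  ultimately have "(-1 :: 'a) ^ m = 1" by (simp add: power_minus [of "E6_coords y i ^ 2"])
  then have "(if CHAR('a) = 2 then 1 else 2) dvd m" by (simp only: minus_one_power_eq_one_iff)
  moreover have "y = 1 \<or> 3 dvd m" using cube_root_of_unity_power [OF y] y_m by blast
  ultimately show "(if CHAR('a) = 2 then 1 else 2) dvd m \<and> (y = 1 \<or> 3 dvd m)" by blast
next
  assume "(if CHAR('a) = 2 then 1 else 2) dvd m \<and> (y = 1 \<or> 3 dvd m)"
  then have m: "(-1 :: 'a) ^ m = 1" "y = 1 \<or> 3 dvd m" by (simp_all only: minus_one_power_eq_one_iff)
  have c: "(E6_coords y l ^ 2) ^ m = 1" if l: "l \<in> {1..6}" for l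
  proof (cases "y = 1")
    case True
    then show ?thesis using l unfolding nodes by auto
  next
    case False
    then obtain q where "m = 3 * q" using m(2) by blast
    then have "(E6_coords y l ^ 2) ^ m = (E6_coords y l ^ 3) ^ (2 * q)"
      by (simp add: mult_ac flip: power_mult)
    then show ?thesis using E6_coords_cube [OF l y] by simp
  qed
  show "\<forall>l\<in>{1..6}. square_coords y i l ^ m = 1"
  proof
    fix l :: nat assume l: "l \<in> {1..6}"
    show "square_coords y i l ^ m = 1"
      using c [OF l] m(1) by (cases "l = i") (simp_all add: square_coords_def power_minus [of "E6_coords y i ^ 2"])
  qed
qed

lemma elt_order_lift:
  assumes S: "has_y_value R \<S> y" and i: "i \<in> {1..6}"
  shows "elt_order (\<S> (s i)) = enat ((if y = 1 then 2 else 6) * (if CHAR('a) = 2 then 1 else 2))"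
proof -
  interpret GL: group "GLn :: ('a ^ 'n ^ 'n) monoid" by (rule group_GLn)
  let ?d = "(if y = 1 then 2 else 6) * (if CHAR('a) = 2 then 1 else 2)"
  have y: "y ^ 3 = 1" using S by (simp add: has_y_value_def)
  obtain z where z: "z \<noteq> 0" "\<S> (s i) = tor_elt R ((E6_coords y)(i := z)) ** sigma R i"
    using has_y_valueE [OF S i] .
  have n: "\<S> (s i) \<in> carrier GLn"
    using z units_E6_coords(1) [OF y z(1)] i by (simp add: invertible_mult)
  have "\<S> (s i) [^]\<^bsub>GLn\<^esub> k = \<one>\<^bsub>GLn\<^esub> \<longleftrightarrow> ?d dvd k" for k :: nat
  proof -
    have "\<S> (s i) [^]\<^bsub>GLn\<^esub> k = \<one>\<^bsub>GLn\<^esub> \<longleftrightarrow>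
        even k \<and> (if CHAR('a) = 2 then 1 else 2) dvd (k div 2) \<and> (y = 1 \<or> 3 dvd (k div 2))"
      using lift_pow_eq_one_iff [OF S i] square_coords_pow_eq_one_iff [OF i y] by simp
    also have "\<dots> \<longleftrightarrow> ?d dvd k" by (cases "CHAR('a) = 2"; cases "y = 1"; simp; presburger)
    finally show ?thesis .
  qed
  then have "GL.ord (\<S> (s i)) = ?d" using GL.ord_unique [OF n] by blast
  then show ?thesis by (simp add: elt_order_def)
qed

definition profile_of_y :: "'a \<Rightarrow> nat \<Rightarrow> enat" where
  "profile_of_y y = (\<lambda>i\<in>{1..6}. enat ((if y = 1 then 2 else 6) * (if CHAR('a) = 2 then 1 else 2)))"

lemma order_profile_eq: "has_y_value R \<S> y \<Longrightarrow> order_profile R \<S> = profile_of_y y"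
  by (auto simp: order_profile_def profile_of_y_def elt_order_lift)

lemma profile_less_of_y: "profile_less (profile_of_y y) (profile_of_y y') \<longleftrightarrow> y \<noteq> 1 \<and> y' = 1"
  unfolding profile_less_def profile_of_y_def nodes by auto

lemma profile_of_y_neq_one: "profile_of_y y = profile_of_y 1 \<longleftrightarrow> y = 1"
proof
  assume "profile_of_y y = profile_of_y 1"
  from fun_cong [OF this, of 1] show "y = 1"
    by (simp add: profile_of_y_def split: if_splits)
qed simp

lemma profile_of_y_cong: "\<lbrakk>y \<noteq> 1; y' \<noteq> 1\<rbrakk> \<Longrightarrow> profile_of_y y = profile_of_y y'"
  by (simp add: profile_of_y_def)

lemma order_profiles_eq: "order_profiles R = profile_of_y ` {y. y ^ 3 = 1}"
proof (intro equalityI subsetI)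
  fix P assume "P \<in> order_profiles R"
  then obtain \<S> where S: "\<S> \<in> sections R" "P = order_profile R \<S>"
    by (auto simp: order_profiles_def)
  obtain y where "has_y_value R \<S> y" using section_has_y_value [OF S(1)] by blast
  then have "has_y_value R \<S> y" "P = profile_of_y y" using S(2) order_profile_eq by simp_all
  then show "P \<in> profile_of_y ` {y. y ^ 3 = 1}" by (auto simp: has_y_value_def)
next
  fix P assume "P \<in> profile_of_y ` {y. y ^ 3 = 1}"
  then obtain y where "y ^ 3 = 1" "P = profile_of_y y" by blast
  then show "P \<in> order_profiles R"
    using exists_section_with_y [of y] order_profile_eq by (force simp: order_profiles_def)
qed

lemma tits_profile: "order_profile R (tits_section R) = profile_of_y 1"
  by (rule order_profile_eq [OF tits_y_value])

lemma tits_optimal: "optimal R (tits_section R)"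
  unfolding optimal_def
proof (intro conjI allI impI)
  have one: "profile_of_y 1 \<in> order_profiles R" by (simp add: order_profiles_eq)
  show "tits_section R \<in> sections R" by (rule tits_section)
  show "maximal_profile R (order_profile R (tits_section R))"
    using one by (auto simp: maximal_profile_def tits_profile order_profiles_eq profile_less_of_y)
  fix P assume "maximal_profile R P"
  then obtain y where "P = profile_of_y y" "\<not> profile_less P (profile_of_y 1)"
    using one by (auto simp: maximal_profile_def order_profiles_eq)
  then show "P = order_profile R (tits_section R)"
    by (auto simp: tits_profile profile_less_of_y)
qed

lemma tits_square:
  assumes "CHAR('a) \<noteq> 2" and i: "i \<in> {1..6}"
  shows "tits_section R (s i) [^]\<^bsub>GLn\<^esub> (2::nat) \<noteq> \<one>\<^bsub>GLn\<^esub>"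
proof -
  have "\<not> (if CHAR('a) = 2 then 1 else 2) dvd (1 :: nat)" using assms(1) by simp
  then show ?thesis
    using lift_pow_eq_one_iff [OF tits_y_value i, of 2] square_coords_pow_eq_one_iff [OF i, of 1 1]
    by simp
qed

lemma second_profile:
  assumes "CHAR('a) \<noteq> 3"
  shows "\<exists>P. P \<noteq> order_profile R (tits_section R) \<and>
    order_profiles R = {order_profile R (tits_section R), P} \<and>
    (\<forall>\<S>\<in>sections R. order_profile R \<S> = P \<longleftrightarrow> (\<exists>y. y \<noteq> 1 \<and> has_y_value R \<S> y)) \<and>
    (CHAR('a) \<noteq> 2 \<longrightarrow> (\<forall>i\<in>{1..6}. P i = 12))"
proof -
  obtain \<omega> :: 'a where \<omega>: "\<omega> ^ 3 = 1" "\<omega> \<noteq> 1" using exists_cube_root_of_unity assms by blast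
  have dichotomy: "profile_of_y y = (if y = 1 then profile_of_y 1 else profile_of_y \<omega>)" for y
    using profile_of_y_cong [OF _ \<omega>(2)] by simp
  have neq: "profile_of_y \<omega> \<noteq> profile_of_y 1" using \<omega>(2) profile_of_y_neq_one by blast
  have "order_profiles R = {profile_of_y 1, profile_of_y \<omega>}"
  proof (intro equalityI subsetI)
    fix P assume "P \<in> order_profiles R"
    then obtain y where "P = profile_of_y y" by (auto simp: order_profiles_eq)
    then show "P \<in> {profile_of_y 1, profile_of_y \<omega>}" using dichotomy [of y] by (cases "y = 1") simp_all
  next
    fix P assume "P \<in> {profile_of_y 1, profile_of_y \<omega>}"
    then show "P \<in> order_profiles R" using \<omega>(1) by (auto simp: order_profiles_eq)
  qed
  moreover have "order_profile R \<S> = profile_of_y \<omega> \<longleftrightarrow> (\<exists>y. y \<noteq> 1 \<and> has_y_value R \<S> y)"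
    if S: "\<S> \<in> sections R" for \<S>
  proof -
    obtain y where y: "has_y_value R \<S> y" using section_has_y_value [OF S] by blast
    have "order_profile R \<S> = profile_of_y \<omega> \<longleftrightarrow> y \<noteq> 1"
      using order_profile_eq [OF y] dichotomy [of y] neq by auto
    also have "\<dots> \<longleftrightarrow> (\<exists>y. y \<noteq> 1 \<and> has_y_value R \<S> y)" using y y_value_unique by blast
    finally show ?thesis .
  qed
  moreover have "profile_of_y \<omega> i = 12" if "CHAR('a) \<noteq> 2" "i \<in> {1..6}" for i
    using that \<omega>(2) by (simp add: profile_of_y_def numeral_eq_enat)
  ultimately show ?thesis
    using neq unfolding tits_profile by (intro exI [of _ "profile_of_y \<omega>"]) blast
qed

end

theorem proposition3p21:
  fixes R :: "('a::alg_closed_field, 'n::finite) realization"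
  assumes "simply_connected_E6 R"
  shows "optimal R (tits_section R) \<and>
    (CHAR('a) \<noteq> 2 \<longrightarrow>
      (\<forall>i\<in>{1..6}. tits_section R (simple_reflection R i) [^]\<^bsub>GLn\<^esub> (2::nat) \<noteq> \<one>\<^bsub>GLn\<^esub>)) \<and>
    (CHAR('a) \<noteq> 3 \<longrightarrow>
      (\<exists>P. P \<noteq> order_profile R (tits_section R) \<and>
        order_profiles R = {order_profile R (tits_section R), P} \<and>
        (\<forall>\<S>\<in>sections R. order_profile R \<S> = P \<longleftrightarrow> (\<exists>y. y \<noteq> 1 \<and> has_y_value R \<S> y)) \<and>
        (CHAR('a) \<noteq> 2 \<longrightarrow> (\<forall>i\<in>{1..6}. P i = 12)))) \<and>
    (\<forall>\<S>\<in>sections R. \<forall>\<S>'\<in>sections R.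
      T_conjugate R \<S> \<S>' \<longleftrightarrow> (\<exists>y. has_y_value R \<S> y \<and> has_y_value R \<S>' y))"
proof -
  interpret E6_group R by unfold_locales (rule assms)
  show ?thesis
    by (intro conjI impI ballI tits_optimal tits_square second_profile T_conjugate_iff)
qed

end
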